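(* Let $m\in\mathbb{N}$, let $J=\bigcup_{j=0}^{m-1}[a_j+b_j,\,a_{j+1}+b_j)$, where $0=a_0<a_1<\dots<a_{m-1}<a_m=1$ and $0=b_0<b_1<\dots<b_{m-1}$ are real numbers, and let $\beta\ge 1$ be real. Let $\Lambda=\{n+\delta_n^* : n\in\mathbb{Z}\}$, where $$\delta_n^*=\begin{cases}\frac{\lfloor \beta n\rfloor+1}{\beta}-n & \text{if } \{\beta n\}\ge \frac12,\\ \frac{\lfloor \beta n\rfloor}{\beta}-n & \text{if } \{\beta n\}<\frac12.\end{cases}$$ If $\frac{b_k}{\beta}\in\mathbb{Z}$ for all $k=1,\dots,m-1$, then the set $\mathcal{E}\!\left(\frac1\Delta\mathbb{Z}\setminus\Lambda\right)$ is an exponential basis for $L^2([0,\Delta]\setminus J)$, where $$\Delta=\left\lceil\frac{1+b_{m-1}}{\beta}\right\rceil\beta .$$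
   Context: For a set $\Gamma\subset\mathbb{R}$, $\mathcal{E}(\Gamma)=\{e^{2\pi i\lambda x}\}_{\lambda\in\Gamma}$. For real $x$, $\lfloor x\rfloor$ is the largest integer $\le x$, $\lceil x\rceil$ is the smallest integer $\ge x$, and $\{x\}=x-\lfloor x\rfloor$. For measurable $D\subset\mathbb{R}$, an exponential basis for $L^2(D)$ is an unconditional Schauder basis of $L^2(D)$ consisting of functions $e^{2\pi i\lambda x}$ with real $\lambda$ (for sets of finite measure, equivalently, a Riesz basis of $L^2(D)$ consisting of such exponentials). *)

theory Defs
  imports "HOL-Analysis.Analysis"
begin

section \<open>The space of square-integrable functions on a set\<close>

text \<open>
  Elements of \<open>L\<^sup>2(D)\<close> are represented by functions on the whole line, of which only the values
  on \<open>D\<close> matter; two of them represent the same element iff \<open>L2_norm D (f - g) = 0\<close>.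
\<close>

definition L2_on :: "real set \<Rightarrow> (real \<Rightarrow> complex) set" where
  "L2_on D = {f. f \<in> borel_measurable (lebesgue_on D) \<and>
                 integrable (lebesgue_on D) (\<lambda>x. (cmod (f x))\<^sup>2)}"

definition L2_norm :: "real set \<Rightarrow> (real \<Rightarrow> complex) \<Rightarrow> real" where
  "L2_norm D f = sqrt (\<integral>x. (cmod (f x))\<^sup>2 \<partial>lebesgue_on D)"

section \<open>Unconditional Schauder bases\<close>

text \<open>
  Sequences are indexed by a set \<open>I\<close> of natural numbers in its natural order, so that finite and
  empty sequences are covered along with infinite ones. Coefficients are normalised outside \<open>I\<close>
  by \<^const>\<open>extensional\<close>, which makes their uniqueness meaningful.
\<close>

definition series_converges ::
    "real set \<Rightarrow> nat set \<Rightarrow> (nat \<Rightarrow> real \<Rightarrow> complex) \<Rightarrow> (nat \<Rightarrow> complex) \<Rightarrow> (real \<Rightarrow> complex) \<Rightarrow> bool" where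
  "series_converges D I e c f \<longleftrightarrow>
     (\<lambda>N. L2_norm D (\<lambda>x. f x - (\<Sum>n\<in>I \<inter> {..<N}. c n * e n x))) \<longlonglongrightarrow> 0"

text \<open>
  Unconditional convergence is convergence of the net of all finite partial sums, as in
  \<^const>\<open>has_sum\<close>.
\<close>

definition series_converges_unconditionally ::
    "real set \<Rightarrow> nat set \<Rightarrow> (nat \<Rightarrow> real \<Rightarrow> complex) \<Rightarrow> (nat \<Rightarrow> complex) \<Rightarrow> (real \<Rightarrow> complex) \<Rightarrow> bool" where
  "series_converges_unconditionally D I e c f \<longleftrightarrow>
     ((\<lambda>F. L2_norm D (\<lambda>x. f x - (\<Sum>n\<in>F. c n * e n x))) \<longlongrightarrow> 0) (finite_subsets_at_top I)"

definition schauder_basis :: "real set \<Rightarrow> nat set \<Rightarrow> (nat \<Rightarrow> real \<Rightarrow> complex) \<Rightarrow> bool" where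
  "schauder_basis D I e \<longleftrightarrow>
     (\<forall>n\<in>I. e n \<in> L2_on D) \<and>
     (\<forall>f\<in>L2_on D. \<exists>!c. c \<in> extensional I \<and> series_converges D I e c f)"

definition unconditional_schauder_basis :: "real set \<Rightarrow> nat set \<Rightarrow> (nat \<Rightarrow> real \<Rightarrow> complex) \<Rightarrow> bool" where
  "unconditional_schauder_basis D I e \<longleftrightarrow>
     schauder_basis D I e \<and>
     (\<forall>f\<in>L2_on D. \<forall>c. series_converges D I e c f \<longrightarrow> series_converges_unconditionally D I e c f)"

section \<open>Exponential bases\<close>

definition exponentials :: "real set \<Rightarrow> (real \<Rightarrow> complex) set" where
  "exponentials \<Gamma> = (\<lambda>\<gamma> x. exp (2 * of_real pi * \<i> * of_real \<gamma> * of_real x)) ` \<Gamma>"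

text \<open>
  A set of functions is an unconditional basis if some enumeration of it without repetitions is
  one; by unconditionality the choice of the enumeration is irrelevant.
\<close>

definition exponential_basis :: "real set \<Rightarrow> (real \<Rightarrow> complex) set \<Rightarrow> bool" where
  "exponential_basis D B \<longleftrightarrow>
     (\<exists>\<Gamma>. B = exponentials \<Gamma>) \<and>
     (\<exists>I e. bij_betw e I B \<and> unconditional_schauder_basis D I e)"

section \<open>The perturbation of the integers\<close>

definition delta_star :: "real \<Rightarrow> int \<Rightarrow> real" where
  "delta_star \<beta> n =
     (if frac (\<beta> * of_int n) \<ge> 1 / 2
      then (of_int \<lfloor>\<beta> * of_int n\<rfloor> + 1) / \<beta> - of_int n
      else of_int \<lfloor>\<beta> * of_int n\<rfloor> / \<beta> - of_int n)"

end

theory Submission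
  imports Defs
begin

text \<open>
  Write \<open>\<Lambda>\<close> for the set of the frequencies \<open>r / \<beta>\<close> where \<open>r\<close> is a multiple \<open>\<beta> n\<close> rounded to an
  integer. The exponentials with frequencies in \<open>\<Lambda>\<close> turn out to be a Riesz basis of \<open>L\<^sup>2([0,1))\<close>. They have
  period \<open>\<beta>\<close>, so they do not notice translations by the multiples \<open>b k\<close> of \<open>\<beta>\<close>, and since \<open>J\<close> is
  \<open>[0,1)\<close> cut into pieces that are translated in this way, they are a Riesz basis of \<open>L\<^sup>2(J)\<close>, too
  (locale \<open>rearrangement\<close>). Finally \<open>J\<close> is contained in \<open>[0,\<Delta>]\<close> and \<open>\<Lambda>\<close> in the lattice of
  frequencies \<open>k / \<Delta>\<close>, whose exponentials are an orthogonal basis of \<open>L\<^sup>2([0,\<Delta>])\<close>, because \<open>\<Delta>\<close> is an integer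
  multiple of \<open>\<beta>\<close>. By a duality for orthogonal bases, the complementary frequencies then form a Riesz
  basis on the complementary set (locale \<open>complementary_frequencies\<close>): if \<open>P\<close> and \<open>Q\<close> are the
  orthogonal projections that belong to a set and to a part of the basis, the compression of \<open>P\<close> to
  the range of \<open>Q\<close> is invertible iff the compression of \<open>1 - P\<close> to the range of \<open>1 - Q\<close> is.

  It remains to treat \<open>[0,1)\<close>. The distance between \<open>r / \<beta>\<close> and \<open>n\<close> is at most \<open>1 / (2 \<beta>)\<close>, so for
  \<open>\<beta> > 2\<close> Kadec's 1/4-theorem applies. For \<open>\<beta> < 2\<close> the same duality helps once more, now inside
  \<open>[0,\<beta>]\<close> with its orthogonal basis of frequencies \<open>k / \<beta>\<close>. The fractions that are left over by the
  rounding are themselves rounded: they are close to the odd multiples of \<open>\<gamma> / (2 \<beta>)\<close> where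
  \<open>1 / \<beta> + 1 / \<gamma> = 1\<close>, and \<open>\<gamma> > 2\<close>. So Kadec's theorem provides a Riesz basis on \<open>[1,\<beta>]\<close> with these
  frequencies, and passing to complements gives \<open>\<Lambda>\<close> on \<open>[0,1)\<close>. In the remaining cases \<open>\<beta> = 1\<close> and
  \<open>\<beta> = 2\<close> nothing is rounded (lemma \<open>rounded_multiples_riesz\<close>).

  All spaces are represented by finite exponential sums. A Riesz basis is a set of frequencies with a
  lower bound for the \<open>L\<^sup>2\<close>-norms of such sums in terms of their coefficients (\<open>bounded_below_on\<close>)
  and with a dense span (\<open>complete_on\<close>); the upper bound is Bessel's inequality on a larger interval.
  Inverse operators are replaced by successive approximation, which needs only that every problem can be
  reduced, up to a small error, to one that is smaller by a fixed factor (lemma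
  \<open>successive_approximation\<close>).
\<close>


section \<open>Square-integrable functions\<close>

lemma L2_onI:
  "f \<in> borel_measurable (lebesgue_on D) \<Longrightarrow> integrable (lebesgue_on D) (\<lambda>x. (cmod (f x))\<^sup>2)
    \<Longrightarrow> f \<in> L2_on D"
  by (simp add: L2_on_def)

lemma L2_on_measurable: "f \<in> L2_on D \<Longrightarrow> f \<in> borel_measurable (lebesgue_on D)"
  and L2_on_integrable: "f \<in> L2_on D \<Longrightarrow> integrable (lebesgue_on D) (\<lambda>x. (cmod (f x))\<^sup>2)"
  by (simp_all add: L2_on_def)

lemma L2_norm_nonneg [simp]: "0 \<le> L2_norm D f"
  by (simp add: L2_norm_def)

lemma L2_norm_squared: "(L2_norm D f)\<^sup>2 = (\<integral>x. (cmod (f x))\<^sup>2 \<partial>lebesgue_on D)"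
  by (simp add: L2_norm_def)

lemma L2_norm_cong: "(\<And>x. x \<in> D \<Longrightarrow> cmod (f x) = cmod (g x)) \<Longrightarrow> L2_norm D f = L2_norm D g"
  unfolding L2_norm_def by (auto intro!: arg_cong[of _ _ sqrt] Bochner_Integration.integral_cong)

lemma L2_on_cong: "(\<And>x. x \<in> D \<Longrightarrow> f x = g x) \<Longrightarrow> f \<in> L2_on D \<longleftrightarrow> g \<in> L2_on D"
  unfolding L2_on_def
  by (auto intro!: conj_cong measurable_lebesgue_cong Bochner_Integration.integrable_cong)

lemma L2_on_zero [simp]: "(\<lambda>_. 0) \<in> L2_on D"
  by (simp add: L2_on_def)

lemma L2_norm_zero [simp]: "L2_norm D (\<lambda>_. 0) = 0"
  by (simp add: L2_norm_def)

lemma L2_on_cmult: "f \<in> L2_on D \<Longrightarrow> (\<lambda>x. c * f x) \<in> L2_on D"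
  unfolding L2_on_def by (auto simp: norm_mult power_mult_distrib)

lemma L2_norm_cmult: "L2_norm D (\<lambda>x. c * f x) = cmod c * L2_norm D f"
  by (simp add: L2_norm_def norm_mult power_mult_distrib real_sqrt_mult)

lemma L2_norm_minus: "L2_norm D (\<lambda>x. - f x) = L2_norm D f"
  by (rule L2_norm_cong) simp

lemma L2_norm_minus_commute: "L2_norm D (\<lambda>x. f x - g x) = L2_norm D (\<lambda>x. g x - f x)"
  by (rule L2_norm_cong) (simp add: norm_minus_commute)

text \<open>
  Weighted form of \<open>2 u v \<le> t u\<^sup>2 + v\<^sup>2 / t\<close>. Integrating it and optimising the weight gives
  Minkowski's inequality.
\<close>

lemma norm_add_squared_le:
  fixes u v :: complex
  assumes "t > 0"
  shows "(cmod (u + v))\<^sup>2 \<le> (1 + t) * (cmod u)\<^sup>2 + (1 + 1 / t) * (cmod v)\<^sup>2"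
proof -
  have "(cmod (u + v))\<^sup>2 \<le> (cmod u + cmod v)\<^sup>2"
    by (intro power_mono norm_triangle_ineq) auto
  moreover have "2 * cmod u * cmod v \<le> t * (cmod u)\<^sup>2 + (cmod v)\<^sup>2 / t"
  proof -
    have "0 \<le> (sqrt t * cmod u - cmod v / sqrt t)\<^sup>2" by simp
    also have "\<dots> = t * (cmod u)\<^sup>2 + (cmod v)\<^sup>2 / t - 2 * cmod u * cmod v"
      using assms by (simp add: power2_diff power_mult_distrib power_divide)
    finally show ?thesis by simp
  qed
  ultimately show ?thesis by (simp add: power2_sum algebra_simps)
qed

lemma L2_on_add:
  assumes f: "f \<in> L2_on D" and g: "g \<in> L2_on D"
  shows "(\<lambda>x. f x + g x) \<in> L2_on D"
proof (rule L2_onI)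
  note [measurable] = L2_on_measurable[OF f] L2_on_measurable[OF g]
  show "(\<lambda>x. f x + g x) \<in> borel_measurable (lebesgue_on D)" by measurable
  show "integrable (lebesgue_on D) (\<lambda>x. (cmod (f x + g x))\<^sup>2)"
  proof (rule Bochner_Integration.integrable_bound)
    show "integrable (lebesgue_on D) (\<lambda>x. 2 * (cmod (f x))\<^sup>2 + 2 * (cmod (g x))\<^sup>2)"
      using L2_on_integrable[OF f] L2_on_integrable[OF g] by simp
    show "AE x in lebesgue_on D. norm ((cmod (f x + g x))\<^sup>2) \<le>
        norm (2 * (cmod (f x))\<^sup>2 + 2 * (cmod (g x))\<^sup>2)"
      using norm_add_squared_le[of 1] by (intro always_eventually) auto
  qed measurable
qed

lemma L2_on_diff: "f \<in> L2_on D \<Longrightarrow> g \<in> L2_on D \<Longrightarrow> (\<lambda>x. f x - g x) \<in> L2_on D"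
  using L2_on_add[of f D "\<lambda>x. -1 * g x"] L2_on_cmult[of g D "-1"] by simp

lemma L2_on_sum: "(\<And>i. i \<in> F \<Longrightarrow> f i \<in> L2_on D) \<Longrightarrow> (\<lambda>x. \<Sum>i\<in>F. f i x) \<in> L2_on D"
  by (induction F rule: infinite_finite_induct) (auto intro: L2_on_add)

lemma L2_norm_triangle:
  assumes f: "f \<in> L2_on D" and g: "g \<in> L2_on D"
  shows "L2_norm D (\<lambda>x. f x + g x) \<le> L2_norm D f + L2_norm D g"
proof -
  let ?a = "L2_norm D f" and ?b = "L2_norm D g"
  have bound: "L2_norm D (\<lambda>x. f x + g x) \<le> ?a + ?b + e" if "e > 0" for e
  proof (rule power2_le_imp_le)
    \<comment> \<open>The optimal weight is the quotient of the norms; adding \<open>e / 2\<close> makes both positive.\<close>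
    define p q where "p = ?a + e / 2" and "q = ?b + e / 2"
    have pq: "p > 0" "q > 0" "?a\<^sup>2 \<le> p\<^sup>2" "?b\<^sup>2 \<le> q\<^sup>2"
      using that by (auto simp: p_def q_def add_nonneg_pos intro!: power_mono)
    have "(L2_norm D (\<lambda>x. f x + g x))\<^sup>2
        \<le> (\<integral>x. (1 + q / p) * (cmod (f x))\<^sup>2 + (1 + 1 / (q / p)) * (cmod (g x))\<^sup>2 \<partial>lebesgue_on D)"
      unfolding L2_norm_squared
      using L2_on_integrable[OF L2_on_add[OF f g]] L2_on_integrable[OF f] L2_on_integrable[OF g] pq
      by (intro integral_mono norm_add_squared_le) auto
    also have "\<dots> = (1 + q / p) * ?a\<^sup>2 + (1 + 1 / (q / p)) * ?b\<^sup>2"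
      unfolding L2_norm_squared using L2_on_integrable[OF f] L2_on_integrable[OF g] by simp
    also have "\<dots> \<le> (1 + q / p) * p\<^sup>2 + (1 + 1 / (q / p)) * q\<^sup>2"
      using pq by (intro add_mono mult_left_mono) auto
    also have "\<dots> = (p + q)\<^sup>2"
      using pq by (simp add: field_simps power2_eq_square)
    finally show "(L2_norm D (\<lambda>x. f x + g x))\<^sup>2 \<le> (?a + ?b + e)\<^sup>2"
      by (simp add: p_def q_def algebra_simps)
  qed (use that in auto)
  show ?thesis using bound by (rule field_le_epsilon)
qed

lemma L2_norm_triangle_diff:
  assumes "f \<in> L2_on D" "g \<in> L2_on D"
  shows "L2_norm D (\<lambda>x. f x - g x) \<le> L2_norm D f + L2_norm D g"
  using L2_norm_triangle[of f D "\<lambda>x. -1 * g x"] L2_on_cmult[of g D "-1"] L2_norm_cmult[of D "-1" g] assms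
  by simp

lemma L2_norm_dist_triangle:
  assumes "f \<in> L2_on D" "g \<in> L2_on D" "h \<in> L2_on D"
  shows "L2_norm D (\<lambda>x. f x - h x) \<le> L2_norm D (\<lambda>x. f x - g x) + L2_norm D (\<lambda>x. g x - h x)"
  using L2_norm_triangle[OF L2_on_diff[OF assms(1,2)] L2_on_diff[OF assms(2,3)]] by simp

lemma L2_norm_sum_le:
  "(\<And>i. i \<in> F \<Longrightarrow> f i \<in> L2_on D) \<Longrightarrow> L2_norm D (\<lambda>x. \<Sum>i\<in>F. f i x) \<le> (\<Sum>i\<in>F. L2_norm D (f i))"
proof (induction F rule: infinite_finite_induct)
  case (insert i F)
  then show ?case
    using L2_norm_triangle[of "f i" D "\<lambda>x. \<Sum>i\<in>F. f i x"] L2_on_sum[of F f D] by fastforce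
qed auto

lemma L2_on_bounded:
  assumes "D \<in> lmeasurable" and f: "f \<in> borel_measurable (lebesgue_on D)"
    and "\<And>x. x \<in> D \<Longrightarrow> cmod (f x) \<le> B"
  shows "f \<in> L2_on D"
proof (rule L2_onI[OF f])
  note [measurable] = f
  show "integrable (lebesgue_on D) (\<lambda>x. (cmod (f x))\<^sup>2)"
  proof (rule Bochner_Integration.integrable_bound)
    show "integrable (lebesgue_on D) (\<lambda>_. B\<^sup>2)"
      using finite_measure.integrable_const[OF finite_measure_lebesgue_on[OF assms(1)]] .
    show "AE x in lebesgue_on D. norm ((cmod (f x))\<^sup>2) \<le> norm (B\<^sup>2)"
      using assms(3) by (intro AE_I2) (auto intro: power_mono)
  qed measurable
qed

lemma continuous_measurable_lebesgue_on:
  fixes f :: "real \<Rightarrow> complex"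
  assumes "continuous_on UNIV f"
  shows "f \<in> borel_measurable (lebesgue_on D)"
  using borel_measurable_continuous_onI[OF assms]
  by (simp add: measurable_completion measurable_restrict_space1)

lemma L2_on_mult_unimodular:
  assumes "f \<in> L2_on D" "continuous_on UNIV u" "\<And>x. cmod (u x) = 1"
  shows "(\<lambda>x. f x * u x) \<in> L2_on D"
  using assms continuous_measurable_lebesgue_on[OF assms(2), of D]
  by (auto simp: L2_on_def norm_mult)

subsection \<open>Restriction, extension by zero and change of variables\<close>

lemma
  assumes "D \<in> sets lebesgue"
  shows L2_on_iff_UNIV: "f \<in> L2_on D \<longleftrightarrow> (\<lambda>x. indicator D x *\<^sub>R f x) \<in> L2_on UNIV"
    and L2_norm_eq_UNIV: "L2_norm D f = L2_norm UNIV (\<lambda>x. indicator D x *\<^sub>R f x)"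
proof -
  have *: "(\<lambda>x. (cmod (indicator D x *\<^sub>R f x))\<^sup>2) = (\<lambda>x. indicator D x *\<^sub>R (cmod (f x))\<^sup>2)"
    by (auto simp: indicator_def)
  show "f \<in> L2_on D \<longleftrightarrow> (\<lambda>x. indicator D x *\<^sub>R f x) \<in> L2_on UNIV"
    unfolding L2_on_def mem_Collect_eq * using assms
    by (simp add: borel_measurable_restrict_space_iff integrable_restrict_space lebesgue_on_UNIV_eq)
  show "L2_norm D f = L2_norm UNIV (\<lambda>x. indicator D x *\<^sub>R f x)"
    unfolding L2_norm_def * using assms
    by (simp add: integral_restrict_space lebesgue_on_UNIV_eq)
qed

lemma L2_on_zero_extension:
  assumes "D \<in> sets lebesgue" "E \<in> sets lebesgue" "D \<subseteq> E" "f \<in> L2_on D"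
  shows "(\<lambda>x. indicator D x *\<^sub>R f x) \<in> L2_on E"
    and "L2_norm E (\<lambda>x. indicator D x *\<^sub>R f x) = L2_norm D f"
proof -
  have *: "(\<lambda>x. indicator E x *\<^sub>R indicator D x *\<^sub>R f x) = (\<lambda>x. indicator D x *\<^sub>R f x)"
    using assms(3) by (intro ext) (auto simp: indicator_def of_bool_def)
  show "(\<lambda>x. indicator D x *\<^sub>R f x) \<in> L2_on E"
    using L2_on_iff_UNIV[OF assms(1)] L2_on_iff_UNIV[OF assms(2)] assms(4) * by metis
  show "L2_norm E (\<lambda>x. indicator D x *\<^sub>R f x) = L2_norm D f"
    using L2_norm_eq_UNIV[OF assms(1)] L2_norm_eq_UNIV[OF assms(2)] * by metis
qed

lemma L2_on_subset:
  assumes "D \<in> sets lebesgue" "E \<in> sets lebesgue" "D \<subseteq> E" "f \<in> L2_on E"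
  shows "f \<in> L2_on D"
proof (rule L2_onI)
  show "f \<in> borel_measurable (lebesgue_on D)"
    using measurable_restrict_mono[OF L2_on_measurable[OF assms(4)] assms(3)] .
  have "set_integrable lebesgue E (\<lambda>x. (cmod (f x))\<^sup>2)"
    using L2_on_integrable[OF assms(4)] assms(2) by (simp add: set_integrable_def integrable_restrict_space)
  then have "set_integrable lebesgue D (\<lambda>x. (cmod (f x))\<^sup>2)"
    using set_integrable_subset assms(1,3) by blast
  then show "integrable (lebesgue_on D) (\<lambda>x. (cmod (f x))\<^sup>2)"
    using assms(1) by (simp add: set_integrable_def integrable_restrict_space)
qed

lemma L2_norm_squared_Un:
  assumes "C \<in> sets lebesgue" "D \<in> sets lebesgue" "C \<inter> D = {}" "f \<in> L2_on C" "f \<in> L2_on D"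
  shows "f \<in> L2_on (C \<union> D)" and "(L2_norm (C \<union> D) f)\<^sup>2 = (L2_norm C f)\<^sup>2 + (L2_norm D f)\<^sup>2"
proof -
  have eq: "(\<lambda>x. indicator (C \<union> D) x *\<^sub>R f x) = (\<lambda>x. indicator C x *\<^sub>R f x + indicator D x *\<^sub>R f x)"
    using assms(3) by (intro ext) (auto simp: indicator_def of_bool_def)
  show in_L2: "f \<in> L2_on (C \<union> D)"
    using L2_on_add[OF L2_on_iff_UNIV[THEN iffD1, OF assms(1,4)] L2_on_iff_UNIV[THEN iffD1, OF assms(2,5)]]
      L2_on_iff_UNIV[of "C \<union> D" f] assms(1,2) by (simp only: eq sets.Un)
  have int: "set_integrable lebesgue C (\<lambda>x. (cmod (f x))\<^sup>2)" "set_integrable lebesgue D (\<lambda>x. (cmod (f x))\<^sup>2)"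
    using assms by (auto simp: set_integrable_def L2_on_def integrable_restrict_space)
  have "(L2_norm S f)\<^sup>2 = (LINT x:S|lebesgue. (cmod (f x))\<^sup>2)" if "S \<in> sets lebesgue" for S
    using that by (simp add: L2_norm_squared set_lebesgue_integral_def integral_restrict_space)
  then show "(L2_norm (C \<union> D) f)\<^sup>2 = (L2_norm C f)\<^sup>2 + (L2_norm D f)\<^sup>2"
    using set_integral_Un[OF assms(3) int] assms by simp
qed

lemma L2_norm_squared_split:
  assumes "D \<in> sets lebesgue" "E \<in> sets lebesgue" "D \<subseteq> E" "f \<in> L2_on E"
  shows "(L2_norm E f)\<^sup>2 = (L2_norm D f)\<^sup>2 + (L2_norm (E - D) f)\<^sup>2"
proof -
  have "D \<union> (E - D) = E" using assms by auto
  then show ?thesis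
    using L2_norm_squared_Un(2)[of D "E - D" f] L2_on_subset[OF _ assms(2) _ assms(4)] assms(1-3) by auto
qed

lemma L2_norm_mono:
  assumes "D \<in> sets lebesgue" "E \<in> sets lebesgue" "D \<subseteq> E" "f \<in> L2_on E"
  shows "L2_norm D f \<le> L2_norm E f"
  by (rule power2_le_imp_le) (use L2_norm_squared_split[OF assms] in auto)

lemma affine_image_sets_lebesgue:
  fixes p q :: real
  assumes "D \<in> sets lebesgue" "p \<noteq> 0"
  shows "(\<lambda>x. q + p * x) ` D \<in> sets lebesgue"
proof -
  have meas: "(\<lambda>x. - q / p + (1 / p) * x) \<in> lebesgue \<rightarrow>\<^sub>M lebesgue"
    using lebesgue_affine_measurable[of "\<lambda>_. 1 / p" "- q / p"] assms(2) by simp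
  have "(\<lambda>x. q + p * x) ` D = (\<lambda>x. - q / p + (1 / p) * x) -` D"
    using assms(2) by (force simp: field_simps image_iff)
  then show ?thesis
    using measurable_sets[OF meas assms(1)] by simp
qed

lemma
  fixes p q :: real
  assumes D: "D \<in> sets lebesgue" and p: "p > 0"
  shows L2_on_affine: "f \<in> L2_on ((\<lambda>x. q + p * x) ` D) \<longleftrightarrow> (\<lambda>x. f (q + p * x)) \<in> L2_on D"
    and L2_norm_affine: "L2_norm ((\<lambda>x. q + p * x) ` D) f = sqrt p * L2_norm D (\<lambda>x. f (q + p * x))"
proof -
  let ?E = "(\<lambda>x. q + p * x) ` D"
  let ?g = "\<lambda>x. indicator ?E x *\<^sub>R f x"
  have E: "?E \<in> sets lebesgue" using affine_image_sets_lebesgue[OF D, of p q] p by simp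
  have ind: "indicator ?E (q + p * x) = (indicator D x :: real)" for x
    using p by (auto simp: indicator_def image_iff)
  have "?g \<in> borel_measurable lebesgue \<longleftrightarrow> (\<lambda>x. ?g (q + p * x)) \<in> borel_measurable lebesgue"
  proof
    assume "?g \<in> borel_measurable lebesgue"
    moreover have "(\<lambda>x. q + p * x) \<in> lebesgue \<rightarrow>\<^sub>M lebesgue"
      using lebesgue_affine_measurable[of "\<lambda>_. p" q] p by simp
    ultimately show "(\<lambda>x. ?g (q + p * x)) \<in> borel_measurable lebesgue"
      by (rule measurable_compose_rev)
  next
    assume *: "(\<lambda>x. ?g (q + p * x)) \<in> borel_measurable lebesgue"
    have "(\<lambda>x. - q / p + (1 / p) * x) \<in> lebesgue \<rightarrow>\<^sub>M lebesgue"
      using lebesgue_affine_measurable[of "\<lambda>_. 1 / p" "- q / p"] p by simp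
    from measurable_compose_rev[OF * this] show "?g \<in> borel_measurable lebesgue"
      using p by (simp add: field_simps)
  qed
  moreover have "integrable lebesgue (\<lambda>x. (cmod (?g (q + p * x)))\<^sup>2) \<longleftrightarrow>
      integrable lebesgue (\<lambda>x. (cmod (?g x))\<^sup>2)"
    using lebesgue_integrable_real_affine_iff[of p "\<lambda>x. (cmod (?g x))\<^sup>2" q] p by simp
  ultimately show "f \<in> L2_on ?E \<longleftrightarrow> (\<lambda>x. f (q + p * x)) \<in> L2_on D"
    unfolding L2_on_iff_UNIV[OF D] L2_on_iff_UNIV[OF E]
    by (simp add: L2_on_def lebesgue_on_UNIV_eq ind)
  have "(\<integral>x. (cmod (?g x))\<^sup>2 \<partial>lebesgue) = p * (\<integral>x. (cmod (?g (q + p * x)))\<^sup>2 \<partial>lebesgue)"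
    using lebesgue_integral_real_affine[of p "\<lambda>x. (cmod (?g x))\<^sup>2" q] p by simp
  then show "L2_norm ?E f = sqrt p * L2_norm D (\<lambda>x. f (q + p * x))"
    unfolding L2_norm_eq_UNIV[OF D] L2_norm_eq_UNIV[OF E]
    by (simp add: L2_norm_def lebesgue_on_UNIV_eq ind real_sqrt_mult)
qed


section \<open>Exponential sums\<close>

definition expo :: "real \<Rightarrow> real \<Rightarrow> complex" where
  "expo \<nu> x = exp (2 * of_real pi * \<i> * of_real \<nu> * of_real x)"

lemma expo_eq_cis: "expo \<nu> x = cis (2 * pi * \<nu> * x)"
  by (simp add: expo_def cis_conv_exp algebra_simps)

lemma norm_expo [simp]: "cmod (expo \<nu> x) = 1"
  by (simp add: expo_eq_cis)

lemma expo_0 [simp]: "expo 0 x = 1" "expo \<nu> 0 = 1"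
  by (simp_all add: expo_eq_cis)

lemma expo_add: "expo (\<nu> + \<mu>) x = expo \<nu> x * expo \<mu> x"
  and expo_add_point: "expo \<nu> (x + y) = expo \<nu> x * expo \<nu> y"
  by (simp_all add: expo_eq_cis cis_mult algebra_simps)

lemma cnj_expo: "cnj (expo \<nu> x) = expo (- \<nu>) x"
  by (simp add: expo_eq_cis cis_cnj)

lemma expo_mult_cnj [simp]: "expo \<nu> x * cnj (expo \<nu> x) = 1" "cnj (expo \<nu> x) * expo \<nu> x = 1"
  by (simp_all add: cnj_expo flip: expo_add)

lemma expo_scale: "expo \<nu> (p * x) = expo (p * \<nu>) x"
  by (simp add: expo_eq_cis algebra_simps)

lemma expo_eq_1_iff: "expo \<nu> x = 1 \<longleftrightarrow> \<nu> * x \<in> \<int>"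
proof -
  have "expo \<nu> x = 1 \<longleftrightarrow> (\<exists>n::int. 2 * pi * \<nu> * x = of_int (2 * n) * pi)"
    by (simp add: expo_def exp_eq_1)
  also have "\<dots> \<longleftrightarrow> \<nu> * x \<in> \<int>"
    by (auto simp: Ints_def)
  finally show ?thesis .
qed

lemma continuous_on_expo: "continuous_on S (expo \<nu>)"
  unfolding expo_def[abs_def] by (intro continuous_intros)

lemma expo_in_L2: "D \<in> lmeasurable \<Longrightarrow> expo \<nu> \<in> L2_on D"
  by (rule L2_on_bounded[where B = 1]) (auto intro: continuous_measurable_lebesgue_on continuous_on_expo)

definition trig_poly :: "real set \<Rightarrow> (real \<Rightarrow> complex) \<Rightarrow> real \<Rightarrow> complex" where
  "trig_poly F c x = (\<Sum>\<nu>\<in>F. c \<nu> * expo \<nu> x)"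

definition trig_span :: "real set \<Rightarrow> (real \<Rightarrow> complex) set" where
  "trig_span \<Lambda> = {trig_poly F c | F c. finite F \<and> F \<subseteq> \<Lambda>}"

lemma trig_poly_in_span: "finite F \<Longrightarrow> F \<subseteq> \<Lambda> \<Longrightarrow> trig_poly F c \<in> trig_span \<Lambda>"
  by (auto simp: trig_span_def)

lemma trig_poly_in_L2: "D \<in> lmeasurable \<Longrightarrow> trig_poly F c \<in> L2_on D"
  unfolding trig_poly_def[abs_def] by (intro L2_on_sum L2_on_cmult expo_in_L2)

lemma trig_span_in_L2: "D \<in> lmeasurable \<Longrightarrow> p \<in> trig_span \<Lambda> \<Longrightarrow> p \<in> L2_on D"
  by (auto simp: trig_span_def trig_poly_in_L2)

lemma trig_span_zero [simp]: "(\<lambda>_. 0) \<in> trig_span \<Lambda>"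
  using trig_poly_in_span[of "{}" \<Lambda> undefined] by (simp add: trig_poly_def[abs_def])

lemma expo_in_span: "\<nu> \<in> \<Lambda> \<Longrightarrow> expo \<nu> \<in> trig_span \<Lambda>"
  using trig_poly_in_span[of "{\<nu>}" \<Lambda> "\<lambda>_. 1"] by (simp add: trig_poly_def[abs_def])

lemma trig_poly_extend:
  assumes "finite G" "F \<subseteq> G"
  shows "trig_poly F c = trig_poly G (\<lambda>\<nu>. if \<nu> \<in> F then c \<nu> else 0)"
  unfolding trig_poly_def[abs_def]
  by (intro ext sum.mono_neutral_cong_left) (use assms in auto)

lemma trig_poly_cong: "(\<And>\<nu>. \<nu> \<in> F \<Longrightarrow> c \<nu> = d \<nu>) \<Longrightarrow> trig_poly F c = trig_poly F d"
  unfolding trig_poly_def[abs_def] by (intro ext sum.cong) auto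

lemma trig_poly_add: "(\<lambda>x. trig_poly F c x + trig_poly F d x) = trig_poly F (\<lambda>\<nu>. c \<nu> + d \<nu>)"
  by (simp add: trig_poly_def[abs_def] sum.distrib algebra_simps)

lemma trig_poly_Un:
  "finite F \<Longrightarrow> finite G \<Longrightarrow> F \<inter> G = {} \<Longrightarrow> trig_poly (F \<union> G) c x = trig_poly F c x + trig_poly G c x"
  by (simp add: trig_poly_def sum.union_disjoint)

lemma trig_span_add:
  assumes "f \<in> trig_span \<Lambda>" "g \<in> trig_span \<Lambda>"
  shows "(\<lambda>x. f x + g x) \<in> trig_span \<Lambda>"
proof -
  obtain F c G d where *: "finite F" "F \<subseteq> \<Lambda>" "f = trig_poly F c" "finite G" "G \<subseteq> \<Lambda>" "g = trig_poly G d"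
    using assms by (auto simp: trig_span_def)
  then have "(\<lambda>x. f x + g x) = trig_poly (F \<union> G)
      (\<lambda>\<nu>. (if \<nu> \<in> F then c \<nu> else 0) + (if \<nu> \<in> G then d \<nu> else 0))"
    using trig_poly_extend[of "F \<union> G" F c] trig_poly_extend[of "F \<union> G" G d]
    by (simp flip: trig_poly_add)
  with * show ?thesis by (simp add: trig_poly_in_span)
qed

lemma trig_span_cmult: "f \<in> trig_span \<Lambda> \<Longrightarrow> (\<lambda>x. a * f x) \<in> trig_span \<Lambda>"
proof -
  assume "f \<in> trig_span \<Lambda>"
  then obtain F c where *: "finite F" "F \<subseteq> \<Lambda>" "f = trig_poly F c" by (auto simp: trig_span_def)
  then have "(\<lambda>x. a * f x) = trig_poly F (\<lambda>\<nu>. a * c \<nu>)"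
    by (simp add: trig_poly_def[abs_def] sum_distrib_left mult.assoc)
  with * show ?thesis by (simp add: trig_poly_in_span)
qed

lemma trig_span_sum: "(\<And>i. i \<in> I \<Longrightarrow> f i \<in> trig_span \<Lambda>) \<Longrightarrow> (\<lambda>x. \<Sum>i\<in>I. f i x) \<in> trig_span \<Lambda>"
  by (induction I rule: infinite_finite_induct) (auto intro: trig_span_add)

lemma trig_span_mult:
  assumes f: "f \<in> trig_span \<Lambda>" and g: "g \<in> trig_span \<Lambda>'"
    and sub: "\<And>\<nu> \<mu>. \<nu> \<in> \<Lambda> \<Longrightarrow> \<mu> \<in> \<Lambda>' \<Longrightarrow> \<nu> + \<mu> \<in> \<Gamma>"
  shows "(\<lambda>x. f x * g x) \<in> trig_span \<Gamma>"
proof -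
  obtain F c G d where *: "F \<subseteq> \<Lambda>" "f = trig_poly F c" "G \<subseteq> \<Lambda>'" "g = trig_poly G d"
    using assms by (auto simp: trig_span_def)
  then have "(\<lambda>x. f x * g x) = (\<lambda>x. \<Sum>\<nu>\<in>F. \<Sum>\<mu>\<in>G. c \<nu> * d \<mu> * expo (\<nu> + \<mu>) x)"
    by (simp add: trig_poly_def[abs_def] sum_product expo_add mult_ac)
  also have "\<dots> \<in> trig_span \<Gamma>"
    using * sub by (intro trig_span_sum trig_span_cmult expo_in_span) auto
  finally show ?thesis .
qed

text \<open>
  A lower Riesz bound and the density of the span. The third ingredient of a Riesz basis, an upper
  bound, follows from orthogonality on a larger interval.
\<close>

definition bounded_below_on :: "real set \<Rightarrow> real set \<Rightarrow> bool" where
  "bounded_below_on D \<Lambda> \<longleftrightarrow>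
     (\<exists>A>0. \<forall>F c. finite F \<longrightarrow> F \<subseteq> \<Lambda> \<longrightarrow> A * L2_set (\<lambda>\<nu>. cmod (c \<nu>)) F \<le> L2_norm D (trig_poly F c))"

definition complete_on :: "real set \<Rightarrow> real set \<Rightarrow> bool" where
  "complete_on D \<Lambda> \<longleftrightarrow> (\<forall>f\<in>L2_on D. \<forall>e>0. \<exists>p\<in>trig_span \<Lambda>. L2_norm D (\<lambda>x. f x - p x) < e)"

lemma complete_onE:
  assumes "complete_on D \<Lambda>" "f \<in> L2_on D" "e > 0"
  obtains p where "p \<in> trig_span \<Lambda>" "L2_norm D (\<lambda>x. f x - p x) < e"
  using assms unfolding complete_on_def by meson

subsection \<open>Change of variables\<close>

text \<open>
  Under \<open>x \<mapsto> q + p x\<close> the frequencies are multiplied by \<open>p\<close>, while the translation by \<open>q\<close> only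
  multiplies the coefficients by unimodular numbers.
\<close>

lemma trig_poly_affine:
  assumes "p \<noteq> 0"
  shows "trig_poly F c (q + p * x) = trig_poly ((*) p ` F) (\<lambda>\<mu>. c (\<mu> / p) * expo (\<mu> / p) q) x"
proof -
  have "inj_on ((*) p) F" using assms by (auto simp: inj_on_def)
  then show ?thesis
    unfolding trig_poly_def using assms
    by (subst sum.reindex) (auto simp: expo_add_point expo_scale mult_ac intro!: sum.cong)
qed

lemma bounded_below_on_affine:
  assumes D: "D \<in> sets lebesgue" and p: "p > 0" and bb: "bounded_below_on D ((*) p ` \<Lambda>)"
  shows "bounded_below_on ((\<lambda>x. q + p * x) ` D) \<Lambda>"
proof -
  obtain A where A: "A > 0" "\<And>F c. finite F \<Longrightarrow> F \<subseteq> (*) p ` \<Lambda> \<Longrightarrow>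
      A * L2_set (\<lambda>\<nu>. cmod (c \<nu>)) F \<le> L2_norm D (trig_poly F c)"
    using bb by (auto simp: bounded_below_on_def)
  show ?thesis
    unfolding bounded_below_on_def
  proof (intro exI[of _ "sqrt p * A"] conjI allI impI)
    fix F c assume F: "finite F" "F \<subseteq> \<Lambda>"
    let ?d = "\<lambda>\<mu>. c (\<mu> / p) * expo (\<mu> / p) q"
    have "inj_on ((*) p) F" using p by (auto simp: inj_on_def)
    then have "L2_set (\<lambda>\<mu>. cmod (?d \<mu>)) ((*) p ` F) = L2_set (\<lambda>\<nu>. cmod (c \<nu>)) F"
      using p by (simp add: L2_set_def sum.reindex norm_mult)
    then have "A * L2_set (\<lambda>\<nu>. cmod (c \<nu>)) F \<le> L2_norm D (trig_poly ((*) p ` F) ?d)"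
      using A(2)[of "(*) p ` F" ?d] F by auto
    also have "trig_poly ((*) p ` F) ?d = (\<lambda>x. trig_poly F c (q + p * x))"
      using trig_poly_affine[of p F c q] p by (intro ext) auto
    finally have "sqrt p * (A * L2_set (\<lambda>\<nu>. cmod (c \<nu>)) F) \<le>
        sqrt p * L2_norm D (\<lambda>x. trig_poly F c (q + p * x))"
      by (intro mult_left_mono) (use p in auto)
    also have "\<dots> = L2_norm ((\<lambda>x. q + p * x) ` D) (trig_poly F c)"
      using L2_norm_affine[OF D p] by simp
    finally show "sqrt p * A * L2_set (\<lambda>\<nu>. cmod (c \<nu>)) F \<le> L2_norm ((\<lambda>x. q + p * x) ` D) (trig_poly F c)"
      by (simp add: mult.assoc)
  qed (use A p in auto)
qed

lemma trig_span_affine: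
  assumes "f \<in> trig_span \<Lambda>" "p \<noteq> 0"
  shows "(\<lambda>x. f (q + p * x)) \<in> trig_span ((*) p ` \<Lambda>)"
proof -
  obtain F c where F: "finite F" "F \<subseteq> \<Lambda>" "f = trig_poly F c" using assms by (auto simp: trig_span_def)
  then show ?thesis
    using trig_poly_affine[OF assms(2), of F c q]
      trig_poly_in_span[of "(*) p ` F" "(*) p ` \<Lambda>" "\<lambda>\<mu>. c (\<mu> / p) * expo (\<mu> / p) q"]
    by (auto simp: image_mono)
qed

lemma complete_on_affine:
  assumes D: "D \<in> sets lebesgue" and p: "p > 0" and comp: "complete_on D ((*) p ` \<Lambda>)"
  shows "complete_on ((\<lambda>x. q + p * x) ` D) \<Lambda>"
  unfolding complete_on_def
proof (intro ballI allI impI)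
  fix f and e :: real assume f: "f \<in> L2_on ((\<lambda>x. q + p * x) ` D)" and e: "e > 0"
  have "(\<lambda>x. f (q + p * x)) \<in> L2_on D" using L2_on_affine[OF D p] f by blast
  then obtain g where g: "g \<in> trig_span ((*) p ` \<Lambda>)" "L2_norm D (\<lambda>x. f (q + p * x) - g x) < e / sqrt p"
    using complete_onE[OF comp, of _ "e / sqrt p"] e p by (metis divide_pos_pos real_sqrt_gt_zero)
  define h where "h = (\<lambda>y. g (- q / p + 1 / p * y))"
  have "h \<in> trig_span ((*) (1 / p) ` (*) p ` \<Lambda>)"
    unfolding h_def using p by (intro trig_span_affine[OF g(1)]) auto
  moreover have "(*) (1 / p) ` (*) p ` \<Lambda> = \<Lambda>" using p by (auto simp: image_image)
  moreover have "L2_norm ((\<lambda>x. q + p * x) ` D) (\<lambda>x. f x - h x) < e"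
  proof -
    have "h (q + p * x) = g x" for x using p by (simp add: h_def field_simps)
    then show ?thesis
      using g(2) p L2_norm_affine[OF D p, of q "\<lambda>x. f x - h x"] by (simp add: pos_less_divide_eq mult.commute)
  qed
  ultimately show "\<exists>h\<in>trig_span \<Lambda>. L2_norm ((\<lambda>x. q + p * x) ` D) (\<lambda>x. f x - h x) < e"
    by (intro bexI[of _ h]) simp_all
qed

section \<open>Fourier series on the unit interval\<close>

abbreviation unit_interval :: "real set" where
  "unit_interval \<equiv> {- (1 / 2) .. 1 / 2}"

subsection \<open>Orthogonality\<close>

text \<open>The Fourier transform of the unit interval.\<close>

definition sinc :: "real \<Rightarrow> real" where
  "sinc t = (if t = 0 then 1 else sin (pi * t) / (pi * t))"

lemma integral_expo: "(\<integral>x. expo \<nu> x \<partial>lebesgue_on unit_interval) = of_real (sinc \<nu>)"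
proof (cases "\<nu> = 0")
  case True
  then show ?thesis by (simp add: sinc_def measure_restrict_space)
next
  case False
  define G where "G x = expo \<nu> x / (2 * pi * \<i> * \<nu>)" for x
  have "(expo \<nu> has_integral (G (1 / 2) - G (- (1 / 2)))) unit_interval"
  proof (rule fundamental_theorem_of_calculus)
    fix x :: real
    have "((\<lambda>z. exp (2 * of_real pi * \<i> * of_real \<nu> * z) / (2 * pi * \<i> * \<nu>)) has_field_derivative expo \<nu> x) (at (of_real x))"
      using False by (auto intro!: derivative_eq_intros simp: expo_def)
    from has_vector_derivative_real_field[OF this]
    show "(G has_vector_derivative expo \<nu> x) (at x within unit_interval)"
      by (simp add: G_def[abs_def] expo_def o_def)
  qed simp
  moreover have "integrable (lebesgue_on unit_interval) (expo \<nu>)"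
    by (intro finite_measure.integrable_const_bound[OF finite_measure_lebesgue_on, where B = 1])
       (auto intro: continuous_measurable_lebesgue_on continuous_on_expo)
  then have "(expo \<nu> has_integral (\<integral>x. expo \<nu> x \<partial>lebesgue_on unit_interval)) unit_interval"
    by (intro has_integral_integral_lebesgue_on) auto
  ultimately have "(\<integral>x. expo \<nu> x \<partial>lebesgue_on unit_interval) = G (1 / 2) - G (- (1 / 2))"
    using has_integral_unique by blast
  also have "\<dots> = of_real (sinc \<nu>)"
    using False by (simp add: G_def expo_eq_cis sinc_def complex_eq_iff Re_divide Im_divide power2_eq_square field_simps)
  finally show ?thesis .
qed

definition cinner :: "real set \<Rightarrow> (real \<Rightarrow> complex) \<Rightarrow> (real \<Rightarrow> complex) \<Rightarrow> complex" where
  "cinner D f g = (\<integral>x. f x * cnj (g x) \<partial>lebesgue_on D)"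

lemma integrable_mult_cnj:
  assumes f: "f \<in> L2_on D" and g: "g \<in> L2_on D"
  shows "integrable (lebesgue_on D) (\<lambda>x. f x * cnj (g x))"
proof (rule Bochner_Integration.integrable_bound)
  note [measurable] = L2_on_measurable[OF f] L2_on_measurable[OF g]
  show "integrable (lebesgue_on D) (\<lambda>x. (cmod (f x))\<^sup>2 + (cmod (g x))\<^sup>2)"
    using L2_on_integrable[OF f] L2_on_integrable[OF g] by simp
  have "cmod u * cmod v \<le> (cmod u)\<^sup>2 + (cmod v)\<^sup>2" for u v
    using sum_squares_bound[of "cmod u" "cmod v"] mult_nonneg_nonneg[OF norm_ge_zero norm_ge_zero, of u v]
    by linarith
  then show "AE x in lebesgue_on D. norm (f x * cnj (g x)) \<le> norm ((cmod (f x))\<^sup>2 + (cmod (g x))\<^sup>2)"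
    by (intro always_eventually) (auto simp: norm_mult)
  have "cnj \<in> borel_measurable borel"
    by (intro borel_measurable_continuous_onI continuous_intros)
  from measurable_compose[OF L2_on_measurable[OF g] this]
  show "(\<lambda>x. f x * cnj (g x)) \<in> borel_measurable (lebesgue_on D)"
    using L2_on_measurable[OF f] by (rule borel_measurable_times[rotated])
qed

lemma cinner_trig_poly:
  assumes "D \<in> lmeasurable" "f \<in> L2_on D"
  shows "cinner D f (trig_poly F c) = (\<Sum>\<nu>\<in>F. cnj (c \<nu>) * cinner D f (expo \<nu>))"
proof -
  have int: "integrable (lebesgue_on D) (\<lambda>x. cnj (c \<nu>) * (f x * cnj (expo \<nu> x)))" for \<nu>
    using integrable_mult_cnj[OF assms(2) expo_in_L2[OF assms(1), of \<nu>]] by simp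
  have "cinner D f (trig_poly F c) = (\<integral>x. (\<Sum>\<nu>\<in>F. cnj (c \<nu>) * (f x * cnj (expo \<nu> x))) \<partial>lebesgue_on D)"
    unfolding cinner_def trig_poly_def by (simp add: sum_distrib_left mult_ac)
  also have "\<dots> = (\<Sum>\<nu>\<in>F. cnj (c \<nu>) * cinner D f (expo \<nu>))"
    using int by (subst Bochner_Integration.integral_sum) (auto simp: cinner_def)
  finally show ?thesis .
qed

lemma cinner_commute: "cinner D g f = cnj (cinner D f g)"
  unfolding cinner_def by (subst Bochner_Integration.integral_cnj[symmetric]) (simp add: mult.commute)

lemma cinner_self: "cinner D f f = of_real ((L2_norm D f)\<^sup>2)"
  unfolding cinner_def L2_norm_squared complex_norm_square[symmetric] by (rule integral_complex_of_real)

lemma cinner_expo: "cinner unit_interval (expo \<nu>) (expo \<mu>) = of_real (sinc (\<nu> - \<mu>))"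
  by (simp add: cinner_def cnj_expo integral_expo[symmetric] flip: expo_add)

lemma sinc_Ints: "n \<in> \<int> \<Longrightarrow> n \<noteq> 0 \<Longrightarrow> sinc n = 0"
  by (auto simp: sinc_def mult.commute[of pi] sin_zero_iff_int2 elim!: Ints_cases)

lemma L2_norm_diff_squared:
  assumes f: "f \<in> L2_on D" and g: "g \<in> L2_on D"
  shows "(L2_norm D (\<lambda>x. f x - g x))\<^sup>2 = (L2_norm D f)\<^sup>2 - 2 * Re (cinner D f g) + (L2_norm D g)\<^sup>2"
proof -
  have "(cmod (u - v))\<^sup>2 = (cmod u)\<^sup>2 - 2 * Re (u * cnj v) + (cmod v)\<^sup>2" for u v
    unfolding cmod_power2 by (simp add: power2_eq_square algebra_simps)
  then have "(L2_norm D (\<lambda>x. f x - g x))\<^sup>2 =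
      (\<integral>x. ((cmod (f x))\<^sup>2 - 2 * Re (f x * cnj (g x)) + (cmod (g x))\<^sup>2) \<partial>lebesgue_on D)"
    by (simp only: L2_norm_squared)
  moreover have "Re (cinner D f g) = (\<integral>x. Re (f x * cnj (g x)) \<partial>lebesgue_on D)"
    unfolding cinner_def by (rule integral_Re[OF integrable_mult_cnj[OF f g], symmetric])
  moreover have "integrable (lebesgue_on D) (\<lambda>x. Re (f x * cnj (g x)))"
    by (rule integrable_Re[OF integrable_mult_cnj[OF f g]])
  moreover have "(\<integral>x. (a x - 2 * r x + b x) \<partial>M) = (\<integral>x. a x \<partial>M) - 2 * (\<integral>x. r x \<partial>M) + (\<integral>x. b x \<partial>M)"
    if "integrable M a" "integrable M r" "integrable M b" for M :: "real measure" and a r b :: "real \<Rightarrow> real"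
    using that by simp
  ultimately show ?thesis
    using L2_on_integrable[OF f] L2_on_integrable[OF g] by (simp only: L2_norm_squared)
qed

text \<open>
  Completing the square in the coefficients: an orthogonal projection is the best approximation.
  Frequencies with integer differences cover both the integers and the integers shifted by one half.
\<close>

lemma L2_norm_diff_trig_poly:
  assumes F: "finite F" "\<And>\<nu> \<mu>. \<nu> \<in> F \<Longrightarrow> \<mu> \<in> F \<Longrightarrow> \<nu> - \<mu> \<in> \<int>" and f: "f \<in> L2_on unit_interval"
  defines "a \<equiv> \<lambda>\<nu>. cinner unit_interval f (expo \<nu>)"
  shows "(L2_norm unit_interval (\<lambda>x. f x - trig_poly F c x))\<^sup>2 =
    (L2_norm unit_interval f)\<^sup>2 - (\<Sum>\<nu>\<in>F. (cmod (a \<nu>))\<^sup>2) + (\<Sum>\<nu>\<in>F. (cmod (c \<nu> - a \<nu>))\<^sup>2)"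
proof -
  let ?D = unit_interval
  have D: "?D \<in> lmeasurable" by simp
  have orth: "cinner ?D (expo \<nu>) (expo \<mu>) = (if \<nu> = \<mu> then 1 else 0)" if "\<nu> \<in> F" "\<mu> \<in> F" for \<nu> \<mu>
    using F(2)[OF that] sinc_Ints[of "\<nu> - \<mu>"] by (simp add: cinner_expo sinc_def)
  have "cinner ?D (trig_poly F c) (expo \<nu>) = c \<nu>" if "\<nu> \<in> F" for \<nu>
  proof -
    have "cinner ?D (trig_poly F c) (expo \<nu>) = (\<Sum>\<mu>\<in>F. c \<mu> * cnj (cinner ?D (expo \<nu>) (expo \<mu>)))"
      by (simp add: cinner_commute[of _ _ "expo \<nu>"] cinner_trig_poly[OF D expo_in_L2[OF D]])
    also have "\<dots> = (\<Sum>\<mu>\<in>F. if \<mu> = \<nu> then c \<mu> else 0)"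
      by (intro sum.cong) (auto simp: orth that)
    finally show ?thesis using F(1) that by simp
  qed
  then have "cinner ?D (trig_poly F c) (trig_poly F c) = (\<Sum>\<nu>\<in>F. cnj (c \<nu>) * c \<nu>)"
    by (simp add: cinner_trig_poly[OF D trig_poly_in_L2[OF D]])
  also have "\<dots> = of_real (\<Sum>\<nu>\<in>F. (cmod (c \<nu>))\<^sup>2)"
    unfolding of_real_sum complex_norm_square by (simp add: mult.commute)
  finally have norm: "(L2_norm ?D (trig_poly F c))\<^sup>2 = (\<Sum>\<nu>\<in>F. (cmod (c \<nu>))\<^sup>2)"
    unfolding cinner_self using of_real_eq_iff by blast
  have *: "(cmod (u - v))\<^sup>2 = (cmod u)\<^sup>2 - 2 * Re (cnj u * v) + (cmod v)\<^sup>2" for u v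
    unfolding cmod_power2 by (simp add: power2_eq_square algebra_simps)
  show ?thesis
    unfolding L2_norm_diff_squared[OF f trig_poly_in_L2[OF D]] norm cinner_trig_poly[OF D f] a_def
    by (simp add: * sum.distrib sum_subtractf sum_distrib_left)
qed

lemma best_approximation:
  assumes "finite F" "\<And>\<nu> \<mu>. \<nu> \<in> F \<Longrightarrow> \<mu> \<in> F \<Longrightarrow> \<nu> - \<mu> \<in> \<int>" "f \<in> L2_on unit_interval"
  shows "L2_norm unit_interval (\<lambda>x. f x - trig_poly F (\<lambda>\<nu>. cinner unit_interval f (expo \<nu>)) x)
    \<le> L2_norm unit_interval (\<lambda>x. f x - trig_poly F c x)"
  by (rule power2_le_imp_le) (simp_all add: L2_norm_diff_trig_poly[OF assms] sum_nonneg)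

lemma parseval:
  assumes "finite F" "\<And>\<nu> \<mu>. \<nu> \<in> F \<Longrightarrow> \<mu> \<in> F \<Longrightarrow> \<nu> - \<mu> \<in> \<int>"
  shows "L2_norm unit_interval (trig_poly F c) = L2_set (\<lambda>\<nu>. cmod (c \<nu>)) F"
proof -
  have "(L2_norm unit_interval (trig_poly F c))\<^sup>2 = (L2_set (\<lambda>\<nu>. cmod (c \<nu>)) F)\<^sup>2"
    using L2_norm_diff_trig_poly[OF assms L2_on_zero, of c] L2_norm_minus[of _ "trig_poly F c"]
    by (simp add: cinner_def L2_set_def sum_nonneg)
  then show ?thesis by simp
qed

text \<open>The factor \<open>sqrt T\<close> is the norm of a single exponential on an interval of length \<open>T\<close>.\<close>

lemma parseval_scaled:
  assumes "finite F" "\<And>\<nu>. \<nu> \<in> F \<Longrightarrow> T * \<nu> \<in> \<int>" "T > 0"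
  shows "L2_norm {0..T} (trig_poly F c) = sqrt T * L2_set (\<lambda>\<nu>. cmod (c \<nu>)) F"
proof -
  let ?d = "\<lambda>\<mu>. c (\<mu> / T) * expo (\<mu> / T) (T / 2)"
  have inj: "inj_on ((*) T) F" using assms(3) by (auto simp: inj_on_def)
  have img: "(\<lambda>x. T / 2 + T * x) ` unit_interval = {0..T}"
    using assms(3) image_affinity_atLeastAtMost[of T "T / 2" "- (1 / 2)" "1 / 2"] by (simp add: add.commute)
  have "L2_norm {0..T} (trig_poly F c) = sqrt T * L2_norm unit_interval (\<lambda>x. trig_poly F c (T / 2 + T * x))"
    using L2_norm_affine[of unit_interval T "T / 2" "trig_poly F c"] assms(3) unfolding img by simp
  also have "(\<lambda>x. trig_poly F c (T / 2 + T * x)) = trig_poly ((*) T ` F) ?d"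
    using assms(3) by (intro ext trig_poly_affine) auto
  also have "L2_norm unit_interval (trig_poly ((*) T ` F) ?d) = L2_set (\<lambda>\<mu>. cmod (?d \<mu>)) ((*) T ` F)"
    using assms by (intro parseval) auto
  also have "\<dots> = L2_set (\<lambda>\<nu>. cmod (c \<nu>)) F"
    using inj assms(3) by (simp add: L2_set_def sum.reindex norm_mult)
  finally show ?thesis .
qed


subsection \<open>Completeness\<close>

text \<open>
  Dominated convergence in \<open>L\<^sup>2\<close>; the two truncation steps of the completeness proof use it.
\<close>

lemma L2_norm_dominated_convergence:
  assumes f: "f \<in> L2_on D" and g: "\<And>n. g n \<in> L2_on D"
    and conv: "AE x in lebesgue_on D. (\<lambda>n. g n x) \<longlonglongrightarrow> f x"
    and h: "integrable (lebesgue_on D) h" "\<And>n x. x \<in> D \<Longrightarrow> (cmod (f x - g n x))\<^sup>2 \<le> h x"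
  shows "(\<lambda>n. L2_norm D (\<lambda>x. f x - g n x)) \<longlonglongrightarrow> 0"
proof -
  note [measurable] = L2_on_measurable[OF f] L2_on_measurable[OF g]
  have "(\<lambda>n. \<integral>x. (cmod (f x - g n x))\<^sup>2 \<partial>lebesgue_on D) \<longlonglongrightarrow> (\<integral>x. 0 \<partial>lebesgue_on D)"
  proof (rule integral_dominated_convergence)
    show "AE x in lebesgue_on D. (\<lambda>n. (cmod (f x - g n x))\<^sup>2) \<longlonglongrightarrow> 0"
      using conv
    proof eventually_elim
      case (elim x)
      have "(\<lambda>n. (cmod (f x - g n x))\<^sup>2) \<longlonglongrightarrow> (cmod (f x - f x))\<^sup>2"
        using elim by (intro tendsto_intros)
      then show ?case by simp
    qed
    show "AE x in lebesgue_on D. norm ((cmod (f x - g n x))\<^sup>2) \<le> h x" for n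
      using h(2) by (intro AE_I2) simp
    show "(\<lambda>x. (cmod (f x - g n x))\<^sup>2) \<in> borel_measurable (lebesgue_on D)" for n by measurable
  qed (use h in auto)
  then show ?thesis
    unfolding L2_norm_def using tendsto_real_sqrt by fastforce
qed

lemma L2_bounded_approximation:
  assumes "f \<in> L2_on D" "e > 0"
  obtains g B where "g \<in> L2_on D" "B > 0" "\<And>x. cmod (g x) \<le> B" "L2_norm D (\<lambda>x. f x - g x) < e"
proof -
  define g where "g n x = (if cmod (f x) \<le> real n then f x else 0)" for n x
  note [measurable] = L2_on_measurable[OF assms(1)]
  have meas: "g n \<in> borel_measurable (lebesgue_on D)" for n
    unfolding g_def[abs_def] by measurable
  have g: "g n \<in> L2_on D" for n
  proof (rule L2_onI[OF meas])
    show "integrable (lebesgue_on D) (\<lambda>x. (cmod (g n x))\<^sup>2)"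
      using L2_on_integrable[OF assms(1)] borel_measurable_power[OF measurable_compose[OF meas[of n] borel_measurable_norm]]
      by (rule Bochner_Integration.integrable_bound) (auto simp: g_def)
  qed
  have "(\<lambda>n. L2_norm D (\<lambda>x. f x - g n x)) \<longlonglongrightarrow> 0"
  proof (rule L2_norm_dominated_convergence[OF assms(1) g])
    have "(\<lambda>n. g n x) \<longlonglongrightarrow> f x" for x
    proof (rule tendsto_eventually)
      obtain N :: nat where "cmod (f x) \<le> real N" using real_arch_simple by blast
      then show "\<forall>\<^sub>F n in sequentially. g n x = f x"
        by (intro eventually_sequentiallyI[of N]) (auto simp: g_def)
    qed
    then show "AE x in lebesgue_on D. (\<lambda>n. g n x) \<longlonglongrightarrow> f x" by simp
  qed (use L2_on_integrable[OF assms(1)] in \<open>auto simp: g_def\<close>)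
  then obtain n where "L2_norm D (\<lambda>x. f x - g n x) < e"
    using assms(2) by (metis (no_types, lifting) LIMSEQ_iff abs_ge_self diff_zero le_refl order_le_less_trans real_norm_def)
  then show thesis
    using g[of n] by (intro that[of "g n" "real n + 1"]) (auto simp: g_def)
qed

text \<open>
  Measurable functions are almost everywhere limits of continuous ones. Clamping these to the bound
  of the limit makes dominated convergence applicable, and a cut-off that vanishes at the point
  \<open>-1\<close> of the unit circle, where the two ends of the interval are glued together, keeps them
  continuous as functions on the circle.
\<close>

lemma L2_circle_approximation:
  assumes f: "f \<in> L2_on unit_interval" and B: "B > 0" "\<And>x. cmod (f x) \<le> B" and e: "e > 0"
  obtains h where "continuous_on (sphere 0 1) h" "h \<circ> (\<lambda>x. cis (2 * pi * x)) \<in> L2_on unit_interval"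
    "L2_norm unit_interval (\<lambda>x. f x - h (cis (2 * pi * x))) < e"
proof -
  have "f measurable_on unit_interval"
    using L2_on_measurable[OF f] by (subst measurable_on_iff_borel_measurable) auto
  then obtain N g where N: "negligible N" and g: "\<And>n. continuous_on UNIV (g n)"
    and lim: "\<And>x. x \<notin> N \<Longrightarrow> (\<lambda>n. g n x) \<longlonglongrightarrow> (if x \<in> unit_interval then f x else 0)"
    unfolding measurable_on_def by blast
  define clamp where "clamp z = of_real (B / max B (cmod z)) * z" for z :: complex
  have clamp_cont: "continuous_on S clamp" for S
    unfolding clamp_def[abs_def] using B(1) by (intro continuous_intros) auto
  have clamp_le: "cmod (clamp z) \<le> B" for z
    using B(1) by (auto simp: clamp_def norm_mult norm_divide max_def field_simps)
  have clamp_id: "clamp z = z" if "cmod z \<le> B" for z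
    using B(1) that by (simp add: clamp_def max_def)
  define h where "h n z = of_real (min 1 (real n * cmod (z + 1))) * clamp (g n (Arg z / (2 * pi)))" for n z
  have cont: "continuous_on (sphere 0 1) (h n)" for n
    unfolding continuous_on_eq_continuous_within
  proof
    fix z :: complex assume z: "z \<in> sphere 0 1"
    show "continuous (at z within sphere 0 1) (h n)"
    proof (cases "z = -1")
      case True
      have "((\<lambda>z. B * (real n * cmod (z + 1))) \<longlongrightarrow> B * (real n * cmod (- 1 + 1))) (at (-1) within sphere 0 1)"
        by (intro tendsto_intros)
      then have "((\<lambda>z. B * (real n * cmod (z + 1))) \<longlongrightarrow> 0) (at (-1) within sphere 0 1)" by simp
      moreover have "norm (h n z) \<le> B * (real n * cmod (z + 1))" for z
      proof -
        have "norm (h n z) \<le> (real n * cmod (z + 1)) * B"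
          unfolding h_def norm_mult by (intro mult_mono clamp_le) (auto simp: abs_le_iff)
        then show ?thesis by (simp add: mult.commute)
      qed
      ultimately have "(h n \<longlongrightarrow> 0) (at (-1) within sphere 0 1)"
        by (intro Lim_null_comparison[of "h n"]) auto
      moreover have "h n (-1) = 0" by (simp add: h_def)
      ultimately show ?thesis by (simp add: continuous_within True)
    next
      case False
      have "z \<notin> \<real>\<^sub>\<le>\<^sub>0"
      proof
        assume "z \<in> \<real>\<^sub>\<le>\<^sub>0"
        then obtain r where "z = of_real r" "r \<le> 0" by (auto elim: nonpos_Reals_cases)
        with z False show False by auto
      qed
      then have "continuous (at z) Arg" by (rule continuous_at_Arg)
      then have "continuous (at z) (\<lambda>z. Arg z / (2 * pi))" by (intro continuous_intros) auto
      moreover have "isCont (clamp \<circ> g n) t" for t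
        using continuous_on_compose[OF g clamp_cont, of n] by (simp add: continuous_on_eq_continuous_at o_def)
      ultimately have "isCont (\<lambda>z. clamp (g n (Arg z / (2 * pi)))) z"
        using isCont_o2[of z "\<lambda>z. Arg z / (2 * pi)" "clamp \<circ> g n"] by (simp add: o_def)
      then have "isCont (h n) z"
        unfolding h_def[abs_def] by (intro continuous_intros)
      then show ?thesis by (rule continuous_at_imp_continuous_within)
    qed
  qed
  have h_le: "cmod (h n z) \<le> B" for n z
  proof -
    have "cmod (h n z) \<le> 1 * B"
      unfolding h_def norm_mult by (intro mult_mono clamp_le) auto
    then show ?thesis by simp
  qed
  let ?c = "\<lambda>x. cis (2 * pi * x)"
  have in_L2: "h n \<circ> ?c \<in> L2_on unit_interval" for n
  proof (rule L2_on_bounded)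
    have "continuous_on UNIV (h n \<circ> ?c)"
      by (intro continuous_on_compose continuous_on_subset[OF cont] continuous_intros) auto
    then show "h n \<circ> ?c \<in> borel_measurable (lebesgue_on unit_interval)"
      by (rule continuous_measurable_lebesgue_on)
  qed (use h_le in auto)
  have "(\<lambda>n. L2_norm unit_interval (\<lambda>x. f x - (h n \<circ> ?c) x)) \<longlonglongrightarrow> 0"
  proof (rule L2_norm_dominated_convergence[OF f in_L2])
    have "(\<lambda>n. (h n \<circ> ?c) x) \<longlonglongrightarrow> f x" if x: "x \<in> unit_interval" "x \<notin> insert (1 / 2) (insert (- (1 / 2)) N)" for x
    proof -
      have Arg: "Arg (?c x) = 2 * pi * x"
        using x mult_strict_left_mono[of "- 1" "2 * x" pi] mult_left_mono[of "2 * x" 1 pi]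
        by (intro Arg_unique[of 1]) (auto simp: cis_conv_exp mult_ac)
      have "?c x + 1 \<noteq> 0"
      proof
        assume "?c x + 1 = 0"
        then have "?c x = -1" by (simp add: add_eq_0_iff2)
        then have "2 * pi * x = pi" using Arg Arg_of_real[of "-1"] by simp
        then show False using x by auto
      qed
      then have pos: "cmod (?c x + 1) > 0" by simp
      have "(\<lambda>n. clamp (g n x)) \<longlonglongrightarrow> clamp (f x)"
        using lim[of x] x continuous_on_tendsto_compose[OF clamp_cont[of UNIV], of "\<lambda>n. g n x" "f x" sequentially]
        by auto
      moreover have "\<forall>\<^sub>F n in sequentially. clamp (g n x) = (h n \<circ> ?c) x"
      proof -
        obtain M :: nat where "1 / cmod (?c x + 1) \<le> real M" using real_arch_simple by blast
        then have "1 \<le> real n * cmod (?c x + 1)" if "n \<ge> M" for n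
          using that pos by (simp add: pos_divide_le_eq) (meson mult_right_mono norm_ge_zero of_nat_mono order_trans)
        then show ?thesis
          by (intro eventually_sequentiallyI[of M]) (auto simp: h_def Arg min_def)
      qed
      ultimately have "(\<lambda>n. (h n \<circ> ?c) x) \<longlonglongrightarrow> clamp (f x)" by (rule Lim_transform_eventually)
      then show ?thesis using clamp_id[OF B(2)] by simp
    qed
    moreover have "negligible (insert (1 / 2) (insert (- (1 / 2)) N))" using N by simp
    ultimately show "AE x in lebesgue_on unit_interval. (\<lambda>n. (h n \<circ> ?c) x) \<longlonglongrightarrow> f x"
      by (auto simp: AE_restrict_space_iff negligible_iff_null_sets intro!: AE_I'[of "insert (1 / 2) (insert (- (1 / 2)) N)"])
    show "(cmod (f x - (h n \<circ> ?c) x))\<^sup>2 \<le> (2 * B)\<^sup>2" for n x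
      using norm_triangle_ineq4[of "f x" "(h n \<circ> ?c) x"] B(2)[of x] h_le[of n "?c x"]
      by (intro power_mono) auto
    show "integrable (lebesgue_on unit_interval) (\<lambda>x. (2 * B)\<^sup>2)"
      by (rule finite_measure.integrable_const[OF finite_measure_lebesgue_on]) simp
  qed
  then obtain n where "L2_norm unit_interval (\<lambda>x. f x - (h n \<circ> ?c) x) < e"
    using e by (metis (no_types, lifting) LIMSEQ_iff abs_ge_self diff_zero le_refl order_le_less_trans real_norm_def)
  then show thesis using that[OF cont in_L2] by simp
qed

text \<open>
  On the unit circle, \<open>Re z\<close> and \<open>Im z\<close> are combinations of \<open>z\<close> and its conjugate, which are the
  exponentials with frequencies \<open>1\<close> and \<open>- 1\<close>.
\<close>

lemma real_polynomial_function_cis_in_trig_span: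
  assumes "real_polynomial_function r"
  shows "(\<lambda>x. complex_of_real (r (cis (2 * pi * x)))) \<in> trig_span \<int>"
  using assms
proof induction
  case (linear r)
  interpret r: bounded_linear r by fact
  have "r (cis t) = cos t * r 1 + sin t * r \<i>" for t
  proof -
    have "cis t = cos t *\<^sub>R 1 + sin t *\<^sub>R \<i>" by (simp add: complex_eq_iff)
    then show ?thesis by (metis r.add r.scaleR real_scaleR_def)
  qed
  then have "(\<lambda>x. complex_of_real (r (cis (2 * pi * x)))) =
      (\<lambda>x. Complex (r 1 / 2) (- r \<i> / 2) * expo 1 x + Complex (r 1 / 2) (r \<i> / 2) * expo (- 1) x)"
    by (intro ext) (simp add: expo_eq_cis complex_eq_iff algebra_simps)
  also have "\<dots> \<in> trig_span \<int>"
    by (intro trig_span_add trig_span_cmult expo_in_span) auto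
  finally show ?case .
next
  case (const c)
  have "(\<lambda>x. c * expo 0 x) \<in> trig_span \<int>" by (intro trig_span_cmult expo_in_span) auto
  then show ?case by simp
next
  case (add f g)
  then show ?case using trig_span_add by force
next
  case (mult f g)
  then show ?case using trig_span_mult[OF mult.IH, of \<int>] by force
qed

text \<open>
  Uniform approximation on the circle by polynomials, according to Stone and Weierstrass, completes
  the chain of approximations.
\<close>

lemma fourier_complete: "complete_on unit_interval \<int>"
  unfolding complete_on_def
proof (intro ballI allI impI)
  let ?D = unit_interval
  let ?c = "\<lambda>x. cis (2 * pi * x)"
  fix f and e :: real assume f: "f \<in> L2_on ?D" and e: "e > 0"
  obtain g B where g: "g \<in> L2_on ?D" "B > 0" "\<And>x. cmod (g x) \<le> B" "L2_norm ?D (\<lambda>x. f x - g x) < e / 3"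
    using L2_bounded_approximation[OF f, of "e / 3"] e by auto
  obtain h where h: "continuous_on (sphere 0 1) h" "h \<circ> ?c \<in> L2_on ?D"
      "L2_norm ?D (\<lambda>x. g x - h (?c x)) < e / 3"
    using L2_circle_approximation[OF g(1-3), of "e / 3"] e by auto
  obtain q where q: "polynomial_function q" "\<And>z. z \<in> sphere 0 1 \<Longrightarrow> cmod (h z - q z) < e / 3"
    using Stone_Weierstrass_polynomial_function[OF compact_sphere h(1), of "e / 3"] e by auto
  have "real_polynomial_function (Re \<circ> q)" "real_polynomial_function (Im \<circ> q)"
    using q(1) bounded_linear_Re bounded_linear_Im by (auto simp: polynomial_function_def)
  then have "(\<lambda>x. of_real (Re (q (?c x))) + \<i> * of_real (Im (q (?c x)))) \<in> trig_span \<int>"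
    by (intro trig_span_add trig_span_cmult) (auto dest!: real_polynomial_function_cis_in_trig_span)
  then have q_span: "(\<lambda>x. q (?c x)) \<in> trig_span \<int>"
    by (simp flip: complex_eq)
  note q_L2 = trig_span_in_L2[OF _ q_span, of ?D, simplified]
  have hq: "L2_norm ?D (\<lambda>x. (h \<circ> ?c) x - q (?c x)) \<le> e / 3"
  proof (rule power2_le_imp_le)
    have "(L2_norm ?D (\<lambda>x. (h \<circ> ?c) x - q (?c x)))\<^sup>2 \<le> (\<integral>x. (e / 3)\<^sup>2 \<partial>lebesgue_on ?D)"
      unfolding L2_norm_squared
    proof (rule integral_mono)
      show "integrable (lebesgue_on ?D) (\<lambda>x. (cmod ((h \<circ> ?c) x - q (?c x)))\<^sup>2)"
        by (rule L2_on_integrable[OF L2_on_diff[OF h(2) q_L2]])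
      show "integrable (lebesgue_on ?D) (\<lambda>x. (e / 3)\<^sup>2)"
        by (rule finite_measure.integrable_const[OF finite_measure_lebesgue_on]) simp
      show "(cmod ((h \<circ> ?c) x - q (?c x)))\<^sup>2 \<le> (e / 3)\<^sup>2" for x
        using q(2)[of "?c x"] by (intro power_mono) auto
    qed
    then show "(L2_norm ?D (\<lambda>x. (h \<circ> ?c) x - q (?c x)))\<^sup>2 \<le> (e / 3)\<^sup>2"
      by (simp add: measure_restrict_space)
  qed (use e in auto)
  have "L2_norm ?D (\<lambda>x. f x - q (?c x)) < e"
    using L2_norm_dist_triangle[OF f g(1) q_L2] L2_norm_dist_triangle[OF g(1) h(2) q_L2] hq g(4) h(3) by simp
  then show "\<exists>p\<in>trig_span \<int>. L2_norm ?D (\<lambda>x. f x - p x) < e"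
    by (intro bexI[OF _ q_span])
qed

text \<open>Multiplying by an exponential shifts the frequencies and preserves the norm.\<close>

lemma complete_on_shift:
  assumes D: "D \<in> lmeasurable" and comp: "complete_on D \<Lambda>"
  shows "complete_on D ((+) s ` \<Lambda>)"
  unfolding complete_on_def
proof (intro ballI allI impI)
  fix f and e :: real assume f: "f \<in> L2_on D" and e: "e > 0"
  have "(\<lambda>x. f x * expo (- s) x) \<in> L2_on D"
    using f by (rule L2_on_mult_unimodular) (auto intro: continuous_on_expo)
  then obtain p where p: "p \<in> trig_span \<Lambda>" "L2_norm D (\<lambda>x. f x * expo (- s) x - p x) < e"
    using complete_onE[OF comp] e by metis
  have "(\<lambda>x. expo s x * p x) \<in> trig_span ((+) s ` \<Lambda>)"
    by (rule trig_span_mult[OF expo_in_span[of s "{s}"] p(1)]) auto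
  moreover have "L2_norm D (\<lambda>x. f x - expo s x * p x) = L2_norm D (\<lambda>x. f x * expo (- s) x - p x)"
  proof (rule L2_norm_cong)
    fix x
    have "f x - expo s x * p x = expo s x * (f x * expo (- s) x - p x)"
      by (simp add: algebra_simps flip: cnj_expo)
    then show "cmod (f x - expo s x * p x) = cmod (f x * expo (- s) x - p x)" by (simp add: norm_mult)
  qed
  ultimately show "\<exists>p\<in>trig_span ((+) s ` \<Lambda>). L2_norm D (\<lambda>x. f x - p x) < e"
    using p(2) by (intro bexI[of _ "\<lambda>x. expo s x * p x"]) simp_all
qed

lemma fourier_complete_scaled:
  assumes "T > 0"
  shows "complete_on {0..T} {of_int k / T | k. True}"
proof -
  have "(*) T ` {of_int k / T | k. True} = \<int>"
  proof -
    have "(*) T ` {of_int k / T | k. True} = range (\<lambda>k::int. T * (of_int k / T))"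
      by (simp only: full_SetCompr_eq image_image simp_thms)
    also have "\<dots> = \<int>" using assms by (simp add: Ints_def)
    finally show ?thesis .
  qed
  then have "complete_on ((\<lambda>x. T / 2 + T * x) ` unit_interval) {of_int k / T | k. True}"
    using fourier_complete assms by (intro complete_on_affine) auto
  moreover have "(\<lambda>x. T / 2 + T * x) ` unit_interval = {0..T}"
    using assms image_affinity_atLeastAtMost[of T "T / 2" "- (1 / 2)" "1 / 2"] by (simp add: add.commute)
  ultimately show ?thesis by simp
qed


section \<open>Complementary frequencies on complementary sets\<close>

text \<open>
  Successive approximation: if every approximation problem \<open>h\<close> reduces, up to an arbitrarily small
  error, to a problem \<open>h'\<close> that is smaller by a fixed factor, then all of them can be solved. Here
  \<open>P h r\<close> means that \<open>h\<close> can be approximated within \<open>r\<close>. Only approximate reductions are available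
  below, since exponential sums have finitely many terms.
\<close>

lemma successive_approximation:
  fixes size :: "'a \<Rightarrow> real" and P :: "'a \<Rightarrow> real \<Rightarrow> bool"
  assumes \<theta>: "0 \<le> \<theta>" "\<theta> < 1"
    and start: "\<And>h. h \<in> Q \<Longrightarrow> P h (size h)"
    and mono: "\<And>h r s. P h r \<Longrightarrow> r \<le> s \<Longrightarrow> P h s"
    and step: "\<And>h e. h \<in> Q \<Longrightarrow> e > 0 \<Longrightarrow>
      \<exists>h'\<in>Q. size h' \<le> \<theta> * size h + e \<and> (\<forall>r. P h' r \<longrightarrow> P h (r + e))"
    and h: "h \<in> Q" and e: "e > 0"
  shows "P h e"
proof -
  have iter: "\<forall>h\<in>Q. \<forall>e>0. P h (\<theta> ^ n * size h + e)" for n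
  proof (induction n)
    case 0
    show ?case by (auto intro!: mono[OF start])
  next
    case (Suc n)
    show ?case
    proof (intro ballI allI impI)
      fix h and e :: real assume h: "h \<in> Q" "e > 0"
      obtain h' where h': "h' \<in> Q" "size h' \<le> \<theta> * size h + e / 3" "\<And>r. P h' r \<Longrightarrow> P h (r + e / 3)"
        using step[OF h(1), of "e / 3"] h(2) by auto
      have "P h' (\<theta> ^ n * size h' + e / 3)" using Suc h'(1) h(2) by simp
      then have "P h (\<theta> ^ n * size h' + e / 3 + e / 3)" by (rule h'(3))
      moreover have "\<theta> ^ n * size h' \<le> \<theta> ^ n * (\<theta> * size h) + \<theta> ^ n * (e / 3)"
        using mult_left_mono[OF h'(2), of "\<theta> ^ n"] \<theta> by (simp add: distrib_left)
      moreover have "\<theta> ^ n * (e / 3) \<le> 1 * (e / 3)"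
        using \<theta> h(2) by (intro mult_right_mono power_le_one) auto
      ultimately show "P h (\<theta> ^ Suc n * size h + e)"
        by (elim mono) (simp add: mult_ac)
    qed
  qed
  have "(\<lambda>n. \<theta> ^ n * size h) \<longlonglongrightarrow> 0 * size h"
    using \<theta> by (intro tendsto_mult LIMSEQ_realpow_zero) auto
  then have "\<forall>\<^sub>F n in sequentially. \<theta> ^ n * size h < e / 2"
    using e by (intro order_tendstoD) auto
  then obtain n where "\<theta> ^ n * size h < e / 2"
    by (auto simp: eventually_sequentially)
  moreover have "P h (\<theta> ^ n * size h + e / 2)" using iter h e by simp
  ultimately show ?thesis by (elim mono) simp
qed

locale complementary_frequencies =
  fixes T :: real and M \<Lambda> J :: "real set"
  assumes T: "T > 0" and M_eq: "M = {of_int k / T | k. True}" and \<Lambda>: "\<Lambda> \<subseteq> M"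
    and J: "J \<in> sets lebesgue" "J \<subseteq> {0..T}"
begin

abbreviation "E \<equiv> {0..T}"

lemma E_meas: "E \<in> lmeasurable" and J_meas: "J \<in> lmeasurable" and D_meas: "E - J \<in> lmeasurable"
  and D_sets: "E - J \<in> sets lebesgue"
proof -
  show E: "E \<in> lmeasurable" by simp
  show "J \<in> lmeasurable" using bounded_set_imp_lmeasurable[OF bounded_subset[OF bounded_closed_interval J(2)] J(1)] .
  then show D: "E - J \<in> lmeasurable" using E by (intro fmeasurable.Diff)
  then show "E - J \<in> sets lebesgue" by blast
qed

lemma norm_E: "finite F \<Longrightarrow> F \<subseteq> M \<Longrightarrow> L2_norm E (trig_poly F c) = sqrt T * L2_set (\<lambda>\<nu>. cmod (c \<nu>)) F"
proof (rule parseval_scaled)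
  fix \<nu> assume "F \<subseteq> M" "\<nu> \<in> F"
  then obtain k :: int where "\<nu> = of_int k / T" unfolding M_eq by blast
  then show "T * \<nu> \<in> \<int>" using T by simp
qed (use T in auto)

lemma pythagoras:
  assumes "g \<in> trig_span (M - \<Lambda>)" "h \<in> trig_span \<Lambda>"
  shows "(L2_norm E (\<lambda>x. g x + h x))\<^sup>2 = (L2_norm E g)\<^sup>2 + (L2_norm E h)\<^sup>2"
proof -
  obtain F c G d where *: "finite F" "F \<subseteq> M - \<Lambda>" "g = trig_poly F c" "finite G" "G \<subseteq> \<Lambda>" "h = trig_poly G d"
    using assms by (auto simp: trig_span_def)
  let ?e = "\<lambda>\<nu>. if \<nu> \<in> F then c \<nu> else d \<nu>"
  have disj: "F \<inter> G = {}" using * by auto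
  have "trig_poly F c = trig_poly F ?e" "trig_poly G d = trig_poly G ?e"
    using disj by (auto intro!: trig_poly_cong)
  then have gh: "g = trig_poly F ?e" "h = trig_poly G ?e" "(\<lambda>x. g x + h x) = trig_poly (F \<union> G) ?e"
    using trig_poly_Un[OF *(1,4) disj] * by auto
  have "F \<union> G \<subseteq> M" "F \<subseteq> M" "G \<subseteq> M" using * \<Lambda> by auto
  then have norm: "L2_norm E (trig_poly S ?e) = sqrt T * L2_set (\<lambda>\<nu>. cmod (?e \<nu>)) S" if "S \<in> {F, G, F \<union> G}" for S
    using that *(1,4) by (intro norm_E) auto
  have "L2_norm E (\<lambda>x. g x + h x) = sqrt T * L2_set (\<lambda>\<nu>. cmod (?e \<nu>)) (F \<union> G)"
    unfolding gh(3) by (rule norm) simp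
  moreover have "L2_norm E g = sqrt T * L2_set (\<lambda>\<nu>. cmod (?e \<nu>)) F"
    unfolding gh(1) by (rule norm) simp
  moreover have "L2_norm E h = sqrt T * L2_set (\<lambda>\<nu>. cmod (?e \<nu>)) G"
    unfolding gh(2) by (rule norm) simp
  ultimately show ?thesis
    using *(1,4) disj T
    by (simp add: power_mult_distrib L2_set_def sum_nonneg sum.union_disjoint distrib_left del: sum.If_cases)
qed

lemma pythagoras_diff:
  assumes "g \<in> trig_span (M - \<Lambda>)" "h \<in> trig_span \<Lambda>"
  shows "(L2_norm E (\<lambda>x. g x - h x))\<^sup>2 = (L2_norm E g)\<^sup>2 + (L2_norm E h)\<^sup>2"
  using pythagoras[OF assms(1) trig_span_cmult[OF assms(2), of "- 1"]] L2_norm_minus[of E h] by simp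

lemma split_span:
  assumes "p \<in> trig_span M"
  obtains g h where "g \<in> trig_span (M - \<Lambda>)" "h \<in> trig_span \<Lambda>" "p = (\<lambda>x. g x + h x)"
    "L2_norm E h \<le> L2_norm E p"
proof -
  obtain F c where F: "finite F" "F \<subseteq> M" "p = trig_poly F c" using assms by (auto simp: trig_span_def)
  let ?g = "trig_poly (F - \<Lambda>) c" and ?h = "trig_poly (F \<inter> \<Lambda>) c"
  have gh: "?g \<in> trig_span (M - \<Lambda>)" "?h \<in> trig_span \<Lambda>"
    using F by (auto intro!: trig_poly_in_span)
  have p: "p = (\<lambda>x. ?g x + ?h x)"
    using F trig_poly_Un[of "F - \<Lambda>" "F \<inter> \<Lambda>" c] by (auto simp: Un_Diff_Int Int_Diff)
  have "L2_norm E ?h \<le> L2_norm E p"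
  proof (rule power2_le_imp_le)
    show "(L2_norm E ?h)\<^sup>2 \<le> (L2_norm E p)\<^sup>2" unfolding p using pythagoras[OF gh] by simp
  qed simp
  with gh p show thesis using that by blast
qed

text \<open>
  A lower bound on \<open>J\<close> says that a fixed part of the energy of every sum over \<open>\<Lambda>\<close> is located in
  \<open>J\<close>; so only a fraction \<open>\<theta>\<close> is left for the complement of \<open>J\<close>.
\<close>

lemma fraction_outside:
  assumes "bounded_below_on J \<Lambda>"
  obtains \<theta> where "0 \<le> \<theta>" "\<theta> < 1" "\<And>h. h \<in> trig_span \<Lambda> \<Longrightarrow> L2_norm (E - J) h \<le> \<theta> * L2_norm E h"
proof -
  obtain A where A: "A > 0" "\<And>F c. finite F \<Longrightarrow> F \<subseteq> \<Lambda> \<Longrightarrow>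
      A * L2_set (\<lambda>\<nu>. cmod (c \<nu>)) F \<le> L2_norm J (trig_poly F c)"
    using assms by (auto simp: bounded_below_on_def)
  define a where "a = A / sqrt T"
  \<comment> \<open>The maximum matters only if \<open>\<Lambda>\<close> is empty, when \<open>a\<close> may exceed \<open>1\<close>.\<close>
  define \<theta> where "\<theta> = sqrt (max 0 (1 - a\<^sup>2))"
  have a: "a > 0" using A T by (simp add: a_def)
  have "L2_norm (E - J) h \<le> \<theta> * L2_norm E h" if h: "h \<in> trig_span \<Lambda>" for h
  proof (rule power2_le_imp_le)
    obtain F c where F: "finite F" "F \<subseteq> \<Lambda>" "h = trig_poly F c" using h by (auto simp: trig_span_def)
    have "a * L2_norm E h = A * L2_set (\<lambda>\<nu>. cmod (c \<nu>)) F"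
      using F \<Lambda> norm_E[of F c] T by (auto simp: a_def)
    also have "\<dots> \<le> L2_norm J h" using A(2) F by blast
    finally have "a\<^sup>2 * (L2_norm E h)\<^sup>2 \<le> (L2_norm J h)\<^sup>2"
      using a by (metis power_mono power_mult_distrib L2_norm_nonneg mult_nonneg_nonneg less_imp_le)
    moreover have "(L2_norm E h)\<^sup>2 = (L2_norm J h)\<^sup>2 + (L2_norm (E - J) h)\<^sup>2"
      using J h E_meas by (intro L2_norm_squared_split trig_span_in_L2) auto
    ultimately have "(L2_norm (E - J) h)\<^sup>2 \<le> (1 - a\<^sup>2) * (L2_norm E h)\<^sup>2"
      by (simp add: algebra_simps)
    also have "\<dots> \<le> max 0 (1 - a\<^sup>2) * (L2_norm E h)\<^sup>2" by (intro mult_right_mono) auto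
    finally show "(L2_norm (E - J) h)\<^sup>2 \<le> (\<theta> * L2_norm E h)\<^sup>2"
      by (simp add: \<theta>_def power_mult_distrib)
  qed (simp add: \<theta>_def)
  moreover have "0 \<le> \<theta>" "\<theta> < 1" using a by (auto simp: \<theta>_def)
  ultimately show thesis using that by blast
qed

text \<open>
  A sum \<open>h\<close> over \<open>\<Lambda>\<close>, cut off to the complement \<open>D\<close> of \<open>J\<close>, has an expansion over all
  frequencies. Its part over the complement of \<open>\<Lambda>\<close> is an admissible approximation on \<open>D\<close>, and what
  remains is again a sum over \<open>\<Lambda>\<close>, smaller by the factor \<open>\<theta>\<close>: alternating projections.
\<close>

lemma complete_on_complement:
  assumes "bounded_below_on J \<Lambda>"
  shows "complete_on (E - J) (M - \<Lambda>)"
proof -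
  let ?D = "E - J"
  obtain \<theta> where \<theta>: "0 \<le> \<theta>" "\<theta> < 1" "\<And>h. h \<in> trig_span \<Lambda> \<Longrightarrow> L2_norm ?D h \<le> \<theta> * L2_norm E h"
    using fraction_outside[OF assms] by blast
  have complete_E: "complete_on E M" using fourier_complete_scaled[OF T] by (simp add: M_eq)
  have E: "E \<in> sets lebesgue" by simp
  note L2 = trig_span_in_L2[OF E_meas] trig_span_in_L2[OF D_meas]
  have to_D: "L2_norm ?D f \<le> L2_norm E f" if "f \<in> L2_on E" for f
    using L2_norm_mono[OF D_sets E _ that] by auto
  have extend: "\<exists>p\<in>trig_span M. L2_norm ?D (\<lambda>x. f x - p x) \<le> e \<and> L2_norm E p \<le> L2_norm ?D f + e"
    if f: "f \<in> L2_on ?D" and e: "e > 0" for f and e :: real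
  proof -
    let ?f = "\<lambda>x. indicator ?D x *\<^sub>R f x"
    note ext = L2_on_zero_extension[OF D_sets E Diff_subset f]
    obtain p where p: "p \<in> trig_span M" "L2_norm E (\<lambda>x. ?f x - p x) < e"
      using complete_onE[OF complete_E ext(1) e] by auto
    have "L2_norm ?D (\<lambda>x. f x - p x) = L2_norm ?D (\<lambda>x. ?f x - p x)"
      by (rule L2_norm_cong) simp
    also have "\<dots> \<le> L2_norm E (\<lambda>x. ?f x - p x)"
      by (intro to_D L2_on_diff ext(1) L2(1)[OF p(1)])
    finally have "L2_norm ?D (\<lambda>x. f x - p x) \<le> e" using p(2) by simp
    moreover have "L2_norm E p \<le> L2_norm E ?f + L2_norm E (\<lambda>x. ?f x - p x)"
      using L2_norm_triangle_diff[of ?f E "\<lambda>x. ?f x - p x"] ext(1) L2(1)[OF p(1)] L2_on_diff by auto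
    ultimately show ?thesis using p ext(2) by force
  qed
  have approx_\<Lambda>: "\<exists>g\<in>trig_span (M - \<Lambda>). L2_norm ?D (\<lambda>x. h x - g x) \<le> e"
    if "h \<in> trig_span \<Lambda>" "e > 0" for h and e :: real
  proof (rule successive_approximation[where P = "\<lambda>h r. \<exists>g\<in>trig_span (M - \<Lambda>). L2_norm ?D (\<lambda>x. h x - g x) \<le> r"
        and size = "L2_norm E", OF \<theta>(1,2) _ _ _ that])
    fix h assume "h \<in> trig_span \<Lambda>"
    then show "\<exists>g\<in>trig_span (M - \<Lambda>). L2_norm ?D (\<lambda>x. h x - g x) \<le> L2_norm E h"
      by (intro bexI[of _ "\<lambda>_. 0"]) (auto intro!: to_D L2)
  next
    fix h and e :: real assume h: "h \<in> trig_span \<Lambda>" and e: "e > 0"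
    obtain p where p: "p \<in> trig_span M" "L2_norm ?D (\<lambda>x. h x - p x) \<le> e" "L2_norm E p \<le> L2_norm ?D h + e"
      using extend[OF L2(2)[OF h] e] by auto
    obtain g h' where gh: "g \<in> trig_span (M - \<Lambda>)" "h' \<in> trig_span \<Lambda>" "p = (\<lambda>x. g x + h' x)"
        "L2_norm E h' \<le> L2_norm E p"
      by (rule split_span[OF p(1)])
    show "\<exists>h'\<in>trig_span \<Lambda>. L2_norm E h' \<le> \<theta> * L2_norm E h + e \<and>
        (\<forall>r. (\<exists>g\<in>trig_span (M - \<Lambda>). L2_norm ?D (\<lambda>x. h' x - g x) \<le> r) \<longrightarrow>
             (\<exists>g\<in>trig_span (M - \<Lambda>). L2_norm ?D (\<lambda>x. h x - g x) \<le> r + e))"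
    proof (intro bexI[OF _ gh(2)] conjI allI impI)
      show "L2_norm E h' \<le> \<theta> * L2_norm E h + e" using gh(4) p(3) \<theta>(3)[OF h] by simp
      fix r assume "\<exists>g'\<in>trig_span (M - \<Lambda>). L2_norm ?D (\<lambda>x. h' x - g' x) \<le> r"
      then obtain g' where g': "g' \<in> trig_span (M - \<Lambda>)" "L2_norm ?D (\<lambda>x. h' x - g' x) \<le> r" by auto
      have "L2_norm ?D (\<lambda>x. (h x - p x) + (h' x - g' x))
          \<le> L2_norm ?D (\<lambda>x. h x - p x) + L2_norm ?D (\<lambda>x. h' x - g' x)"
        using h gh p(1) g' by (intro L2_norm_triangle L2_on_diff L2)
      then have "L2_norm ?D (\<lambda>x. h x - (g x + g' x)) \<le> r + e"
        using p(2) g'(2) by (simp add: gh(3) algebra_simps)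
      then show "\<exists>g\<in>trig_span (M - \<Lambda>). L2_norm ?D (\<lambda>x. h x - g x) \<le> r + e"
        using trig_span_add[OF gh(1) g'(1)] by (intro bexI[of _ "\<lambda>x. g x + g' x"])
    qed
  qed (meson order_trans)
  show ?thesis
    unfolding complete_on_def
  proof (intro ballI allI impI)
    fix f and e :: real assume f: "f \<in> L2_on ?D" and e: "e > 0"
    obtain p where p: "p \<in> trig_span M" "L2_norm ?D (\<lambda>x. f x - p x) \<le> e / 3"
      using extend[OF f, of "e / 3"] e by auto
    obtain g h where gh: "g \<in> trig_span (M - \<Lambda>)" "h \<in> trig_span \<Lambda>" "p = (\<lambda>x. g x + h x)"
      by (rule split_span[OF p(1)])
    obtain g' where g': "g' \<in> trig_span (M - \<Lambda>)" "L2_norm ?D (\<lambda>x. h x - g' x) \<le> e / 3"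
      using approx_\<Lambda>[OF gh(2), of "e / 3"] e by auto
    have "L2_norm ?D (\<lambda>x. (f x - p x) + (h x - g' x))
        \<le> L2_norm ?D (\<lambda>x. f x - p x) + L2_norm ?D (\<lambda>x. h x - g' x)"
      by (intro L2_norm_triangle L2_on_diff f L2(2)[OF p(1)] L2(2)[OF gh(2)] L2(2)[OF g'(1)])
    then have "L2_norm ?D (\<lambda>x. f x - (g x + g' x)) < e"
      using p(2) g'(2) e by (simp add: gh(3) algebra_simps)
    then show "\<exists>p\<in>trig_span (M - \<Lambda>). L2_norm ?D (\<lambda>x. f x - p x) < e"
      using trig_span_add[OF gh(1) g'(1)] by (intro bexI[of _ "\<lambda>x. g x + g' x"])
  qed
qed

text \<open>
  Let \<open>g\<close> be a sum over the complement of \<open>\<Lambda>\<close> with little energy on \<open>D\<close>. Approximating it on \<open>J\<close>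
  by a sum \<open>h\<close> over \<open>\<Lambda>\<close> yields a difference \<open>g - h\<close> that is small on \<open>J\<close> and, since \<open>h\<close> leaves
  only the fraction \<open>\<theta>\<close> outside \<open>J\<close>, of norm little more than \<open>\<theta>\<close> times the norm of \<open>h\<close> on \<open>D\<close>.
  But \<open>g\<close> and \<open>h\<close> are orthogonal, so \<open>g - h\<close> is longer than \<open>h\<close>; hence \<open>g\<close> is small.
\<close>

lemma bounded_below_on_complement:
  assumes bb: "bounded_below_on J \<Lambda>" and comp: "complete_on J \<Lambda>"
  shows "bounded_below_on (E - J) (M - \<Lambda>)"
proof -
  let ?D = "E - J"
  obtain \<theta> where \<theta>: "0 \<le> \<theta>" "\<theta> < 1" "\<And>h. h \<in> trig_span \<Lambda> \<Longrightarrow> L2_norm ?D h \<le> \<theta> * L2_norm E h"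
    using fraction_outside[OF bb] by blast
  define k where "k = 1 - \<theta>\<^sup>2"
  have k: "k > 0" using \<theta> by (simp add: k_def power_less_one_iff abs_square_less_1)
  note L2 = trig_span_in_L2[OF E_meas] trig_span_in_L2[OF D_meas] trig_span_in_L2[OF J_meas]
  have main: "k * (L2_norm E g)\<^sup>2 \<le> (L2_norm ?D g)\<^sup>2" if g: "g \<in> trig_span (M - \<Lambda>)" for g
  proof (rule field_le_epsilon)
    fix e :: real assume e: "e > 0"
    then obtain h where h: "h \<in> trig_span \<Lambda>" "L2_norm J (\<lambda>x. g x - h x) < sqrt (e / k)"
      using complete_onE[OF comp L2(3)[OF g], of "sqrt (e / k)"] k by auto
    define x y where "x = L2_norm ?D g" and "y = L2_norm E h"
    have xy: "x \<ge> 0" "y \<ge> 0" by (auto simp: x_def y_def)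
    have "(L2_norm E g)\<^sup>2 + y\<^sup>2 = (L2_norm E (\<lambda>x. g x - h x))\<^sup>2"
      using pythagoras_diff[OF g h(1)] by (simp add: y_def)
    also have "\<dots> = (L2_norm J (\<lambda>x. g x - h x))\<^sup>2 + (L2_norm ?D (\<lambda>x. g x - h x))\<^sup>2"
      using J g h by (intro L2_norm_squared_split L2_on_diff L2) auto
    also have "\<dots> \<le> e / k + (x + \<theta> * y)\<^sup>2"
    proof (rule add_mono)
      show "(L2_norm J (\<lambda>x. g x - h x))\<^sup>2 \<le> e / k"
        using power_mono[OF less_imp_le[OF h(2)], of 2] e k by simp
      have "L2_norm ?D (\<lambda>x. g x - h x) \<le> x + \<theta> * y"
        using L2_norm_triangle_diff[OF L2(2)[OF g] L2(2)[OF h(1)]] \<theta>(3)[OF h(1)] by (simp add: x_def y_def)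
      then show "(L2_norm ?D (\<lambda>x. g x - h x))\<^sup>2 \<le> (x + \<theta> * y)\<^sup>2" by (intro power_mono) auto
    qed
    finally have "k * ((L2_norm E g)\<^sup>2 + y\<^sup>2) \<le> k * (e / k + (x + \<theta> * y)\<^sup>2)"
      using k by (intro mult_left_mono) auto
    then have "k * (L2_norm E g)\<^sup>2 \<le> e + k * ((x + \<theta> * y)\<^sup>2 - y\<^sup>2)"
      using k by (simp add: algebra_simps)
    \<comment> \<open>Completing the square eliminates \<open>y\<close>, the unknown norm of the approximant.\<close>
    also have "k * ((x + \<theta> * y)\<^sup>2 - y\<^sup>2) = x\<^sup>2 - (\<theta> * x - k * y)\<^sup>2"
      unfolding k_def by algebra
    finally show "k * (L2_norm E g)\<^sup>2 \<le> (L2_norm ?D g)\<^sup>2 + e"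
      using zero_le_power2[of "\<theta> * x - k * y"] unfolding x_def by linarith
  qed
  show ?thesis
    unfolding bounded_below_on_def
  proof (intro exI[of _ "sqrt k * sqrt T"] conjI allI impI)
    fix F c assume F: "finite F" "F \<subseteq> M - \<Lambda>"
    have "(sqrt k * L2_norm E (trig_poly F c))\<^sup>2 \<le> (L2_norm ?D (trig_poly F c))\<^sup>2"
      using main[OF trig_poly_in_span[OF F]] k by (simp add: power_mult_distrib)
    then have "sqrt k * L2_norm E (trig_poly F c) \<le> L2_norm ?D (trig_poly F c)"
      by (rule power2_le_imp_le) simp
    also have "L2_norm E (trig_poly F c) = sqrt T * L2_set (\<lambda>\<nu>. cmod (c \<nu>)) F"
      using F by (intro norm_E) auto
    finally show "sqrt k * sqrt T * L2_set (\<lambda>\<nu>. cmod (c \<nu>)) F \<le> L2_norm ?D (trig_poly F c)"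
      by (simp add: mult.assoc)
  qed (use k T in auto)
qed

end


section \<open>Kadec's 1/4-theorem\<close>

subsection \<open>Coefficients of the perturbation\<close>

lemma sinc_uminus [simp]: "sinc (- t) = sinc t"
  by (simp add: sinc_def)

lemma sinc_less:
  assumes "0 \<le> u" "u < v" "v \<le> 1 / 4"
  shows "sinc v < sinc u"
proof -
  have sin_gt: "x * cos x < sin x" if "0 < x" "x < pi" for x :: real
  proof -
    have "(\<lambda>x. sin x - x * cos x) 0 < (\<lambda>x. sin x - x * cos x) x"
    proof (rule DERIV_pos_imp_increasing_open[OF that(1)])
      fix y assume "0 < y" "y < x"
      then have "y * sin y > 0" using that(2) by (intro mult_pos_pos sin_gt_zero) auto
      moreover have "((\<lambda>x. sin x - x * cos x) has_real_derivative y * sin y) (at y)"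
        by (auto intro!: derivative_eq_intros)
      ultimately show "\<exists>z. ((\<lambda>x. sin x - x * cos x) has_real_derivative z) (at y) \<and> z > 0" by blast
    qed (intro continuous_intros)
    then show ?thesis by simp
  qed
  have pos_case: "sinc v < sinc u" if "0 < u" "u < v" for u
  proof -
    have "(\<lambda>x. sin x / x) (pi * v) < (\<lambda>x. sin x / x) (pi * u)"
    proof (rule DERIV_neg_imp_decreasing[of "pi * u" "pi * v" "\<lambda>x. sin x / x"])
      fix x assume x: "pi * u \<le> x" "x \<le> pi * v"
      have "pi * v < pi * 1" using assms by (intro mult_strict_left_mono) auto
      moreover have "0 < pi * u" using that by simp
      ultimately have pos: "0 < x" "x < pi" using x by linarith+
      have "((\<lambda>x. sin x / x) has_real_derivative (x * cos x - sin x) / (x * x)) (at x)"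
        using pos by (auto intro!: derivative_eq_intros simp: mult.commute)
      moreover have "(x * cos x - sin x) / (x * x) < 0"
        using sin_gt[OF pos] pos by (intro divide_neg_pos) auto
      ultimately show "\<exists>y. ((\<lambda>x. sin x / x) has_real_derivative y) (at x) \<and> y < 0" by blast
    qed (use that in auto)
    then show ?thesis using that by (simp add: sinc_def)
  qed
  show ?thesis
  proof (cases "u = 0")
    case True
    then have "sinc v < sinc (v / 2)" using assms by (intro pos_case) auto
    also have "\<dots> \<le> 1" using assms sin_x_le_x[of "pi * (v / 2)"] True by (simp add: sinc_def)
    finally show ?thesis using True by (simp add: sinc_def)
  qed (use assms pos_case in auto)
qed

text \<open>
  The coefficient at frequency \<open>j / 2\<close> when the even part of \<open>1 - expo \<delta>\<close> is expanded in the
  integer frequencies (even \<open>j\<close>) and its odd part in the half-integers (odd \<open>j\<close>).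
\<close>

definition kadec_coeff :: "real \<Rightarrow> int \<Rightarrow> real" where
  "kadec_coeff \<delta> j = (if j = 0 then 1 else 0) -
     (sinc (\<delta> - j / 2) + (if even j then 1 else - 1) * sinc (\<delta> + j / 2)) / 2"

text \<open>
  \<open>t sin (\<pi> t)\<close> and \<open>t cos (\<pi> t)\<close> are increasing on \<open>[0, 1/4]\<close>, where they end with the same value.
\<close>

lemma mult_sin_le: "\<bar>t\<bar> \<le> 1 / 4 \<Longrightarrow> \<bar>t * sin (pi * t)\<bar> \<le> sin (pi / 4) / 4"
proof -
  assume t: "\<bar>t\<bar> \<le> 1 / 4"
  have pt: "0 \<le> pi * \<bar>t\<bar>" "pi * \<bar>t\<bar> \<le> pi / 4"
    using mult_left_mono[OF t, of pi] by simp_all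
  have "\<bar>sin (pi * t)\<bar> = \<bar>sin (pi * \<bar>t\<bar>)\<bar>" by (auto simp: abs_if)
  also have "\<dots> = sin (pi * \<bar>t\<bar>)"
    using pt pi_gt_zero by (intro abs_of_nonneg sin_ge_zero) linarith+
  also have "\<dots> \<le> sin (pi / 4)"
    using pt pi_gt_zero by (intro sin_monotone_2pi_le) linarith+
  finally have "\<bar>t\<bar> * \<bar>sin (pi * t)\<bar> \<le> (1 / 4) * sin (pi / 4)"
    using t by (intro mult_mono) auto
  then show ?thesis by (simp add: abs_mult)
qed

lemma mult_cos_le: "\<bar>t\<bar> \<le> 1 / 4 \<Longrightarrow> \<bar>t * cos (pi * t)\<bar> \<le> sin (pi / 4) / 4"
proof -
  assume t: "\<bar>t\<bar> \<le> 1 / 4"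
  have "(\<lambda>t. t * cos (pi * t)) \<bar>t\<bar> \<le> (\<lambda>t. t * cos (pi * t)) (1 / 4)"
  proof (rule DERIV_nonneg_imp_nondecreasing[OF t])
    fix x assume x: "\<bar>t\<bar> \<le> x" "x \<le> 1 / 4"
    have "pi * x \<le> pi * (1 / 4)" using x by (intro mult_left_mono) auto
    moreover have "0 \<le> pi * x" using x by simp
    ultimately have px: "0 \<le> pi * x" "pi * x \<le> pi / 4" "pi * x \<le> 1"
      using pi_less_4 by linarith+
    have "sin (pi * x) \<le> sin (pi / 4)"
      using px pi_gt_zero by (intro sin_monotone_2pi_le) linarith+
    also have "\<dots> = cos (pi / 4)" by (simp add: sin_45 cos_45)
    also have "\<dots> \<le> cos (pi * x)"
      using px pi_gt_zero by (intro cos_monotone_0_pi_le) linarith+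
    finally have "sin (pi * x) \<le> cos (pi * x)" .
    moreover have "pi * x * sin (pi * x) \<le> 1 * sin (pi * x)"
      using px pi_gt_zero by (intro mult_right_mono sin_ge_zero) linarith+
    moreover have "((\<lambda>t. t * cos (pi * t)) has_real_derivative cos (pi * x) - pi * x * sin (pi * x)) (at x)"
      by (auto intro!: derivative_eq_intros)
    ultimately show "\<exists>y. ((\<lambda>t. t * cos (pi * t)) has_real_derivative y) (at x) \<and> y \<ge> 0"
      by (intro exI[of _ "cos (pi * x) - pi * x * sin (pi * x)"]) auto
  qed
  moreover have "cos (pi * \<bar>t\<bar>) \<ge> 0"
  proof (rule cos_ge_zero)
    show "pi * \<bar>t\<bar> \<le> pi / 2" using mult_left_mono[OF t, of pi] pi_gt_zero by simp
    have "0 \<le> pi * \<bar>t\<bar>" by simp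
    then show "- (pi / 2) \<le> pi * \<bar>t\<bar>" using pi_gt_zero by linarith
  qed
  moreover have "cos (pi * \<bar>t\<bar>) = cos (pi * t)" by (auto simp: abs_if)
  ultimately show ?thesis by (simp add: abs_mult sin_45 cos_45)
qed

text \<open>
  The bound for \<open>|\<delta>| = 1/4\<close> written as a difference, so that the sum over all \<open>j\<close> telescopes.
\<close>

definition kadec_bound :: "int \<Rightarrow> real" where
  "kadec_bound j = 2 * sin (pi / 4) / pi * (1 / (2 * \<bar>j\<bar> - 1) - 1 / (2 * \<bar>j\<bar> + 1))"

lemma coeff_nonzero_le:
  assumes "\<bar>\<delta>\<bar> \<le> 1 / 4" "j \<noteq> 0"
  shows "\<bar>kadec_coeff \<delta> j\<bar> \<le> kadec_bound j"
proof -
  \<comment> \<open>With \<open>a = j / 2\<close> both parities lead to \<open>\<delta> w / (\<pi> (a\<^sup>2 - \<delta>\<^sup>2))\<close> up to sign, where \<open>w\<close> is the sine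
    or the cosine of \<open>\<pi> \<delta>\<close>; numerator and denominator are worst for \<open>|\<delta>| = 1/4\<close>.\<close>
  define a :: real where "a = j / 2"
  have "(1::int) \<le> \<bar>j\<bar>" using assms(2) by linarith
  then have j1: "(1::real) \<le> \<bar>real_of_int j\<bar>" by linarith
  then have a: "1 / 2 \<le> \<bar>a\<bar>" by (simp add: a_def)
  then have ne: "\<delta> - a \<noteq> 0" "\<delta> + a \<noteq> 0" using assms(1) by auto
  have "(1 / 2)\<^sup>2 \<le> \<bar>a\<bar>\<^sup>2" using a by (intro power_mono) auto
  moreover have "\<bar>\<delta>\<bar>\<^sup>2 \<le> (1 / 4)\<^sup>2" using assms(1) by (intro power_mono) auto
  ultimately have sq: "0 < a\<^sup>2 - 1 / 16" "a\<^sup>2 - 1 / 16 \<le> a\<^sup>2 - \<delta>\<^sup>2"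
    by (simp_all add: power_divide)
  obtain w where w: "\<bar>kadec_coeff \<delta> j\<bar> = \<bar>\<delta> * w\<bar> / (pi * (a\<^sup>2 - \<delta>\<^sup>2))" "\<bar>\<delta> * w\<bar> \<le> sin (pi / 4) / 4"
  proof (cases "even j")
    case True
    then obtain k where k: "j = 2 * k" by blast
    then have ak: "a = of_int k" by (simp add: a_def)
    define \<sigma> where "\<sigma> = cos (pi * a)"
    have \<sigma>: "sin (pi * a) = 0" "\<bar>\<sigma>\<bar> = 1"
      by (auto simp: \<sigma>_def ak mult.commute[of pi] sin_zero_iff_int2 intro!: sin_zero_abs_cos_one)
    have "sin (pi * (\<delta> - a)) = \<sigma> * sin (pi * \<delta>)" "sin (pi * (\<delta> + a)) = \<sigma> * sin (pi * \<delta>)"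
      by (simp_all add: right_diff_distrib distrib_left sin_diff sin_add \<sigma>(1) \<sigma>_def)
    then have sinc: "sinc (\<delta> - a) = \<sigma> * sin (pi * \<delta>) / pi * (1 / (\<delta> - a))"
        "sinc (\<delta> + a) = \<sigma> * sin (pi * \<delta>) / pi * (1 / (\<delta> + a))"
      using ne by (simp_all add: sinc_def)
    have "kadec_coeff \<delta> j = 0 - (sinc (\<delta> - a) + 1 * sinc (\<delta> + a)) / 2"
      using assms(2) True by (simp only: kadec_coeff_def a_def if_True if_False)
    also have "\<dots> = - (\<sigma> * sin (pi * \<delta>) / pi) * (1 / (\<delta> - a) + 1 / (\<delta> + a)) / 2"
      unfolding sinc by algebra
    also have "1 / (\<delta> - a) + 1 / (\<delta> + a) = 2 * \<delta> / (\<delta>\<^sup>2 - a\<^sup>2)"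
      using ne by (simp add: field_simps power2_eq_square)
    also have "- (\<sigma> * sin (pi * \<delta>) / pi) * (2 * \<delta> / (\<delta>\<^sup>2 - a\<^sup>2)) / 2 = \<sigma> * (\<delta> * sin (pi * \<delta>)) / (pi * (a\<^sup>2 - \<delta>\<^sup>2))"
      using sq by (simp add: field_simps)
    finally have "\<bar>kadec_coeff \<delta> j\<bar> = \<bar>\<delta> * sin (pi * \<delta>)\<bar> / (pi * (a\<^sup>2 - \<delta>\<^sup>2))"
      using sq \<sigma>(2) by (simp add: abs_mult)
    then show ?thesis using that mult_sin_le[OF assms(1)] by blast
  next
    case False
    then obtain k where k: "j = 2 * k + 1" by (elim oddE)
    then have ak: "pi * a = of_int k * pi + pi / 2" by (simp add: a_def algebra_simps add_divide_distrib)
    define \<sigma> where "\<sigma> = sin (pi * a)"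
    have "sin (of_int k * pi) = 0" by (auto simp: sin_zero_iff_int2)
    then have \<sigma>: "cos (pi * a) = 0" "\<bar>\<sigma>\<bar> = 1"
      using sin_zero_abs_cos_one by (auto simp: \<sigma>_def ak sin_add cos_add)
    have "sin (pi * (\<delta> - a)) = - \<sigma> * cos (pi * \<delta>)" "sin (pi * (\<delta> + a)) = \<sigma> * cos (pi * \<delta>)"
      by (simp_all add: right_diff_distrib distrib_left sin_diff sin_add \<sigma>(1) \<sigma>_def)
    then have sinc: "sinc (\<delta> - a) = - (\<sigma> * cos (pi * \<delta>) / pi * (1 / (\<delta> - a)))"
        "sinc (\<delta> + a) = \<sigma> * cos (pi * \<delta>) / pi * (1 / (\<delta> + a))"
      using ne by (simp_all add: sinc_def)
    have "kadec_coeff \<delta> j = 0 - (sinc (\<delta> - a) + - 1 * sinc (\<delta> + a)) / 2"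
      using assms(2) False by (simp only: kadec_coeff_def a_def if_False)
    also have "\<dots> = (\<sigma> * cos (pi * \<delta>) / pi) * (1 / (\<delta> - a) + 1 / (\<delta> + a)) / 2"
      proof -
      have "0 - (- (X * B) + - 1 * (X * C)) / 2 = X * (B + C) / 2" for X B C :: real
        by (simp add: field_simps)
      then show ?thesis unfolding sinc .
    qed
    also have "1 / (\<delta> - a) + 1 / (\<delta> + a) = 2 * \<delta> / (\<delta>\<^sup>2 - a\<^sup>2)"
      using ne by (simp add: field_simps power2_eq_square)
    also have "(\<sigma> * cos (pi * \<delta>) / pi) * (2 * \<delta> / (\<delta>\<^sup>2 - a\<^sup>2)) / 2 = - \<sigma> * (\<delta> * cos (pi * \<delta>)) / (pi * (a\<^sup>2 - \<delta>\<^sup>2))"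
      using sq by (simp add: field_simps)
    finally have "\<bar>kadec_coeff \<delta> j\<bar> = \<bar>\<delta> * cos (pi * \<delta>)\<bar> / (pi * (a\<^sup>2 - \<delta>\<^sup>2))"
      using sq \<sigma>(2) by (simp add: abs_mult)
    then show ?thesis using that mult_cos_le[OF assms(1)] by blast
  qed
  have "\<bar>kadec_coeff \<delta> j\<bar> \<le> (sin (pi / 4) / 4) / (pi * (a\<^sup>2 - 1 / 16))"
    unfolding w(1) using w(2) sq pi_gt_zero by (intro frac_le mult_left_mono mult_pos_pos) auto
  also have "\<dots> = kadec_bound j"
  proof -
    have "a\<^sup>2 = \<bar>real_of_int j\<bar>\<^sup>2 / 4" by (simp add: a_def power_divide)
    moreover have "2 * \<bar>real_of_int j\<bar> - 1 \<noteq> 0" "2 * \<bar>real_of_int j\<bar> + 1 \<noteq> 0" using j1 by auto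
    ultimately show ?thesis
      using sq unfolding kadec_bound_def by (simp add: field_simps power2_eq_square)
  qed
  finally show ?thesis .
qed

lemma sum_coeff_bound_le:
  assumes "finite K" "0 \<notin> K"
  shows "(\<Sum>j\<in>K. kadec_bound j) \<le> sinc (1 / 4)"
proof -
  have nonneg: "kadec_bound j \<ge> 0" if "j \<noteq> 0" for j
  proof -
    have "(1::int) \<le> \<bar>j\<bar>" using that by linarith
    then have "(1::real) \<le> \<bar>real_of_int j\<bar>" by linarith
    then have "1 / (2 * \<bar>real_of_int j\<bar> + 1) \<le> 1 / (2 * \<bar>real_of_int j\<bar> - 1)"
      by (intro divide_left_mono mult_pos_pos) auto
    then show ?thesis
      unfolding kadec_bound_def by (intro mult_nonneg_nonneg divide_nonneg_pos) (auto intro!: sin_ge_zero)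
  qed
  have telescope: "(\<Sum>j\<in>{1..int N}. kadec_bound j) = 2 * sin (pi / 4) / pi * (1 - 1 / (2 * real N + 1))" for N
  proof (induction N)
    case (Suc N)
    have "{1..int (Suc N)} = insert (int N + 1) {1..int N}" by auto
    then have "(\<Sum>j\<in>{1..int (Suc N)}. kadec_bound j) = kadec_bound (int N + 1) + (\<Sum>j\<in>{1..int N}. kadec_bound j)"
      by simp
    also have "kadec_bound (int N + 1) =
        2 * sin (pi / 4) / pi * (1 / (2 * real N + 1) - 1 / (2 * real (Suc N) + 1))"
      by (simp add: kadec_bound_def add.commute)
    also have "\<dots> + (\<Sum>j\<in>{1..int N}. kadec_bound j) = 2 * sin (pi / 4) / pi * (1 - 1 / (2 * real (Suc N) + 1))"
      unfolding Suc by algebra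
    finally show ?case .
  qed simp
  have half: "(\<Sum>j\<in>P. kadec_bound j) \<le> 2 * sin (pi / 4) / pi" if P: "finite P" "\<And>j. j \<in> P \<Longrightarrow> j > 0" for P
  proof -
    obtain N where "\<And>j. j \<in> P \<Longrightarrow> j \<le> int N"
      using P(1) by (metis Max_ge int_nat_eq nat_le_iff order_trans le_refl nat_le_eq_zle linear)
    then have "(\<Sum>j\<in>P. kadec_bound j) \<le> (\<Sum>j\<in>{1..int N}. kadec_bound j)"
      using P(2) by (intro sum_mono2 nonneg) (force simp: int_one_le_iff_zero_less)+
    also have "\<dots> \<le> 2 * sin (pi / 4) / pi * 1"
      unfolding telescope by (intro mult_left_mono) (auto intro!: divide_nonneg_pos mult_nonneg_nonneg sin_ge_zero)
    finally show ?thesis by simp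
  qed
  let ?P = "{j\<in>K. j > 0}" and ?N = "{j\<in>K. j < 0}"
  have "j < 0 \<or> j > 0" if "j \<in> K" for j
    using that assms(2) by (cases j "0::int" rule: linorder_cases) auto
  then have "K = ?P \<union> ?N" by blast
  then have "(\<Sum>j\<in>K. kadec_bound j) = (\<Sum>j\<in>?P \<union> ?N. kadec_bound j)" by simp
  also have "\<dots> = (\<Sum>j\<in>?P. kadec_bound j) + (\<Sum>j\<in>?N. kadec_bound j)"
    using assms(1) by (intro sum.union_disjoint) auto
  also have "(\<Sum>j\<in>?N. kadec_bound j) = (\<Sum>j\<in>uminus ` ?N. kadec_bound j)"
    by (subst sum.reindex) (auto simp: kadec_bound_def)
  also have "(\<Sum>j\<in>?P. kadec_bound j) + (\<Sum>j\<in>uminus ` ?N. kadec_bound j) \<le>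
      2 * sin (pi / 4) / pi + 2 * sin (pi / 4) / pi"
    using assms by (intro add_mono half) auto
  also have "\<dots> = sinc (1 / 4)" by (simp add: sinc_def field_simps)
  finally show ?thesis .
qed

lemma coeff_le:
  assumes "\<bar>\<delta>\<bar> \<le> L" "L < 1 / 4"
  shows "\<bar>kadec_coeff \<delta> j\<bar> \<le> (if j = 0 then 1 - sinc L else kadec_bound j)"
proof (cases "j = 0")
  case True
  have "sinc \<bar>\<delta>\<bar> \<ge> sinc L"
    using sinc_less[of "\<bar>\<delta>\<bar>" L] assms by (cases "\<bar>\<delta>\<bar> = L") auto
  moreover have "sinc \<bar>\<delta>\<bar> \<le> sinc 0"
    using sinc_less[of 0 "\<bar>\<delta>\<bar>"] assms by (cases "\<delta> = 0") auto
  moreover have "sinc \<bar>\<delta>\<bar> = sinc \<delta>" by (auto simp: abs_if)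
  moreover have "sinc 0 = 1" by (simp add: sinc_def)
  ultimately show ?thesis using True by (simp add: kadec_coeff_def)
qed (use coeff_nonzero_le assms in auto)

text \<open>
  The right-hand side is below \<open>1\<close> because \<open>sinc\<close> is strictly decreasing on \<open>[0, 1/4]\<close>; at
  \<open>L = 1/4\<close> it would be \<open>1\<close>, which is why \<open>1/4\<close> is the limit of this method.
\<close>

lemma sum_coeff_le:
  assumes "finite K" "0 \<le> L" "L < 1 / 4"
  shows "(\<Sum>j\<in>K. if j = 0 then 1 - sinc L else kadec_bound j) \<le> 1 - sinc L + sinc (1 / 4)"
proof -
  have "sinc L \<le> 1" using sinc_less[of 0 L] assms by (cases "L = 0") (auto simp: sinc_def)
  let ?t = "\<lambda>j. if j = 0 then 1 - sinc L else kadec_bound j"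
  have "(\<Sum>j\<in>K. ?t j) \<le> (\<Sum>j\<in>insert 0 K. ?t j)"
    using assms \<open>sinc L \<le> 1\<close> by (intro sum_mono2) auto
  also have "\<dots> = 1 - sinc L + (\<Sum>j\<in>K - {0}. ?t j)" using assms(1) by (simp add: sum.insert_remove)
  also have "(\<Sum>j\<in>K - {0}. ?t j) = (\<Sum>j\<in>K - {0}. kadec_bound j)" by (intro sum.cong) auto
  also have "\<dots> \<le> sinc (1 / 4)" using assms(1) by (intro sum_coeff_bound_le) auto
  finally show ?thesis by simp
qed


subsection \<open>Expansion of the perturbation\<close>

lemma cinner_diff:
  assumes "f \<in> L2_on D" "g \<in> L2_on D" "h \<in> L2_on D"
  shows "cinner D (\<lambda>x. f x - g x) h = cinner D f h - cinner D g h"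
  unfolding cinner_def using integrable_mult_cnj[OF assms(1,3)] integrable_mult_cnj[OF assms(2,3)]
  by (simp add: left_diff_distrib)

lemma cinner_add:
  assumes "f \<in> L2_on D" "g \<in> L2_on D" "h \<in> L2_on D"
  shows "cinner D (\<lambda>x. f x + g x) h = cinner D f h + cinner D g h"
  unfolding cinner_def using integrable_mult_cnj[OF assms(1,3)] integrable_mult_cnj[OF assms(2,3)]
  by (simp add: distrib_right)

lemma cinner_cmult:
  "cinner D (\<lambda>x. a * f x) h = a * cinner D f h"
  unfolding cinner_def by (simp add: mult.assoc)

lemma approx_by_coefficients:
  assumes comp: "complete_on unit_interval \<Lambda>" and diff: "\<And>\<nu> \<mu>. \<nu> \<in> \<Lambda> \<Longrightarrow> \<mu> \<in> \<Lambda> \<Longrightarrow> \<nu> - \<mu> \<in> \<int>"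
    and f: "f \<in> L2_on unit_interval" and e: "e > 0"
  obtains F where "finite F" "F \<subseteq> \<Lambda>"
    "L2_norm unit_interval (\<lambda>x. f x - trig_poly F (\<lambda>\<nu>. cinner unit_interval f (expo \<nu>)) x) < e"
proof -
  obtain p where p: "p \<in> trig_span \<Lambda>" "L2_norm unit_interval (\<lambda>x. f x - p x) < e"
    using complete_onE[OF comp f e] .
  then obtain F c where F: "finite F" "F \<subseteq> \<Lambda>" "L2_norm unit_interval (\<lambda>x. f x - trig_poly F c x) < e"
    by (auto simp: trig_span_def)
  have "L2_norm unit_interval (\<lambda>x. f x - trig_poly F (\<lambda>\<nu>. cinner unit_interval f (expo \<nu>)) x)
      \<le> L2_norm unit_interval (\<lambda>x. f x - trig_poly F c x)"
    using F diff by (intro best_approximation f) auto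
  with F show thesis by (intro that[of F]) auto
qed

text \<open>
  The even part \<open>1 - cos (2 \<pi> \<delta> x)\<close> of the perturbation is expanded in the integer frequencies, the
  odd part \<open>- \<i> sin (2 \<pi> \<delta> x)\<close> in the half-integers. The odd part is discontinuous as a function on
  the circle, but turns continuous when multiplied by an exponential with half-integer frequency;
  therefore the second expansion has small coefficients, which is Kadec's observation.
\<close>

lemma perturbation_expansion:
  assumes e: "e > 0"
  obtains K where "finite K"
    "L2_norm unit_interval (\<lambda>x. 1 - expo \<delta> x - (\<Sum>j\<in>K. of_real (kadec_coeff \<delta> j) * expo (of_int j / 2) x)) < e"
proof -
  let ?D = unit_interval
  have D: "?D \<in> lmeasurable" by simp
  note L2 = expo_in_L2[OF D]
  let ?u = "\<lambda>x. expo 0 x - (1 / 2) * (expo \<delta> x + expo (- \<delta>) x)"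
  let ?v = "\<lambda>x. (- 1 / 2) * (expo \<delta> x - expo (- \<delta>) x)"
  have u: "?u \<in> L2_on ?D" and v: "?v \<in> L2_on ?D"
    by (intro L2_on_diff L2_on_add L2_on_cmult L2)+
  have cu: "cinner ?D ?u (expo \<nu>) = of_real (sinc \<nu> - (sinc (\<delta> - \<nu>) + sinc (\<delta> + \<nu>)) / 2)" for \<nu>
  proof -
    have "sinc (- \<delta> - \<nu>) = sinc (\<delta> + \<nu>)" using sinc_uminus[of "\<delta> + \<nu>"] by simp
    then show ?thesis
      unfolding cinner_diff[OF L2 L2_on_cmult[OF L2_on_add[OF L2 L2]] L2] cinner_cmult
        cinner_add[OF L2 L2 L2] cinner_expo by simp
  qed
  have cv: "cinner ?D ?v (expo \<nu>) = of_real (- (sinc (\<delta> - \<nu>) - sinc (\<delta> + \<nu>)) / 2)" for \<nu>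
  proof -
    have "sinc (- \<delta> - \<nu>) = sinc (\<delta> + \<nu>)" using sinc_uminus[of "\<delta> + \<nu>"] by simp
    then show ?thesis
      unfolding cinner_cmult cinner_diff[OF L2 L2 L2] cinner_expo by (simp add: field_simps)
  qed
  obtain F where F: "finite F" "F \<subseteq> \<int>"
      "L2_norm ?D (\<lambda>x. ?u x - trig_poly F (\<lambda>\<nu>. cinner ?D ?u (expo \<nu>)) x) < e / 2"
    by (rule approx_by_coefficients[OF fourier_complete _ u, of "e / 2"]) (use e in auto)
  obtain G where G: "finite G" "G \<subseteq> (+) (1 / 2) ` \<int>"
      "L2_norm ?D (\<lambda>x. ?v x - trig_poly G (\<lambda>\<nu>. cinner ?D ?v (expo \<nu>)) x) < e / 2"
    by (rule approx_by_coefficients[OF complete_on_shift[OF D fourier_complete] _ v, of "1 / 2" "e / 2"]) (use e in auto)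
  define K where "K F = {j::int. of_int j / 2 \<in> F}" for F :: "real set"
  have reindex: "finite (K F)" "trig_poly F a x = (\<Sum>j\<in>K F. a (of_int j / 2) * expo (of_int j / 2) x)"
    if fin: "finite F" and half: "\<And>\<nu>. \<nu> \<in> F \<Longrightarrow> 2 * \<nu> \<in> \<int>" for F a x
  proof -
    let ?h = "\<lambda>j::int. real_of_int j / 2"
    have inj: "inj_on ?h (K F)" by (auto simp: inj_on_def)
    have F: "F = ?h ` K F"
    proof
      show "F \<subseteq> ?h ` K F"
      proof
        fix \<nu> assume \<nu>: "\<nu> \<in> F"
        then obtain j :: int where "2 * \<nu> = of_int j" using half by (meson Ints_cases)
        then have "\<nu> = ?h j" by simp
        with \<nu> show "\<nu> \<in> ?h ` K F" unfolding K_def by blast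
      qed
    qed (auto simp: K_def)
    then show "finite (K F)" using fin inj finite_image_iff by metis
    show "trig_poly F a x = (\<Sum>j\<in>K F. a (?h j) * expo (?h j) x)"
      unfolding trig_poly_def by (subst F, subst sum.reindex[OF inj]) simp
  qed
  have F2: "2 * \<nu> \<in> \<int>" if "\<nu> \<in> F" for \<nu> using F(2) that by auto
  have G2: "2 * \<nu> \<in> \<int>" if "\<nu> \<in> G" for \<nu> using G(2) that by (auto simp: distrib_left)
  have even: "even j" if "j \<in> K F" for j
  proof -
    have "of_int j / 2 \<in> (\<int> :: real set)" using F(2) that unfolding K_def by blast
    then obtain k :: int where "of_int j / 2 = real_of_int k" by (elim Ints_cases)
    then have "j = 2 * k" by linarith
    then show ?thesis by simp
  qed
  have odd: "odd j" if "j \<in> K G" for j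
  proof -
    have "of_int j / 2 \<in> (+) (1 / 2) ` (\<int> :: real set)" using G(2) that unfolding K_def by blast
    then obtain k :: int where "of_int j / 2 = 1 / 2 + real_of_int k" unfolding Ints_def by blast
    then have "j = 2 * k + 1" by linarith
    then show ?thesis by simp
  qed
  have coeff_F: "cinner ?D ?u (expo (of_int j / 2)) = of_real (kadec_coeff \<delta> j)" if "j \<in> K F" for j
  proof -
    from even[OF that] obtain k where "j = 2 * k" by blast
    then have "sinc (of_int j / 2) = (if j = 0 then 1 else 0)"
      using sinc_Ints[of "of_int k"] by (cases "k = 0") (simp_all add: sinc_def)
    then show ?thesis unfolding cu kadec_coeff_def using even[OF that] by simp
  qed
  have coeff_G: "cinner ?D ?v (expo (of_int j / 2)) = of_real (kadec_coeff \<delta> j)" if "j \<in> K G" for j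
  proof -
    have "j \<noteq> 0" using odd[OF that] by auto
    then show ?thesis unfolding cv kadec_coeff_def using odd[OF that] by (simp add: field_simps)
  qed
  have disj: "K F \<inter> K G = {}" using even odd by blast
  have fin: "finite (K F)" "finite (K G)" using reindex(1) F(1) F2 G(1) G2 by auto
  let ?p = "trig_poly F (\<lambda>\<nu>. cinner ?D ?u (expo \<nu>))" and ?q = "trig_poly G (\<lambda>\<nu>. cinner ?D ?v (expo \<nu>))"
  have "?p x = (\<Sum>j\<in>K F. of_real (kadec_coeff \<delta> j) * expo (of_int j / 2) x)" for x
  proof -
    have "?p x = (\<Sum>j\<in>K F. cinner ?D ?u (expo (of_int j / 2)) * expo (of_int j / 2) x)"
      by (rule reindex(2)[OF F(1)]) (rule F2)
    also have "\<dots> = (\<Sum>j\<in>K F. of_real (kadec_coeff \<delta> j) * expo (of_int j / 2) x)"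
      by (intro sum.cong refl) (simp only: coeff_F)
    finally show ?thesis .
  qed
  moreover have "?q x = (\<Sum>j\<in>K G. of_real (kadec_coeff \<delta> j) * expo (of_int j / 2) x)" for x
  proof -
    have "?q x = (\<Sum>j\<in>K G. cinner ?D ?v (expo (of_int j / 2)) * expo (of_int j / 2) x)"
      by (rule reindex(2)[OF G(1)]) (rule G2)
    also have "\<dots> = (\<Sum>j\<in>K G. of_real (kadec_coeff \<delta> j) * expo (of_int j / 2) x)"
      by (intro sum.cong refl) (simp only: coeff_G)
    finally show ?thesis .
  qed
  ultimately have "(\<Sum>j\<in>K F \<union> K G. of_real (kadec_coeff \<delta> j) * expo (of_int j / 2) x) = ?p x + ?q x" for x
    unfolding sum.union_disjoint[OF fin disj] by simp
  note sum_eq = this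
  have "(\<lambda>x. 1 - expo \<delta> x - (\<Sum>j\<in>K F \<union> K G. of_real (kadec_coeff \<delta> j) * expo (of_int j / 2) x)) =
      (\<lambda>x. (?u x - ?p x) + (?v x - ?q x))"
  proof -
    have gen: "1 - a - (p + q) = (1 - (1 / 2) * (a + b) - p) + ((- 1 / 2) * (a - b) - q)" for a b p q :: complex
      by (simp add: field_simps)
    show ?thesis unfolding sum_eq expo_0 by (rule ext) (rule gen)
  qed
  moreover have "L2_norm ?D (\<lambda>x. (?u x - ?p x) + (?v x - ?q x)) < e"
  proof -
    have "L2_norm ?D (\<lambda>x. (?u x - ?p x) + (?v x - ?q x))
        \<le> L2_norm ?D (\<lambda>x. ?u x - ?p x) + L2_norm ?D (\<lambda>x. ?v x - ?q x)"
      by (intro L2_norm_triangle[OF L2_on_diff[OF u] L2_on_diff[OF v]] trig_poly_in_L2 D)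
    then show ?thesis using F(3) G(3) by simp
  qed
  ultimately show thesis using that[of "K F \<union> K G"] fin by simp
qed

subsection \<open>The perturbed exponentials\<close>

lemma parseval_int:
  fixes F :: "int set"
  assumes "finite F"
  shows "L2_norm unit_interval (\<lambda>x. \<Sum>n\<in>F. c n * expo (of_int n) x) = L2_set (\<lambda>n. cmod (c n)) F"
proof -
  have inj: "inj_on real_of_int F" by (simp add: inj_on_def)
  have eq: "(\<lambda>x. \<Sum>n\<in>F. c n * expo (of_int n) x) = trig_poly (real_of_int ` F) (\<lambda>\<nu>. c \<lfloor>\<nu>\<rfloor>)"
    by (simp add: trig_poly_def[abs_def] sum.reindex[OF inj])
  have "L2_norm unit_interval (\<lambda>x. \<Sum>n\<in>F. c n * expo (of_int n) x) = L2_set (\<lambda>\<nu>. cmod (c \<lfloor>\<nu>\<rfloor>)) (real_of_int ` F)"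
    unfolding eq using assms by (intro parseval) auto
  also have "\<dots> = L2_set (\<lambda>n. cmod (c n)) F"
    by (simp add: L2_set_def sum.reindex[OF inj])
  finally show ?thesis .
qed

locale kadec =
  fixes \<omega> :: "int \<Rightarrow> real" and L :: real
  assumes L: "0 \<le> L" "L < 1 / 4" and close: "\<And>n. \<bar>\<omega> n - of_int n\<bar> \<le> L"
begin

definition "\<kappa> = 1 - sinc L + sinc (1 / 4)"

lemma kappa: "0 \<le> \<kappa>" "\<kappa> < 1"
proof -
  have "sinc (1 / 4) < sinc L" using L by (intro sinc_less) auto
  then show "\<kappa> < 1" by (simp add: \<kappa>_def)
  have "0 \<le> sinc (1 / 4)" using sum_coeff_bound_le[of "{}"] by simp
  moreover have "sinc L \<le> 1" using sinc_less[of 0 L] L by (cases "L = 0") (auto simp: sinc_def)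
  ultimately show "0 \<le> \<kappa>" by (simp add: \<kappa>_def)
qed

lemma inj_omega: "inj \<omega>"
proof (rule injI)
  fix m n assume "\<omega> m = \<omega> n"
  then have "\<bar>real_of_int m - real_of_int n\<bar> < 1" using close[of m] close[of n] L by linarith
  then show "m = n" by linarith
qed

text \<open>
  After expanding each perturbation and exchanging the two sums, every frequency \<open>j / 2\<close> contributes
  \<open>expo (j / 2)\<close> times a Fourier series, whose coefficients are the \<open>c n\<close> times numbers that are
  bounded uniformly in \<open>n\<close>. The sum of these bounds over all \<open>j\<close> is at most \<open>\<kappa>\<close>.
\<close>

lemma perturbation_le:
  assumes F: "finite F"
  shows "L2_norm unit_interval (\<lambda>x. \<Sum>n\<in>F. c n * (expo (of_int n) x - expo (\<omega> n) x))
    \<le> \<kappa> * L2_set (\<lambda>n. cmod (c n)) F"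
proof (rule field_le_epsilon)
  let ?D = unit_interval
  have D: "?D \<in> lmeasurable" by simp
  note L2 = L2_on_cmult L2_on_sum L2_on_diff expo_in_L2[OF D]
  fix e :: real assume e: "e > 0"
  \<comment> \<open>The expansions are truncated with error \<open>e / C\<close> each; the summand \<open>1\<close> keeps \<open>C\<close> positive.\<close>
  define C where "C = (\<Sum>n\<in>F. cmod (c n)) + 1"
  have C: "C > 0" by (simp add: C_def sum_nonneg add_nonneg_pos)
  define \<delta> where "\<delta> n = \<omega> n - of_int n" for n
  define R where "R K n x = 1 - expo (\<delta> n) x - (\<Sum>j\<in>K. of_real (kadec_coeff (\<delta> n) j) * expo (of_int j / 2) x)" for K n x
  have "\<exists>K. finite K \<and> L2_norm ?D (R K n) < e / C" for n
  proof -
    have "e / C > 0" using e C by simp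
    from perturbation_expansion[OF this, of "\<delta> n"] show ?thesis unfolding R_def[abs_def] by blast
  qed
  then obtain K where K: "\<And>n. finite (K n)" "\<And>n. L2_norm ?D (R (K n) n) < e / C" by metis
  have R_L2: "R (K n) n \<in> L2_on ?D" for n
  proof -
    have "(\<lambda>x. 1) \<in> L2_on ?D" using expo_in_L2[OF D, of 0] by (simp cong: L2_on_cong)
    then show ?thesis unfolding R_def[abs_def] by (intro L2)
  qed
  define U where "U = (\<Union>n\<in>F. K n)"
  have U: "finite U" using F K by (simp add: U_def)
  define b where "b n j = (if j \<in> K n then kadec_coeff (\<delta> n) j else 0)" for n j
  define t where "t j = (if j = 0 then 1 - sinc L else kadec_bound j)" for j :: int
  have b: "\<bar>b n j\<bar> \<le> t j" for n j
    using coeff_le[of "\<delta> n" L j] coeff_le[of 0 L j] close[of n] L by (auto simp: b_def t_def \<delta>_def split: if_splits)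
  let ?err = "\<lambda>x. \<Sum>n\<in>F. c n * (R (K n) n x * expo (of_int n) x)"
  let ?main = "\<lambda>x. \<Sum>j\<in>U. (\<Sum>n\<in>F. (c n * of_real (b n j)) * expo (of_int n) x) * expo (of_int j / 2) x"
  have split: "c n * (expo (of_int n) x - expo (\<omega> n) x) =
      c n * (R (K n) n x * expo (of_int n) x) + (\<Sum>j\<in>U. c n * of_real (b n j) * expo (of_int n) x * expo (of_int j / 2) x)"
    if "n \<in> F" for n x
  proof -
    have "expo (\<omega> n) x = expo (of_int n) x * expo (\<delta> n) x"
      by (simp add: \<delta>_def flip: expo_add)
    moreover have "(\<Sum>j\<in>U. of_real (b n j) * expo (of_int j / 2) x) = (\<Sum>j\<in>K n. of_real (kadec_coeff (\<delta> n) j) * expo (of_int j / 2) x)"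
      using U that by (intro sum.mono_neutral_cong_right) (auto simp: b_def U_def)
    moreover have "(\<Sum>j\<in>U. c n * of_real (b n j) * expo (of_int n) x * expo (of_int j / 2) x) =
        c n * expo (of_int n) x * (\<Sum>j\<in>U. of_real (b n j) * expo (of_int j / 2) x)"
      unfolding sum_distrib_left by (intro sum.cong) (auto simp: mult_ac)
    ultimately show ?thesis by (simp add: R_def algebra_simps)
  qed
  have eq: "(\<lambda>x. \<Sum>n\<in>F. c n * (expo (of_int n) x - expo (\<omega> n) x)) = (\<lambda>x. ?err x + ?main x)"
  proof
    fix x
    have "(\<Sum>n\<in>F. c n * (expo (of_int n) x - expo (\<omega> n) x)) = ?err x +
        (\<Sum>n\<in>F. \<Sum>j\<in>U. c n * of_real (b n j) * expo (of_int n) x * expo (of_int j / 2) x)"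
      unfolding sum.distrib[symmetric] by (intro sum.cong refl split)
    also have "(\<Sum>n\<in>F. \<Sum>j\<in>U. c n * of_real (b n j) * expo (of_int n) x * expo (of_int j / 2) x) = ?main x"
      by (subst sum.swap) (simp add: sum_distrib_right)
    finally show "(\<Sum>n\<in>F. c n * (expo (of_int n) x - expo (\<omega> n) x)) = ?err x + ?main x" .
  qed
  have unimod: "(\<lambda>x. f x * expo \<nu> x) \<in> L2_on ?D" "L2_norm ?D (\<lambda>x. f x * expo \<nu> x) = L2_norm ?D f"
    if "f \<in> L2_on ?D" for f \<nu>
    using L2_on_mult_unimodular[OF that continuous_on_expo] by (auto simp: norm_mult intro: L2_norm_cong)
  have inner_L2: "(\<lambda>x. \<Sum>n\<in>F. (c n * of_real (b n j)) * expo (of_int n) x) \<in> L2_on ?D" for j by (intro L2)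
  have err_L2: "(\<lambda>x. c n * (R (K n) n x * expo (of_int n) x)) \<in> L2_on ?D" for n
    by (intro L2_on_cmult unimod R_L2)
  have "L2_norm ?D ?err \<le> (\<Sum>n\<in>F. L2_norm ?D (\<lambda>x. c n * (R (K n) n x * expo (of_int n) x)))"
    by (intro L2_norm_sum_le err_L2)
  also have "\<dots> = (\<Sum>n\<in>F. cmod (c n) * L2_norm ?D (R (K n) n))"
    by (simp add: L2_norm_cmult unimod(2)[OF R_L2])
  also have "\<dots> \<le> (\<Sum>n\<in>F. cmod (c n) * (e / C))"
    using K(2) by (intro sum_mono mult_left_mono) (auto intro: less_imp_le)
  also have "\<dots> = (C - 1) * (e / C)" by (simp only: C_def add_diff_cancel_right' sum_distrib_right)
  also have "\<dots> \<le> C * (e / C)" using e C by (intro mult_right_mono) auto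
  also have "\<dots> = e" using C by simp
  finally have err: "L2_norm ?D ?err \<le> e" .
  have "L2_norm ?D ?main \<le> (\<Sum>j\<in>U. L2_norm ?D (\<lambda>x. (\<Sum>n\<in>F. (c n * of_real (b n j)) * expo (of_int n) x) * expo (of_int j / 2) x))"
    by (intro L2_norm_sum_le unimod inner_L2)
  also have "\<dots> = (\<Sum>j\<in>U. L2_set (\<lambda>n. cmod (c n * of_real (b n j))) F)"
    unfolding unimod(2)[OF inner_L2] parseval_int[OF F] ..
  also have "\<dots> \<le> (\<Sum>j\<in>U. t j * L2_set (\<lambda>n. cmod (c n)) F)"
  proof (rule sum_mono)
    fix j
    have "t j \<ge> 0" using b[of undefined j] by linarith
    have "L2_set (\<lambda>n. cmod (c n * of_real (b n j))) F \<le> L2_set (\<lambda>n. t j * cmod (c n)) F"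
      using b by (intro L2_set_mono) (auto simp: norm_mult mult.commute[of "cmod (c _)"] intro!: mult_right_mono)
    then show "L2_set (\<lambda>n. cmod (c n * of_real (b n j))) F \<le> t j * L2_set (\<lambda>n. cmod (c n)) F"
      using L2_set_right_distrib[OF \<open>t j \<ge> 0\<close>, of "\<lambda>n. cmod (c n)" F] by simp
  qed
  also have "\<dots> = (\<Sum>j\<in>U. t j) * L2_set (\<lambda>n. cmod (c n)) F" by (simp add: sum_distrib_right)
  also have "\<dots> \<le> \<kappa> * L2_set (\<lambda>n. cmod (c n)) F"
    unfolding \<kappa>_def t_def using sum_coeff_le[OF U L] by (intro mult_right_mono) auto
  finally have "L2_norm ?D ?main \<le> \<kappa> * L2_set (\<lambda>n. cmod (c n)) F" .
  moreover have "L2_norm ?D (\<lambda>x. ?err x + ?main x) \<le> L2_norm ?D ?err + L2_norm ?D ?main"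
    by (intro L2_norm_triangle L2_on_sum err_L2 unimod inner_L2)
  ultimately show "L2_norm ?D (\<lambda>x. \<Sum>n\<in>F. c n * (expo (of_int n) x - expo (\<omega> n) x))
      \<le> \<kappa> * L2_set (\<lambda>n. cmod (c n)) F + e"
    unfolding eq using err by linarith
qed

lemma bounded_below_on_range: "bounded_below_on unit_interval (range \<omega>)"
  unfolding bounded_below_on_def
proof (intro exI[of _ "1 - \<kappa>"] conjI allI impI)
  let ?D = unit_interval
  fix F and c :: "real \<Rightarrow> complex" assume F: "finite F" "F \<subseteq> range \<omega>"
  from finite_subset_image[OF F] obtain G where G: "finite G" "F = \<omega> ` G" by auto
  have inj: "inj_on \<omega> G" using inj_omega by (rule inj_on_subset) simp
  let ?c = "\<lambda>n. c (\<omega> n)"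
  have eq: "trig_poly F c = (\<lambda>x. \<Sum>n\<in>G. ?c n * expo (\<omega> n) x)"
    by (simp add: trig_poly_def[abs_def] G(2) sum.reindex[OF inj])
  have set: "L2_set (\<lambda>\<nu>. cmod (c \<nu>)) F = L2_set (\<lambda>n. cmod (?c n)) G"
    by (simp add: L2_set_def G(2) sum.reindex[OF inj])
  let ?d = "\<lambda>x. \<Sum>n\<in>G. ?c n * (expo (of_int n) x - expo (\<omega> n) x)"
  have "(\<lambda>x. \<Sum>n\<in>G. ?c n * expo (of_int n) x) = (\<lambda>x. ?d x + trig_poly F c x)"
    by (simp add: eq right_diff_distrib sum_subtractf)
  moreover have "L2_norm ?D (\<lambda>x. ?d x + trig_poly F c x) \<le> L2_norm ?D ?d + L2_norm ?D (trig_poly F c)"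
    by (intro L2_norm_triangle L2_on_sum L2_on_cmult L2_on_diff expo_in_L2 trig_poly_in_L2) simp_all
  ultimately have "L2_set (\<lambda>n. cmod (?c n)) G \<le> L2_norm ?D ?d + L2_norm ?D (trig_poly F c)"
    using parseval_int[OF G(1), of ?c] by simp
  also have "L2_norm ?D ?d \<le> \<kappa> * L2_set (\<lambda>n. cmod (?c n)) G" by (rule perturbation_le[OF G(1)])
  finally show "(1 - \<kappa>) * L2_set (\<lambda>\<nu>. cmod (c \<nu>)) F \<le> L2_norm ?D (trig_poly F c)"
    unfolding set by (simp add: left_diff_distrib)
qed (use kappa in simp)

text \<open>
  Replacing the integer frequencies in a Fourier approximation of \<open>f\<close> by the perturbed ones leaves
  a remainder of norm at most \<open>\<kappa>\<close> times that of \<open>f\<close>.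
\<close>

lemma complete_on_range: "complete_on unit_interval (range \<omega>)"
proof -
  let ?D = unit_interval
  let ?P = "\<lambda>f r. \<exists>p\<in>trig_span (range \<omega>). L2_norm ?D (\<lambda>x. f x - p x) \<le> r"
  have D: "?D \<in> lmeasurable" by simp
  have approx: "?P f e" if f: "f \<in> L2_on ?D" and e: "e > 0" for f and e :: real
  proof (rule successive_approximation[where P = ?P and size = "L2_norm ?D", OF kappa _ _ _ f e])
    show "?P f (L2_norm ?D f)" for f by (intro bexI[of _ "\<lambda>_. 0"]) auto
    show "?P f r \<Longrightarrow> r \<le> s \<Longrightarrow> ?P f s" for f r s by (meson order_trans)
  next
    fix f and e :: real assume f: "f \<in> L2_on ?D" and e: "e > 0"
    obtain p where p: "p \<in> trig_span \<int>" "L2_norm ?D (\<lambda>x. f x - p x) < e / 2"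
      using complete_onE[OF fourier_complete f, of "e / 2"] e by auto
    obtain F c where F: "finite F" "F \<subseteq> \<int>" "p = trig_poly F c" using p(1) by (auto simp: trig_span_def)
    from finite_subset_image[OF F(1) F(2)[unfolded Ints_def]]
    obtain G :: "int set" where G: "finite G" "F = of_int ` G" by auto
    let ?c = "\<lambda>n::int. c (of_int n)"
    have inj: "inj_on real_of_int G" by (simp add: inj_on_def)
    have p_eq: "p = (\<lambda>x. \<Sum>n\<in>G. ?c n * expo (of_int n) x)"
      by (simp add: F(3) trig_poly_def[abs_def] G(2) sum.reindex[OF inj])
    let ?q = "\<lambda>x. \<Sum>n\<in>G. ?c n * expo (\<omega> n) x"
    have q: "?q \<in> trig_span (range \<omega>)"
      by (intro trig_span_sum trig_span_cmult expo_in_span) auto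
    have p_L2: "p \<in> L2_on ?D" and q_L2: "?q \<in> L2_on ?D"
      using trig_span_in_L2[OF D] p(1) q by blast+
    have "L2_norm ?D (\<lambda>x. p x - ?q x) \<le> \<kappa> * L2_norm ?D p"
      using perturbation_le[OF G(1), of ?c] parseval_int[OF G(1), of ?c]
      by (simp add: p_eq right_diff_distrib sum_subtractf)
    moreover have "L2_norm ?D p \<le> L2_norm ?D f + e / 2"
      using L2_norm_triangle_diff[OF f L2_on_diff[OF f p_L2]] p(2) by simp
    then have "\<kappa> * L2_norm ?D p \<le> \<kappa> * (L2_norm ?D f + e / 2)"
      using kappa(1) by (intro mult_left_mono)
    then have "\<kappa> * L2_norm ?D p \<le> \<kappa> * L2_norm ?D f + \<kappa> * (e / 2)"
      by (simp only: distrib_left)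
    moreover have "\<kappa> * (e / 2) \<le> 1 * (e / 2)" using kappa e by (intro mult_right_mono) auto
    ultimately have small: "L2_norm ?D (\<lambda>x. f x - ?q x) \<le> \<kappa> * L2_norm ?D f + e"
      using L2_norm_dist_triangle[OF f p_L2 q_L2] p(2) by linarith
    show "\<exists>h\<in>L2_on ?D. L2_norm ?D h \<le> \<kappa> * L2_norm ?D f + e \<and> (\<forall>r. ?P h r \<longrightarrow> ?P f (r + e))"
    proof (rule bexI[of _ "\<lambda>x. f x - ?q x"], intro conjI allI impI small)
      fix r assume "?P (\<lambda>x. f x - ?q x) r"
      then obtain g where g: "g \<in> trig_span (range \<omega>)" "L2_norm ?D (\<lambda>x. f x - ?q x - g x) \<le> r" by blast
      then have "L2_norm ?D (\<lambda>x. f x - (?q x + g x)) \<le> r + e" using e by (simp add: diff_diff_eq)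
      then show "?P f (r + e)" using trig_span_add[OF q g(1)] by (intro bexI[of _ "\<lambda>x. ?q x + g x"])
    qed (intro L2_on_diff f q_L2)
  qed
  show ?thesis
    unfolding complete_on_def
  proof (intro ballI allI impI)
    fix f and e :: real assume f: "f \<in> L2_on ?D" and e: "e > 0"
    obtain p where "p \<in> trig_span (range \<omega>)" "L2_norm ?D (\<lambda>x. f x - p x) \<le> e / 2"
      using approx[OF f, of "e / 2"] e by auto
    then show "\<exists>p\<in>trig_span (range \<omega>). L2_norm ?D (\<lambda>x. f x - p x) < e"
      using e by (intro bexI[of _ p]) auto
  qed
qed

end


lemma bounded_below_on_shift:
  assumes "bounded_below_on D \<Lambda>"
  shows "bounded_below_on D ((+) s ` \<Lambda>)"
proof -
  obtain A where A: "A > 0" "\<And>F c. finite F \<Longrightarrow> F \<subseteq> \<Lambda> \<Longrightarrow>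
      A * L2_set (\<lambda>\<nu>. cmod (c \<nu>)) F \<le> L2_norm D (trig_poly F c)"
    using assms by (auto simp: bounded_below_on_def)
  show ?thesis
    unfolding bounded_below_on_def
  proof (intro exI[of _ A] conjI allI impI A(1))
    fix F and c :: "real \<Rightarrow> complex" assume F: "finite F" "F \<subseteq> (+) s ` \<Lambda>"
    from finite_subset_image[OF F] obtain G where G: "G \<subseteq> \<Lambda>" "finite G" "F = (+) s ` G" by auto
    have inj: "inj_on ((+) s) G" by simp
    have "L2_norm D (trig_poly F c) = L2_norm D (trig_poly G (\<lambda>\<nu>. c (s + \<nu>)))"
    proof (rule L2_norm_cong)
      fix x
      have "trig_poly F c x = expo s x * trig_poly G (\<lambda>\<nu>. c (s + \<nu>)) x"
        by (simp add: trig_poly_def G(3) sum.reindex[OF inj] expo_add sum_distrib_left mult_ac)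
      then show "cmod (trig_poly F c x) = cmod (trig_poly G (\<lambda>\<nu>. c (s + \<nu>)) x)" by (simp add: norm_mult)
    qed
    moreover have "L2_set (\<lambda>\<nu>. cmod (c \<nu>)) F = L2_set (\<lambda>\<nu>. cmod (c (s + \<nu>))) G"
      by (simp add: L2_set_def G(3) sum.reindex[OF inj])
    ultimately show "A * L2_set (\<lambda>\<nu>. cmod (c \<nu>)) F \<le> L2_norm D (trig_poly F c)"
      using A(2)[OF G(2,1)] by simp
  qed
qed

text \<open>
  Translations of the frequencies by \<open>s\<close> and of the interval by \<open>u\<close> are harmless, and an interval
  of length \<open>l\<close> scales the frequencies by \<open>1 / l\<close>.
\<close>

theorem kadec_interval:
  fixes \<omega> :: "int \<Rightarrow> real"
  assumes l: "l > 0" and L: "0 \<le> L" "L < 1 / 4"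
    and close: "\<And>n. \<bar>\<omega> n - (of_int n + s)\<bar> \<le> L" and range: "(*) l ` \<Lambda> = range \<omega>"
  shows "bounded_below_on {u..u + l} \<Lambda>" and "complete_on {u..u + l} \<Lambda>"
proof -
  interpret kadec "\<lambda>n. \<omega> n - s" L
    by standard (use L close in \<open>auto simp: diff_diff_eq2 add.commute diff_diff_eq\<close>)
  have shift: "(*) l ` \<Lambda> = (+) s ` range (\<lambda>n. \<omega> n - s)"
    unfolding range by (simp add: image_image)
  have "bounded_below_on unit_interval ((*) l ` \<Lambda>)" "complete_on unit_interval ((*) l ` \<Lambda>)"
    unfolding shift
    by (rule bounded_below_on_shift[OF bounded_below_on_range])
       (rule complete_on_shift[OF _ complete_on_range], simp)
  then have "bounded_below_on ((\<lambda>x. (u + l / 2) + l * x) ` unit_interval) \<Lambda>"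
      "complete_on ((\<lambda>x. (u + l / 2) + l * x) ` unit_interval) \<Lambda>"
    using l by (auto intro!: bounded_below_on_affine complete_on_affine)
  moreover have "(\<lambda>x. (u + l / 2) + l * x) ` unit_interval = {u..u + l}"
    using l image_affinity_atLeastAtMost[of l "u + l / 2" "- (1 / 2)" "1 / 2"] by (simp add: add.commute)
  ultimately show "bounded_below_on {u..u + l} \<Lambda>" "complete_on {u..u + l} \<Lambda>" by simp_all
qed

section \<open>Changing the set\<close>

lemma complete_on_subset:
  assumes "D \<in> sets lebesgue" "E \<in> lmeasurable" "D \<subseteq> E" "complete_on E \<Lambda>"
  shows "complete_on D \<Lambda>"
  unfolding complete_on_def
proof (intro ballI allI impI)
  have E: "E \<in> sets lebesgue" using assms(2) by blast
  fix f and e :: real assume f: "f \<in> L2_on D" and e: "e > 0"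
  let ?f = "\<lambda>x. indicator D x *\<^sub>R f x"
  note ext = L2_on_zero_extension(1)[OF assms(1) E assms(3) f]
  obtain p where p: "p \<in> trig_span \<Lambda>" "L2_norm E (\<lambda>x. ?f x - p x) < e"
    using complete_onE[OF assms(4) ext e] .
  have "L2_norm D (\<lambda>x. f x - p x) = L2_norm D (\<lambda>x. ?f x - p x)" by (rule L2_norm_cong) simp
  also have "\<dots> \<le> L2_norm E (\<lambda>x. ?f x - p x)"
    by (intro L2_norm_mono assms E L2_on_diff ext trig_span_in_L2[OF assms(2) p(1)])
  finally show "\<exists>p\<in>trig_span \<Lambda>. L2_norm D (\<lambda>x. f x - p x) < e"
    using p by (intro bexI[of _ p]) auto
qed

lemma L2_norm_negligible:
  assumes "negligible N"
  shows "L2_norm N f = 0"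
proof -
  have "N \<in> null_sets lebesgue" using assms by (simp add: negligible_iff_null_sets)
  then have "AE x in lebesgue_on N. (cmod (f x))\<^sup>2 = 0"
    by (auto simp: AE_restrict_space_iff null_sets_def intro!: AE_I'[of N])
  then show ?thesis
    unfolding L2_norm_def by (simp add: integral_eq_zero_AE)
qed

lemma bounded_below_on_subset_negligible:
  assumes "D \<in> sets lebesgue" "E \<in> lmeasurable" "D \<subseteq> E" "negligible (E - D)" "bounded_below_on E \<Lambda>"
  shows "bounded_below_on D \<Lambda>"
proof -
  have E: "E \<in> sets lebesgue" using assms(2) by blast
  have "L2_norm E (trig_poly F c) = L2_norm D (trig_poly F c)" for F c
  proof -
    have "(L2_norm E (trig_poly F c))\<^sup>2 = (L2_norm D (trig_poly F c))\<^sup>2"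
      using L2_norm_squared_split[OF assms(1) E assms(3) trig_poly_in_L2[OF assms(2)], of F c]
        L2_norm_negligible[OF assms(4)] by simp
    then show ?thesis by simp
  qed
  then show ?thesis using assms(5) by (simp add: bounded_below_on_def)
qed

lemma L2_norm_squared_UN:
  assumes "finite I" "\<And>i. i \<in> I \<Longrightarrow> P i \<in> sets lebesgue" "disjoint_family_on P I"
    "\<And>i. i \<in> I \<Longrightarrow> f \<in> L2_on (P i)"
  shows "f \<in> L2_on (\<Union>i\<in>I. P i)" and "(L2_norm (\<Union>i\<in>I. P i) f)\<^sup>2 = (\<Sum>i\<in>I. (L2_norm (P i) f)\<^sup>2)"
proof -
  have "f \<in> L2_on (\<Union>i\<in>I. P i) \<and> (L2_norm (\<Union>i\<in>I. P i) f)\<^sup>2 = (\<Sum>i\<in>I. (L2_norm (P i) f)\<^sup>2)"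
    using assms
  proof (induction I)
    case empty
    have "f \<in> L2_on {}" by (intro L2_onI borel_measurable_if_D) auto
    then show ?case using L2_norm_negligible[OF negligible_empty, of f] by simp
  next
    case (insert i I)
    have disj: "P i \<inter> (\<Union>i\<in>I. P i) = {}" "disjoint_family_on P I"
      using insert.prems(2) insert.hyps(2) by (auto simp: disjoint_family_on_def)
    have meas: "(\<Union>i\<in>I. P i) \<in> sets lebesgue" using insert by (intro sets.finite_UN) auto
    have IH: "f \<in> L2_on (\<Union>i\<in>I. P i)" "(L2_norm (\<Union>i\<in>I. P i) f)\<^sup>2 = (\<Sum>i\<in>I. (L2_norm (P i) f)\<^sup>2)"
      using insert disj(2) by auto
    show ?case
      using L2_norm_squared_Un[OF _ meas disj(1) _ IH(1)] insert IH by simp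
  qed
  then show "f \<in> L2_on (\<Union>i\<in>I. P i)" "(L2_norm (\<Union>i\<in>I. P i) f)\<^sup>2 = (\<Sum>i\<in>I. (L2_norm (P i) f)\<^sup>2)"
    by blast+
qed

text \<open>
  If a set is cut into finitely many pieces that are translated by amounts which are periods of all
  exponentials in question, nothing changes.
\<close>

locale rearrangement =
  fixes m :: nat and P :: "nat \<Rightarrow> real set" and b :: "nat \<Rightarrow> real" and \<Lambda> :: "real set"
  assumes meas: "\<And>j. j < m \<Longrightarrow> P j \<in> sets lebesgue"
    and disj: "disjoint_family_on P {..<m}" and disj': "disjoint_family_on (\<lambda>j. (+) (b j) ` P j) {..<m}"
    and period: "\<And>j \<nu>. j < m \<Longrightarrow> \<nu> \<in> \<Lambda> \<Longrightarrow> \<nu> * b j \<in> \<int>"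
begin

abbreviation "U \<equiv> \<Union>j<m. P j"
abbreviation "V \<equiv> \<Union>j<m. (+) (b j) ` P j"

lemma meas': "j < m \<Longrightarrow> (+) (b j) ` P j \<in> sets lebesgue"
  using affine_image_sets_lebesgue[OF meas, of j 1 "b j"] by simp

lemma L2_norm_rearranged:
  assumes g: "g \<in> L2_on V" and eq: "\<And>j x. j < m \<Longrightarrow> x \<in> P j \<Longrightarrow> g (b j + x) = h x"
  shows "h \<in> L2_on U" and "L2_norm U h = L2_norm V g"
proof -
  have V: "V \<in> sets lebesgue" using meas' by (intro sets.finite_UN) auto
  have g_j: "g \<in> L2_on ((+) (b j) ` P j)" if "j < m" for j
    by (rule L2_on_subset[OF meas'[OF that] V _ g]) (use that in auto)
  have h_j: "h \<in> L2_on (P j)" and norm_j: "L2_norm (P j) h = L2_norm ((+) (b j) ` P j) g" if j: "j < m" for j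
  proof -
    have "(\<lambda>x. g (b j + x)) \<in> L2_on (P j)" "L2_norm ((+) (b j) ` P j) g = L2_norm (P j) (\<lambda>x. g (b j + x))"
      using L2_on_affine[OF meas[OF j], of 1 g "b j"] L2_norm_affine[OF meas[OF j], of 1 "b j" g] g_j[OF j]
      by simp_all
    moreover have "(\<lambda>x. g (b j + x)) \<in> L2_on (P j) \<longleftrightarrow> h \<in> L2_on (P j)"
      by (intro L2_on_cong eq j)
    moreover have "L2_norm (P j) (\<lambda>x. g (b j + x)) = L2_norm (P j) h"
      by (intro L2_norm_cong arg_cong[of _ _ cmod] eq j)
    ultimately show "h \<in> L2_on (P j)" "L2_norm (P j) h = L2_norm ((+) (b j) ` P j) g" by simp_all
  qed
  note U_sum = L2_norm_squared_UN[OF finite_lessThan meas disj, simplified, OF h_j]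
  note V_sum = L2_norm_squared_UN[OF finite_lessThan meas' disj', simplified, OF g_j]
  show "h \<in> L2_on U" using U_sum(1) by blast
  have "(L2_norm U h)\<^sup>2 = (L2_norm V g)\<^sup>2"
    using U_sum(2) V_sum(2) norm_j by simp
  then show "L2_norm U h = L2_norm V g" by simp
qed

lemma trig_span_periodic: "p \<in> trig_span \<Lambda> \<Longrightarrow> j < m \<Longrightarrow> p (b j + x) = p x"
proof -
  assume p: "p \<in> trig_span \<Lambda>" and j: "j < m"
  obtain F c where F: "F \<subseteq> \<Lambda>" "p = trig_poly F c" using p by (auto simp: trig_span_def)
  have "expo \<nu> (b j + x) = expo \<nu> x" if "\<nu> \<in> F" for \<nu>
    using period[OF j, of \<nu>] F(1) that expo_eq_1_iff[of \<nu> "b j"] by (auto simp: expo_add_point)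
  then show ?thesis unfolding F(2) trig_poly_def by (intro sum.cong) auto
qed

lemma bounded_below_on_rearranged:
  assumes "V \<in> lmeasurable" "bounded_below_on U \<Lambda>"
  shows "bounded_below_on V \<Lambda>"
proof -
  have "L2_norm U (trig_poly F c) = L2_norm V (trig_poly F c)" if "finite F" "F \<subseteq> \<Lambda>" for F c
    using trig_span_periodic[OF trig_poly_in_span[OF that]] assms(1)
    by (intro L2_norm_rearranged(2) trig_poly_in_L2) auto
  then show ?thesis using assms(2) by (auto simp: bounded_below_on_def)
qed

lemma complete_on_rearranged:
  assumes V: "V \<in> lmeasurable" and comp: "complete_on U \<Lambda>"
  shows "complete_on V \<Lambda>"
  unfolding complete_on_def
proof (intro ballI allI impI)
  fix f and e :: real assume f: "f \<in> L2_on V" and e: "e > 0"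
  define h where "h x = (\<Sum>j<m. indicator (P j) x *\<^sub>R f (b j + x))" for x
  have h: "f (b j + x) = h x" if "j < m" "x \<in> P j" for j x
  proof -
    have "indicator (P i) x *\<^sub>R f (b i + x) = (if i = j then f (b j + x) else 0)" if "i < m" for i
      using disj that \<open>j < m\<close> \<open>x \<in> P j\<close> by (auto simp: disjoint_family_on_def indicator_def)
    then have "h x = (\<Sum>i<m. if i = j then f (b j + x) else 0)"
      unfolding h_def by (intro sum.cong) auto
    then show ?thesis using that(1) by simp
  qed
  obtain p where p: "p \<in> trig_span \<Lambda>" "L2_norm U (\<lambda>x. h x - p x) < e"
    using complete_onE[OF comp L2_norm_rearranged(1)[OF f h] e] by blast
  have "L2_norm U (\<lambda>x. h x - p x) = L2_norm V (\<lambda>x. f x - p x)"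
    using h trig_span_periodic[OF p(1)] f trig_span_in_L2[OF V p(1)]
    by (intro L2_norm_rearranged(2) L2_on_diff) auto
  then show "\<exists>p\<in>trig_span \<Lambda>. L2_norm V (\<lambda>x. f x - p x) < e"
    using p by (intro bexI[of _ p]) auto
qed

end

section \<open>Rounded multiples\<close>

text \<open>
  The frequencies are the fractions \<open>r / \<beta>\<close> where \<open>r\<close> is a multiple \<open>\<beta> n\<close> rounded half up.
\<close>

lemma rounded_multiple_iff:
  assumes "\<beta> > 0"
  shows "of_int n + delta_star \<beta> n = of_int r / \<beta> \<longleftrightarrow>
    - 1 / 2 < of_int r - \<beta> * of_int n \<and> of_int r - \<beta> * of_int n \<le> 1 / 2"
proof -
  let ?t = "\<beta> * of_int n"
  have "of_int n + delta_star \<beta> n = of_int (if frac ?t \<ge> 1 / 2 then \<lfloor>?t\<rfloor> + 1 else \<lfloor>?t\<rfloor>) / \<beta>"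
    by (simp add: delta_star_def)
  then have "of_int n + delta_star \<beta> n = of_int r / \<beta> \<longleftrightarrow>
      (if frac ?t \<ge> 1 / 2 then \<lfloor>?t\<rfloor> + 1 else \<lfloor>?t\<rfloor>) = r"
    using assms by (simp only: divide_cancel_right of_int_eq_iff) auto
  also have "\<dots> \<longleftrightarrow> - 1 / 2 < of_int r - ?t \<and> of_int r - ?t \<le> 1 / 2"
    unfolding frac_def by (cases "?t - of_int \<lfloor>?t\<rfloor> \<ge> 1 / 2") (simp_all, linarith+)
  finally show ?thesis .
qed

lemma rounded_multiple_ex:
  assumes "\<beta> > 0"
  obtains r where "of_int n + delta_star \<beta> n = of_int r / \<beta>"
    "- 1 / 2 < of_int r - \<beta> * of_int n" "of_int r - \<beta> * of_int n \<le> 1 / 2"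
proof -
  have "of_int n + delta_star \<beta> n =
      of_int (if frac (\<beta> * of_int n) \<ge> 1 / 2 then \<lfloor>\<beta> * of_int n\<rfloor> + 1 else \<lfloor>\<beta> * of_int n\<rfloor>) / \<beta>"
    by (simp add: delta_star_def)
  then show thesis using that rounded_multiple_iff[OF assms] by blast
qed

definition rounded_multiples :: "real \<Rightarrow> real set" where
  "rounded_multiples \<beta> = {of_int n + delta_star \<beta> n | n :: int. True}"

lemma rounded_multiples_subset: "\<beta> > 0 \<Longrightarrow> rounded_multiples \<beta> \<subseteq> {of_int k / \<beta> | k :: int. True}"
  unfolding rounded_multiples_def using rounded_multiple_ex by blast

lemma abs_delta_star_le:
  assumes "\<beta> > 0"
  shows "\<bar>delta_star \<beta> n\<bar> \<le> 1 / (2 * \<beta>)"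
proof -
  obtain r where r: "of_int n + delta_star \<beta> n = of_int r / \<beta>"
      "- 1 / 2 < of_int r - \<beta> * of_int n" "of_int r - \<beta> * of_int n \<le> 1 / 2"
    using rounded_multiple_ex[OF assms] by blast
  have "\<beta> * delta_star \<beta> n = of_int r - \<beta> * of_int n"
    using r(1) assms by (simp add: field_simps)
  then have "\<bar>\<beta> * delta_star \<beta> n\<bar> \<le> 1 / 2" using r(2,3) by linarith
  then show ?thesis using assms by (simp add: abs_mult field_simps)
qed

text \<open>
  An integer \<open>r\<close> is a rounded multiple of \<open>\<beta>\<close> iff it is in one of the windows
  \<open>(\<beta> n - 1/2, \<beta> n + 1/2]\<close>. It is in the gap \<open>(\<beta> n + 1/2, \<beta> (n + 1) - 1/2]\<close> between two of them iff
  it is in the window \<open>[\<gamma> (p + 1/2) - 1/2, \<gamma> (p + 1/2) + 1/2)\<close> where \<open>p = r - n - 1\<close> and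
  \<open>1 / \<beta> + 1 / \<gamma> = 1\<close>. So the integers left over are rounded odd multiples of \<open>\<gamma> / 2\<close>, a
  variant of Beatty's theorem.
\<close>

lemma rounded_multiples_window:
  assumes "\<beta> > 0"
  shows "of_int r / \<beta> \<in> rounded_multiples \<beta> \<longleftrightarrow>
    (\<exists>n::int. \<beta> * of_int n - 1 / 2 < of_int r \<and> of_int r \<le> \<beta> * of_int n + 1 / 2)"
proof -
  have "of_int r / \<beta> \<in> rounded_multiples \<beta> \<longleftrightarrow> (\<exists>n. of_int n + delta_star \<beta> n = of_int r / \<beta>)"
    unfolding rounded_multiples_def by (auto simp: eq_commute)
  moreover have "- 1 / 2 < x - y \<and> x - y \<le> 1 / 2 \<longleftrightarrow> y - 1 / 2 < x \<and> x \<le> y + 1 / 2" for x y :: real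
    by linarith
  ultimately show ?thesis unfolding rounded_multiple_iff[OF assms] by (simp only:)
qed

text \<open>Odd multiples of \<open>\<gamma> / 2 = \<beta> / (2 (\<beta> - 1))\<close>, rounded half down.\<close>

definition dual_multiple :: "real \<Rightarrow> int \<Rightarrow> int" where
  "dual_multiple \<beta> p = \<lceil>\<beta> / (\<beta> - 1) * (of_int p + 1 / 2) - 1 / 2\<rceil>"

lemma dual_multiple_iff:
  assumes "\<beta> > 1"
  shows "dual_multiple \<beta> p = r \<longleftrightarrow>
    (\<beta> - 1) * (of_int r - 1 / 2) < \<beta> * (of_int p + 1 / 2) \<and>
    \<beta> * (of_int p + 1 / 2) \<le> (\<beta> - 1) * (of_int r + 1 / 2)"
proof -
  let ?x = "\<beta> / (\<beta> - 1) * (of_int p + 1 / 2)"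
  have x: "(\<beta> - 1) * ?x = \<beta> * (of_int p + 1 / 2)" using assms by simp
  have "dual_multiple \<beta> p = r \<longleftrightarrow> of_int r - 1 / 2 < ?x \<and> ?x \<le> of_int r + 1 / 2"
    unfolding dual_multiple_def ceiling_eq_iff by linarith
  also have "\<dots> \<longleftrightarrow> (\<beta> - 1) * (of_int r - 1 / 2) < (\<beta> - 1) * ?x \<and>
      (\<beta> - 1) * ?x \<le> (\<beta> - 1) * (of_int r + 1 / 2)"
    using assms by (simp only: mult_less_cancel_left_pos mult_le_cancel_left_pos diff_gt_0_iff_gt)
  finally show ?thesis unfolding x .
qed

lemma complement_rounded_multiples:
  assumes \<beta>: "\<beta> > 1"
  shows "{of_int k / \<beta> | k :: int. True} - rounded_multiples \<beta> = range (\<lambda>p. of_int (dual_multiple \<beta> p) / \<beta>)"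
proof -
  have dual: "(\<exists>p. dual_multiple \<beta> p = r) \<longleftrightarrow>
      (\<exists>n::int. \<beta> * of_int n + 1 / 2 < of_int r \<and> of_int r \<le> \<beta> * of_int n + \<beta> - 1 / 2)" for r
  proof -
    have "dual_multiple \<beta> (r - n - 1) = r \<longleftrightarrow>
        \<beta> * of_int n + 1 / 2 < of_int r \<and> of_int r \<le> \<beta> * of_int n + \<beta> - 1 / 2" for n
    proof -
      have "\<beta> * (of_int (r - n - 1) + 1 / 2) - (\<beta> - 1) * (of_int r - 1 / 2) = of_int r - (\<beta> * of_int n + 1 / 2)"
          "(\<beta> - 1) * (of_int r + 1 / 2) - \<beta> * (of_int (r - n - 1) + 1 / 2) = \<beta> * of_int n + \<beta> - 1 / 2 - of_int r"
        by (simp_all add: field_simps)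
      then show ?thesis unfolding dual_multiple_iff[OF \<beta>] by linarith
    qed
    moreover have "(\<exists>p. dual_multiple \<beta> p = r) \<longleftrightarrow> (\<exists>n. dual_multiple \<beta> (r - n - 1) = r)"
      by (metis diff_add_cancel diff_diff_eq2 add_diff_cancel_left')
    ultimately show ?thesis by simp
  qed
  have "of_int r / \<beta> \<notin> rounded_multiples \<beta> \<longleftrightarrow> (\<exists>p. dual_multiple \<beta> p = r)" for r
  proof
    assume *: "of_int r / \<beta> \<notin> rounded_multiples \<beta>"
    define n where "n = \<lceil>(of_int r + 1 / 2) / \<beta>\<rceil> - 1"
    have "of_int n < (of_int r + 1 / 2) / \<beta>" "(of_int r + 1 / 2) / \<beta> \<le> of_int n + 1"
      unfolding n_def by linarith+
    then have n: "\<beta> * of_int n < of_int r + 1 / 2" "of_int r + 1 / 2 \<le> \<beta> * of_int n + \<beta>"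
      using \<beta> by (simp_all add: field_simps)
    moreover have "\<beta> * of_int n + 1 / 2 < of_int r"
    proof (rule ccontr)
      assume "\<not> \<beta> * of_int n + 1 / 2 < of_int r"
      then have "of_int r / \<beta> \<in> rounded_multiples \<beta>"
        using n(1) \<beta> by (subst rounded_multiples_window) (auto intro!: exI[of _ n])
      with * show False by simp
    qed
    ultimately show "\<exists>p. dual_multiple \<beta> p = r"
      unfolding dual by (intro exI[of _ n]) auto
  next
    assume "\<exists>p. dual_multiple \<beta> p = r"
    then obtain n' :: int where n': "\<beta> * of_int n' + 1 / 2 < of_int r" "of_int r \<le> \<beta> * of_int n' + \<beta> - 1 / 2"
      unfolding dual by blast
    show "of_int r / \<beta> \<notin> rounded_multiples \<beta>"
    proof
      assume "of_int r / \<beta> \<in> rounded_multiples \<beta>"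
      then obtain n :: int where n: "\<beta> * of_int n - 1 / 2 < of_int r" "of_int r \<le> \<beta> * of_int n + 1 / 2"
        using rounded_multiples_window[of \<beta> r] \<beta> by auto
      have "\<beta> * of_int n' < \<beta> * of_int n" using n n' by linarith
      then have "n' < n" using \<beta> by simp
      moreover have "\<beta> * of_int n < \<beta> * (of_int n' + 1)" using n n' by (simp add: distrib_left)
      then have "of_int n < of_int n' + (1::real)" using \<beta> by simp
      ultimately show False by linarith
    qed
  qed
  then show ?thesis by (auto simp: image_iff)
qed

lemma dual_multiple_close:
  assumes "\<beta> > 1"
  shows "\<bar>(\<beta> - 1) * (of_int (dual_multiple \<beta> p) / \<beta>) - (of_int p + 1 / 2)\<bar> \<le> (\<beta> - 1) / (2 * \<beta>)"
proof -
  let ?r = "of_int (dual_multiple \<beta> p) :: real"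
  have eq: "(\<beta> - 1) * (?r - 1 / 2) = (\<beta> - 1) * ?r - (\<beta> - 1) / 2" "(\<beta> - 1) * (?r + 1 / 2) = (\<beta> - 1) * ?r + (\<beta> - 1) / 2"
    by (simp_all add: right_diff_distrib distrib_left)
  have "(\<beta> - 1) * (?r - 1 / 2) < \<beta> * (of_int p + 1 / 2)" "\<beta> * (of_int p + 1 / 2) \<le> (\<beta> - 1) * (?r + 1 / 2)"
    using dual_multiple_iff[OF assms, of p "dual_multiple \<beta> p"] by blast+
  moreover have "x - h < y \<Longrightarrow> y \<le> x + h \<Longrightarrow> \<bar>x - y\<bar> \<le> h" for x y h :: real by linarith
  ultimately have "\<bar>(\<beta> - 1) * ?r - \<beta> * (of_int p + 1 / 2)\<bar> \<le> (\<beta> - 1) / 2"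
    unfolding eq by blast
  also have "(\<beta> - 1) * ?r - \<beta> * (of_int p + 1 / 2) = \<beta> * ((\<beta> - 1) * (?r / \<beta>) - (of_int p + 1 / 2))"
    using assms by (simp add: field_simps)
  finally have "\<bar>\<beta> * ((\<beta> - 1) * (?r / \<beta>) - (of_int p + 1 / 2))\<bar> \<le> (\<beta> - 1) / 2" .
  moreover have "\<bar>\<beta> * x\<bar> \<le> h / 2 \<Longrightarrow> \<bar>x\<bar> \<le> h / (2 * \<beta>)" for x h
    using assms by (simp add: abs_mult field_simps)
  ultimately show ?thesis by blast
qed

text \<open>
  For \<open>\<beta> > 2\<close> the rounding errors are admissible in Kadec's theorem. For \<open>1 < \<beta> < 2\<close> they are too
  large, but then those of the complementary frequencies, which belong to the interval \<open>[1, \<beta>]\<close> of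
  length \<open>\<beta> - 1\<close>, are admissible. In the remaining cases \<open>\<beta> = 1, 2\<close> nothing is rounded at all.
\<close>

lemma rounded_multiples_riesz:
  assumes "\<beta> \<ge> 1"
  shows "bounded_below_on {0..<1} (rounded_multiples \<beta>)" and "complete_on {0..<1} (rounded_multiples \<beta>)"
proof -
  have direct: "bounded_below_on {0..<1} (rounded_multiples \<beta>) \<and> complete_on {0..<1} (rounded_multiples \<beta>)"
    if L: "0 \<le> L" "L < 1 / 4" and le: "\<And>n. \<bar>delta_star \<beta> n\<bar> \<le> L" for L
  proof -
    have close: "\<bar>(of_int n + delta_star \<beta> n) - (of_int n + 0)\<bar> \<le> L" for n using le by simp
    have range: "(*) 1 ` rounded_multiples \<beta> = range (\<lambda>n. of_int n + delta_star \<beta> n)"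
      by (auto simp: rounded_multiples_def)
    have "negligible ({0..0 + 1} - {0..<1::real})"
      by (rule negligible_subset[of "{1}"]) auto
    moreover have "{0..<1} \<subseteq> {0..0 + 1::real}" by auto
    ultimately show ?thesis
      using bounded_below_on_subset_negligible[OF _ _ _ _ kadec_interval(1)[OF zero_less_one L close range, of 0], of "{0..<1}"]
        complete_on_subset[OF _ _ _ kadec_interval(2)[OF zero_less_one L close range, of 0], of "{0..<1}"]
      by auto
  qed
  consider "\<beta> = 1 \<or> \<beta> = 2" | "\<beta> > 2" | "1 < \<beta>" "\<beta> < 2" using assms by linarith
  then have "bounded_below_on {0..<1} (rounded_multiples \<beta>) \<and> complete_on {0..<1} (rounded_multiples \<beta>)"
  proof cases
    case 1
    then have "delta_star \<beta> n = 0" for n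
    proof
      assume "\<beta> = 2"
      moreover have "(2::real) * of_int n = of_int (2 * n)" by simp
      then have "\<lfloor>2 * real_of_int n\<rfloor> = 2 * n" by (metis floor_of_int)
      ultimately show ?thesis by (simp add: delta_star_def frac_def)
    qed (simp add: delta_star_def frac_def)
    then show ?thesis using direct[of 0] by simp
  next
    case 2
    then have "1 / (2 * \<beta>) < 1 / 4" by (simp add: field_simps)
    with 2 show ?thesis using direct[of "1 / (2 * \<beta>)"] abs_delta_star_le[of \<beta>] by simp
  next
    case 3
    let ?M = "{of_int k / \<beta> | k :: int. True}"
    let ?\<Gamma> = "?M - rounded_multiples \<beta>"
    have L: "0 \<le> (\<beta> - 1) / (2 * \<beta>)" "(\<beta> - 1) / (2 * \<beta>) < 1 / 4" "\<beta> - 1 > 0"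
      using 3 by (simp_all add: field_simps)
    have range: "(*) (\<beta> - 1) ` ?\<Gamma> = range (\<lambda>p. (\<beta> - 1) * (of_int (dual_multiple \<beta> p) / \<beta>))"
      unfolding complement_rounded_multiples[OF 3(1)] by (simp only: image_image)
    have upper: "bounded_below_on {1..\<beta>} ?\<Gamma>" "complete_on {1..\<beta>} ?\<Gamma>"
      using kadec_interval[OF L(3,1,2) dual_multiple_close[OF 3(1)] range, of 1] by simp_all
    interpret complementary_frequencies \<beta> ?M ?\<Gamma> "{1..\<beta>}"
      by standard (use 3 in auto)
    have "?M - ?\<Gamma> = rounded_multiples \<beta>" using rounded_multiples_subset[of \<beta>] 3 by auto
    moreover have "{0..\<beta>} - {1..\<beta>} = {0..<1}" using 3 by auto
    ultimately show ?thesis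
      using bounded_below_on_complement[OF upper] complete_on_complement[OF upper(1)] by simp
  qed
  then show "bounded_below_on {0..<1} (rounded_multiples \<beta>)" "complete_on {0..<1} (rounded_multiples \<beta>)"
    by blast+
qed


section \<open>From Riesz bounds to an unconditional basis\<close>

locale riesz_basis =
  fixes D :: "real set" and I :: "nat set" and e :: "nat \<Rightarrow> real \<Rightarrow> complex" and A B :: real
  assumes e_L2: "\<And>n. n \<in> I \<Longrightarrow> e n \<in> L2_on D" and A: "A > 0" and B: "B \<ge> 0"
    and lower: "\<And>F c. finite F \<Longrightarrow> F \<subseteq> I \<Longrightarrow>
      A * L2_set (\<lambda>n. cmod (c n)) F \<le> L2_norm D (\<lambda>x. \<Sum>n\<in>F. c n * e n x)"
    and upper: "\<And>F c. finite F \<Longrightarrow> F \<subseteq> I \<Longrightarrow>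
      L2_norm D (\<lambda>x. \<Sum>n\<in>F. c n * e n x) \<le> B * L2_set (\<lambda>n. cmod (c n)) F"
    and dense: "\<And>f \<epsilon>. f \<in> L2_on D \<Longrightarrow> \<epsilon> > 0 \<Longrightarrow>
      \<exists>F c. finite F \<and> F \<subseteq> I \<and> L2_norm D (\<lambda>x. f x - (\<Sum>n\<in>F. c n * e n x)) < \<epsilon>"
begin

abbreviation "partial c F \<equiv> \<lambda>x. \<Sum>n\<in>F. c n * e n x"

lemma partial_L2: "F \<subseteq> I \<Longrightarrow> partial c F \<in> L2_on D"
  by (intro L2_on_sum L2_on_cmult e_L2) auto

lemma partial_diff: "(\<lambda>x. partial c F x - partial d F x) = partial (\<lambda>n. c n - d n) F"
  by (simp add: sum_subtractf left_diff_distrib)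

text \<open>
  The coefficients of finite approximants form a Cauchy sequence in \<open>\<ell>\<^sup>2\<close> by the lower bound; their
  limit is the coefficient sequence, and the upper bound controls the error of its partial sums.
\<close>

lemma ex_unconditional_expansion:
  assumes f: "f \<in> L2_on D"
  shows "\<exists>c. series_converges_unconditionally D I e c f"
proof -
  define \<epsilon> where "\<epsilon> k = 1 / real (Suc k)" for k
  have \<epsilon>: "\<epsilon> k > 0" for k by (simp add: \<epsilon>_def)
  have \<epsilon>_lim: "\<epsilon> \<longlonglongrightarrow> 0" unfolding \<epsilon>_def by (rule lim_1_over_n[THEN LIMSEQ_Suc])
  have "\<exists>F c. finite F \<and> F \<subseteq> I \<and> (\<forall>n. n \<notin> F \<longrightarrow> c n = 0) \<and> L2_norm D (\<lambda>x. f x - partial c F x) < \<epsilon> k" for k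
  proof -
    obtain F c where F: "finite F" "F \<subseteq> I" "L2_norm D (\<lambda>x. f x - partial c F x) < \<epsilon> k"
      using dense[OF f \<epsilon>] by blast
    have "partial (\<lambda>n. if n \<in> F then c n else 0) F = partial c F" by (intro ext sum.cong) auto
    with F show ?thesis
      by (intro exI[of _ F] exI[of _ "\<lambda>n. if n \<in> F then c n else 0"]) simp
  qed
  then obtain F c where F: "\<And>k. finite (F k)" "\<And>k. F k \<subseteq> I"
      and c: "\<And>k n. n \<notin> F k \<Longrightarrow> c k n = 0" "\<And>k. L2_norm D (\<lambda>x. f x - partial (c k) (F k) x) < \<epsilon> k"
    by metis
  have ext: "partial (c k) G x = partial (c k) (F k) x" if "finite G" "F k \<subseteq> G" for k G x
    by (intro sum.mono_neutral_right) (use that c(1) in auto)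
  have cauchy: "L2_set (\<lambda>n. cmod (c k n - c l n)) G \<le> (\<epsilon> k + \<epsilon> l) / A" if G: "finite G" "G \<subseteq> I" for k l G
  proof -
    let ?G = "G \<union> F k \<union> F l"
    have G': "finite ?G" "?G \<subseteq> I" using G F by auto
    have "L2_set (\<lambda>n. cmod (c k n - c l n)) G \<le> L2_set (\<lambda>n. cmod (c k n - c l n)) ?G"
      unfolding L2_set_def using G'(1) by (intro real_sqrt_le_mono sum_mono2) auto
    also have "A * \<dots> \<le> L2_norm D (\<lambda>x. partial (c k) ?G x - partial (c l) ?G x)"
      unfolding partial_diff by (rule lower[OF G'])
    also have "\<dots> \<le> L2_norm D (\<lambda>x. partial (c k) ?G x - f x) + L2_norm D (\<lambda>x. f x - partial (c l) ?G x)"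
      by (intro L2_norm_dist_triangle partial_L2 f G')
    also have "\<dots> = L2_norm D (\<lambda>x. f x - partial (c k) (F k) x) + L2_norm D (\<lambda>x. f x - partial (c l) (F l) x)"
    proof -
      have "partial (c k) ?G x = partial (c k) (F k) x" "partial (c l) ?G x = partial (c l) (F l) x" for x
        by (rule ext[OF G'(1)], blast)+
      then show ?thesis
        using L2_norm_minus_commute[of D "partial (c k) ?G" f] by (simp only:)
    qed
    also have "\<dots> \<le> \<epsilon> k + \<epsilon> l"
      using c(2)[of k] c(2)[of l] by simp
    finally show ?thesis using A by (simp add: field_simps)
  qed
  have "Cauchy (\<lambda>k. c k n)" if n: "n \<in> I" for n
  proof (rule metric_CauchyI)
    fix r :: real assume "r > 0"
    then have "\<forall>\<^sub>F k in sequentially. \<epsilon> k < r * A / 2" using A by (intro order_tendstoD[OF \<epsilon>_lim]) auto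
    then obtain N where N: "\<And>k. k \<ge> N \<Longrightarrow> \<epsilon> k < r * A / 2" by (auto simp: eventually_sequentially)
    have "dist (c k n) (c l n) < r" if "k \<ge> N" "l \<ge> N" for k l
    proof -
      have "dist (c k n) (c l n) \<le> (\<epsilon> k + \<epsilon> l) / A"
        using cauchy[of "{n}" k l] n by (simp add: dist_norm)
      also have "\<dots> < r" using N[OF that(1)] N[OF that(2)] A by (simp add: field_simps)
      finally show ?thesis .
    qed
    then show "\<exists>M. \<forall>k\<ge>M. \<forall>l\<ge>M. dist (c k n) (c l n) < r" by blast
  qed
  then have "\<forall>n\<in>I. \<exists>d. (\<lambda>k. c k n) \<longlonglongrightarrow> d" by (auto simp: Cauchy_convergent_iff convergent_def)
  then obtain d where d: "\<And>n. n \<in> I \<Longrightarrow> (\<lambda>k. c k n) \<longlonglongrightarrow> d n" by metis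
  have close: "L2_set (\<lambda>n. cmod (c k n - d n)) G \<le> \<epsilon> k / A" if G: "finite G" "G \<subseteq> I" for k G
  proof (rule LIMSEQ_le)
    show "(\<lambda>l. L2_set (\<lambda>n. cmod (c k n - c l n)) G) \<longlonglongrightarrow> L2_set (\<lambda>n. cmod (c k n - d n)) G"
      unfolding L2_set_def using G by (intro tendsto_intros d) auto
    have "(\<lambda>l. (\<epsilon> k + \<epsilon> l) / A) \<longlonglongrightarrow> (\<epsilon> k + 0) / A" using A by (intro tendsto_intros \<epsilon>_lim) auto
    then show "(\<lambda>l. (\<epsilon> k + \<epsilon> l) / A) \<longlonglongrightarrow> \<epsilon> k / A" by simp
  qed (use cauchy[OF G] in blast)
  have error: "L2_norm D (\<lambda>x. f x - partial d G x) \<le> \<epsilon> k * (1 + B / A)" if G: "finite G" "G \<subseteq> I" "F k \<subseteq> G" for k G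
  proof -
    have "L2_norm D (\<lambda>x. f x - partial d G x) \<le>
        L2_norm D (\<lambda>x. f x - partial (c k) G x) + L2_norm D (\<lambda>x. partial (c k) G x - partial d G x)"
      by (intro L2_norm_dist_triangle partial_L2 f G)
    also have "L2_norm D (\<lambda>x. f x - partial (c k) G x) \<le> \<epsilon> k"
      using c(2)[of k] by (simp only: ext[OF G(1,3)] less_imp_le)
    also have "L2_norm D (\<lambda>x. partial (c k) G x - partial d G x) \<le> B * L2_set (\<lambda>n. cmod (c k n - d n)) G"
      unfolding partial_diff by (rule upper[OF G(1,2)])
    also have "\<dots> \<le> B * (\<epsilon> k / A)" using B close[OF G(1,2)] by (rule mult_left_mono[rotated])
    finally show ?thesis by (simp add: distrib_left mult.commute)
  qed
  have "((\<lambda>G. L2_norm D (\<lambda>x. f x - partial d G x)) \<longlongrightarrow> 0) (finite_subsets_at_top I)"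
  proof (rule tendstoI)
    fix r :: real assume r: "r > 0"
    have "(\<lambda>k. \<epsilon> k * (1 + B / A)) \<longlonglongrightarrow> 0 * (1 + B / A)" by (intro tendsto_intros \<epsilon>_lim)
    then have "\<forall>\<^sub>F k in sequentially. \<epsilon> k * (1 + B / A) < r" using r by (intro order_tendstoD) auto
    then obtain k where k: "\<epsilon> k * (1 + B / A) < r" by (auto simp: eventually_sequentially)
    have "dist (L2_norm D (\<lambda>x. f x - partial d G x)) 0 < r" if "finite G" "F k \<subseteq> G" "G \<subseteq> I" for G
      using error[OF that(1,3,2)] k by simp
    then show "\<forall>\<^sub>F G in finite_subsets_at_top I. dist (L2_norm D (\<lambda>x. f x - partial d G x)) 0 < r"
      unfolding eventually_finite_subsets_at_top using F by (intro exI[of _ "F k"]) blast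
  qed
  then show ?thesis by (auto simp: series_converges_unconditionally_def)
qed

lemma unconditional_imp_converges:
  assumes "series_converges_unconditionally D I e c f"
  shows "series_converges D I e c f"
proof -
  have "filterlim (\<lambda>N. I \<inter> {..<N}) (finite_subsets_at_top I) sequentially"
    unfolding filterlim_finite_subsets_at_top
  proof (intro allI impI)
    fix X :: "nat set" assume X: "finite X \<and> X \<subseteq> I"
    then have "\<exists>N. \<forall>n\<in>X. n < N" by (simp flip: finite_nat_set_iff_bounded)
    then obtain N where N: "\<And>n. n \<in> X \<Longrightarrow> n < N" by auto
    show "\<forall>\<^sub>F N in sequentially. finite (I \<inter> {..<N}) \<and> X \<subseteq> I \<inter> {..<N} \<and> I \<inter> {..<N} \<subseteq> I"
      using X by (intro eventually_sequentiallyI[of N]) (auto dest: N)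
  qed
  then show ?thesis
    using assms unfolding series_converges_def series_converges_unconditionally_def
    by (rule filterlim_compose[rotated])
qed

lemma converges_cong: "(\<And>n. n \<in> I \<Longrightarrow> c n = d n) \<Longrightarrow> series_converges D I e c f = series_converges D I e d f"
proof -
  assume "\<And>n. n \<in> I \<Longrightarrow> c n = d n"
  then have "partial c (I \<inter> {..<N}) x = partial d (I \<inter> {..<N}) x" for N x by (intro sum.cong) auto
  then show ?thesis unfolding series_converges_def by (simp only:)
qed

lemma converges_unconditionally_cong:
  assumes "\<And>n. n \<in> I \<Longrightarrow> c n = d n" "series_converges_unconditionally D I e c f"
  shows "series_converges_unconditionally D I e d f"
proof -
  have "\<forall>\<^sub>F F in finite_subsets_at_top I.
      L2_norm D (\<lambda>x. f x - partial c F x) = L2_norm D (\<lambda>x. f x - partial d F x)"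
    unfolding eventually_finite_subsets_at_top
  proof (intro exI[of _ "{}"] conjI allI impI)
    fix F assume F: "finite F \<and> {} \<subseteq> F \<and> F \<subseteq> I"
    then have "partial c F x = partial d F x" for x using assms(1) by (intro sum.cong) auto
    then show "L2_norm D (\<lambda>x. f x - partial c F x) = L2_norm D (\<lambda>x. f x - partial d F x)" by (simp only:)
  qed auto
  then show ?thesis
    using assms(2) unfolding series_converges_unconditionally_def by (simp cong: tendsto_cong)
qed

lemma coefficients_unique:
  assumes f: "f \<in> L2_on D" and c: "series_converges D I e c f" and d: "series_converges D I e d f" and n: "n \<in> I"
  shows "c n = d n"
proof -
  let ?F = "\<lambda>N. I \<inter> {..<N}"
  have "(\<lambda>N. L2_norm D (\<lambda>x. f x - partial c (?F N) x) + L2_norm D (\<lambda>x. f x - partial d (?F N) x)) \<longlonglongrightarrow> 0 + 0"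
    using c d unfolding series_converges_def by (rule tendsto_add)
  moreover have "A * cmod (c n - d n) \<le> L2_norm D (\<lambda>x. f x - partial c (?F N) x) + L2_norm D (\<lambda>x. f x - partial d (?F N) x)"
    if "N \<ge> Suc n" for N
  proof -
    have F: "finite (?F N)" "?F N \<subseteq> I" by auto
    have "cmod (c n - d n) \<le> L2_set (\<lambda>n. cmod (c n - d n)) (?F N)"
      using n that by (intro member_le_L2_set) auto
    then have "A * cmod (c n - d n) \<le> A * L2_set (\<lambda>n. cmod (c n - d n)) (?F N)"
      using A by (intro mult_left_mono) auto
    also have "\<dots> \<le> L2_norm D (\<lambda>x. partial c (?F N) x - partial d (?F N) x)"
      unfolding partial_diff by (rule lower[OF F])
    also have "\<dots> \<le> L2_norm D (\<lambda>x. partial c (?F N) x - f x) + L2_norm D (\<lambda>x. f x - partial d (?F N) x)"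
      by (intro L2_norm_dist_triangle partial_L2 f F)
    finally show ?thesis by (subst L2_norm_minus_commute)
  qed
  ultimately have "A * cmod (c n - d n) \<le> 0"
    by (intro LIMSEQ_le_const[where X = "\<lambda>N. L2_norm D (\<lambda>x. f x - partial c (?F N) x) + L2_norm D (\<lambda>x. f x - partial d (?F N) x)"])
       auto
  then have "cmod (c n - d n) \<le> 0" using A by (simp add: mult_le_0_iff)
  then show ?thesis by simp
qed

theorem unconditional_basis: "unconditional_schauder_basis D I e"
  unfolding unconditional_schauder_basis_def schauder_basis_def
proof (intro conjI ballI allI impI e_L2)
  fix f assume f: "f \<in> L2_on D"
  obtain c where c: "series_converges_unconditionally D I e c f"
    using ex_unconditional_expansion[OF f] by blast
  note c' = unconditional_imp_converges[OF c]
  show "\<exists>!c. c \<in> extensional I \<and> series_converges D I e c f"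
  proof (rule ex1I[of _ "restrict c I"])
    show "restrict c I \<in> extensional I \<and> series_converges D I e (restrict c I) f"
      using c' converges_cong[of "restrict c I" c f] by simp
    fix d assume d: "d \<in> extensional I \<and> series_converges D I e d f"
    then show "d = restrict c I"
      using coefficients_unique[OF f _ c', of d] by (intro extensionalityI[of _ I]) auto
  qed
  fix d assume "series_converges D I e d f"
  then show "series_converges_unconditionally D I e d f"
    using coefficients_unique[OF f c', of d] c by (intro converges_unconditionally_cong[of c d]) auto
qed

end

lemma exponentials_eq: "exponentials \<Gamma> = expo ` \<Gamma>"
  by (simp add: exponentials_def expo_def[abs_def])

text \<open>At \<open>x = 1 / (2 (\<nu> - \<mu>))\<close> two exponentials with different frequencies have opposite signs.\<close>

lemma inj_expo: "inj expo"
proof (rule injI, rule ccontr)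
  fix \<nu> \<mu> assume eq: "expo \<nu> = expo \<mu>" and ne: "\<nu> \<noteq> \<mu>"
  define x where "x = 1 / (2 * (\<nu> - \<mu>))"
  have "expo (\<nu> - \<mu>) x = expo \<nu> x * cnj (expo \<mu> x)"
    by (simp add: cnj_expo flip: expo_add)
  also have "\<dots> = 1" by (simp add: eq)
  finally have "(\<nu> - \<mu>) * x \<in> \<int>" by (simp add: expo_eq_1_iff)
  moreover have "(\<nu> - \<mu>) * x = 1 / 2" using ne by (simp add: x_def)
  ultimately have "(1 / 2 :: real) \<in> \<int>" by simp
  then show False by simp
qed

text \<open>
  Since the frequencies are part of an orthogonal basis of the larger interval, restricting sums to
  \<open>D\<close> gives the upper Riesz bound. The frequencies are enumerated by natural numbers in any way.
\<close>

theorem exponential_basisI: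
  assumes T: "T > 0" and \<Gamma>: "\<Gamma> \<subseteq> {of_int k / T | k. True}"
    and D: "D \<in> lmeasurable" "D \<subseteq> {0..T}"
    and bb: "bounded_below_on D \<Gamma>" and comp: "complete_on D \<Gamma>"
  shows "exponential_basis D (exponentials \<Gamma>)"
proof -
  have "countable {of_int k / T | k :: int. True}"
    unfolding full_SetCompr_eq simp_thms by (rule countable_image) simp
  then have "countable \<Gamma>" using \<Gamma> countable_subset by blast
  then obtain h :: "real \<Rightarrow> nat" where h: "inj_on h \<Gamma>" by (rule countableE)
  define I where "I = h ` \<Gamma>"
  define g where "g = inv_into \<Gamma> h"
  have g: "bij_betw g I \<Gamma>"
    unfolding I_def g_def using h by (intro bij_betw_inv_into inj_on_imp_bij_betw)
  then have inj_g: "inj_on g F" if "F \<subseteq> I" for F using that by (meson bij_betw_imp_inj_on inj_on_subset)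
  have g_in: "g n \<in> \<Gamma>" if "n \<in> I" for n using g that by (auto simp: bij_betw_def)
  obtain A where A: "A > 0" "\<And>F c. finite F \<Longrightarrow> F \<subseteq> \<Gamma> \<Longrightarrow>
      A * L2_set (\<lambda>\<nu>. cmod (c \<nu>)) F \<le> L2_norm D (trig_poly F c)"
    using bb by (auto simp: bounded_below_on_def)
  have sum_eq: "(\<lambda>x. \<Sum>n\<in>F. c n * expo (g n) x) = trig_poly (g ` F) (\<lambda>\<nu>. c (inv_into F g \<nu>))"
    and set_eq: "L2_set (\<lambda>n. cmod (c n)) F = L2_set (\<lambda>\<nu>. cmod (c (inv_into F g \<nu>))) (g ` F)"
    if "F \<subseteq> I" for F c
    using inj_g[OF that] by (simp_all add: trig_poly_def[abs_def] L2_set_def sum.reindex)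
  interpret riesz_basis D I "\<lambda>n. expo (g n)" A "sqrt T"
  proof
    show "expo (g n) \<in> L2_on D" for n using D(1) by (rule expo_in_L2)
    show "A > 0" "sqrt T \<ge> 0" using A T by auto
  next
    fix F c assume F: "finite F" "F \<subseteq> I"
    have gF: "finite (g ` F)" "g ` F \<subseteq> \<Gamma>" using F g_in by auto
    show "A * L2_set (\<lambda>n. cmod (c n)) F \<le> L2_norm D (\<lambda>x. \<Sum>n\<in>F. c n * expo (g n) x)"
      unfolding sum_eq[OF F(2)] set_eq[OF F(2)] by (rule A(2)[OF gF])
    have "L2_norm D (trig_poly (g ` F) d) \<le> L2_norm {0..T} (trig_poly (g ` F) d)" for d
      using D by (intro L2_norm_mono trig_poly_in_L2) auto
    also have "L2_norm {0..T} (trig_poly (g ` F) d) = sqrt T * L2_set (\<lambda>\<nu>. cmod (d \<nu>)) (g ` F)" for d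
    proof (rule parseval_scaled[OF gF(1) _ T])
      fix \<nu> assume "\<nu> \<in> g ` F"
      then obtain k :: int where "\<nu> = of_int k / T" using gF(2) \<Gamma> by blast
      then show "T * \<nu> \<in> \<int>" using T by simp
    qed
    finally show "L2_norm D (\<lambda>x. \<Sum>n\<in>F. c n * expo (g n) x) \<le> sqrt T * L2_set (\<lambda>n. cmod (c n)) F"
      unfolding sum_eq[OF F(2)] set_eq[OF F(2)] .
  next
    fix f and \<epsilon> :: real assume "f \<in> L2_on D" "\<epsilon> > 0"
    then obtain p where p: "p \<in> trig_span \<Gamma>" "L2_norm D (\<lambda>x. f x - p x) < \<epsilon>"
      using complete_onE[OF comp] by metis
    then obtain G d where G: "finite G" "G \<subseteq> \<Gamma>" "p = trig_poly G d" by (auto simp: trig_span_def)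
    have "G \<subseteq> g ` I" using G(2) g by (simp add: bij_betw_def)
    from finite_subset_image[OF G(1) this] obtain F where F: "F \<subseteq> I" "finite F" "G = g ` F" by blast
    have p_eq: "p = (\<lambda>x. \<Sum>n\<in>F. d (g n) * expo (g n) x)"
      using inj_g[OF F(1)] by (simp add: G(3) F(3) trig_poly_def[abs_def] sum.reindex)
    show "\<exists>F c. finite F \<and> F \<subseteq> I \<and> L2_norm D (\<lambda>x. f x - (\<Sum>n\<in>F. c n * expo (g n) x)) < \<epsilon>"
      using F p(2) unfolding p_eq by (intro exI[of _ F] exI[of _ "\<lambda>n. d (g n)"]) simp
  qed
  have "bij_betw expo \<Gamma> (expo ` \<Gamma>)"
    by (rule inj_on_imp_bij_betw[OF inj_on_subset[OF inj_expo]]) simp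
  from bij_betw_trans[OF g this] have "bij_betw (expo \<circ> g) I (expo ` \<Gamma>)" .
  then have "bij_betw (\<lambda>n. expo (g n)) I (exponentials \<Gamma>)" by (simp add: exponentials_eq o_def)
  then show ?thesis
    unfolding exponential_basis_def using unconditional_basis by (intro conjI exI) auto
qed

section \<open>The complement of a rearranged unit interval\<close>

theorem theorem1p2:
  fixes m :: nat and a b :: "nat \<Rightarrow> real" and \<beta> \<Delta> :: real and J \<Lambda> :: "real set"
  assumes "m \<ge> 1"
    and "a 0 = 0" and "a m = 1" and "strict_mono_on {..m} a"
    and "b 0 = 0" and "strict_mono_on {..<m} b"
    and "\<beta> \<ge> 1"
    and "J = (\<Union>j<m. {a j + b j ..< a (Suc j) + b j})"
    and "\<Lambda> = {of_int n + delta_star \<beta> n | n :: int. True}"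
    and "\<Delta> = of_int \<lceil>(1 + b (m - 1)) / \<beta>\<rceil> * \<beta>"
    and "\<forall>k\<in>{1..<m}. b k / \<beta> \<in> \<int>"
  shows "exponential_basis ({0..\<Delta>} - J) (exponentials ({of_int k / \<Delta> | k :: int. True} - \<Lambda>))"
proof -
  define N where "N = \<lceil>(1 + b (m - 1)) / \<beta>\<rceil>"
  define P where "P j = {a j ..< a (Suc j)}" for j
  have \<beta>: "\<beta> > 0" using assms(7) by simp
  have \<Lambda>: "\<Lambda> = rounded_multiples \<beta>" by (simp add: assms(9) rounded_multiples_def)
  have a_mono: "a i \<le> a j" if "i \<le> j" "j \<le> m" for i j
    using strict_mono_onD[OF assms(4), of i j] that by (cases "i = j") auto
  have b_mono: "b i \<le> b j" if "i \<le> j" "j < m" for i j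
    using strict_mono_onD[OF assms(6), of i j] that by (cases "i = j") auto
  have b_nonneg: "b j \<ge> 0" if "j < m" for j using b_mono[of 0 j] that assms(5) by simp
  have shift: "(+) (b j) ` P j = {a j + b j ..< a (Suc j) + b j}" for j
    by (simp add: P_def add.commute)
  have J: "J = (\<Union>j<m. (+) (b j) ` P j)" by (simp add: assms(8) shift)
  have \<Delta>: "\<Delta> \<ge> 1 + b (m - 1)"
  proof -
    have "(1 + b (m - 1)) / \<beta> \<le> of_int N" unfolding N_def by (rule le_of_int_ceiling)
    then show ?thesis unfolding assms(10) N_def[symmetric] pos_divide_le_eq[OF \<beta>] .
  qed
  have \<Delta>_pos: "\<Delta> > 0" using \<Delta> b_nonneg[of "m - 1"] assms(1) by simp
  have J_sub: "J \<subseteq> {0..\<Delta>}"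
  proof
    fix x assume "x \<in> J"
    then obtain j where j: "j < m" "a j + b j \<le> x" "x < a (Suc j) + b j" by (auto simp: assms(8))
    have "a 0 \<le> a j" "a (Suc j) \<le> a m" "b j \<le> b (m - 1)" using j(1) by (auto intro!: a_mono b_mono)
    then show "x \<in> {0..\<Delta>}" using j b_nonneg[OF j(1)] assms(2,3) \<Delta> by auto
  qed
  have J_meas: "J \<in> sets lebesgue" unfolding assms(8) by (intro sets.finite_UN) auto
  have union: "(\<Union>j<n. P j) = {0..<a n}" if "n \<le> m" for n
    using that
  proof (induction n)
    case (Suc n)
    have "{0..<a n} \<union> P n = {0..<a (Suc n)}"
      using a_mono[of 0 n] a_mono[of n "Suc n"] Suc.prems assms(2) by (auto simp: P_def)
    then show ?case using Suc by (simp add: lessThan_Suc Un_commute)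
  qed (simp add: assms(2))
  \<comment> \<open>\<open>J\<close> is the rearrangement of \<open>[0,1)\<close> by the periods \<open>b j\<close> of the exponentials.\<close>
  interpret R: rearrangement m P b "rounded_multiples \<beta>"
  proof
    show "P j \<in> sets lebesgue" for j by (simp add: P_def)
    have sep: "a (Suc i) \<le> a j" "b i \<le> b j" if "i < j" "j < m" for i j
      using that by (auto intro!: a_mono b_mono)
    have less: "P i \<inter> P j = {} \<and> (+) (b i) ` P i \<inter> (+) (b j) ` P j = {}" if "i < j" "j < m" for i j
      unfolding shift using sep[OF that] by (auto simp: P_def)
    have "P i \<inter> P j = {} \<and> (+) (b i) ` P i \<inter> (+) (b j) ` P j = {}" if "i \<noteq> j" "i < m" "j < m" for i j
      using less[of i j] less[of j i] that by (metis Int_commute linorder_neqE_nat)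
    then show "disjoint_family_on P {..<m}" "disjoint_family_on (\<lambda>j. (+) (b j) ` P j) {..<m}"
      by (auto simp: disjoint_family_on_def)
    fix j \<nu> assume j: "j < m" and "\<nu> \<in> rounded_multiples \<beta>"
    then obtain r :: int where r: "\<nu> = of_int r / \<beta>" using rounded_multiples_subset[OF \<beta>] by blast
    have "b j / \<beta> \<in> \<int>" using assms(5,11) j by (cases "j = 0") auto
    then have "of_int r * (b j / \<beta>) \<in> \<int>" by (intro Ints_mult) auto
    then show "\<nu> * b j \<in> \<int>" by (simp add: r)
  qed
  have U: "(\<Union>j<m. P j) = {0..<1}" using union[of m] assms(3) by simp
  have J_lmeas: "J \<in> lmeasurable"
    using bounded_set_imp_lmeasurable[OF bounded_subset[OF bounded_closed_interval J_sub] J_meas] .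
  have riesz_J: "bounded_below_on J \<Lambda>" "complete_on J \<Lambda>"
    using R.bounded_below_on_rearranged R.complete_on_rearranged rounded_multiples_riesz[OF assms(7)] J_lmeas
    unfolding U \<Lambda> J by blast+
  \<comment> \<open>Passing to complements inside \<open>[0,\<Delta>]\<close>.\<close>
  interpret C: complementary_frequencies \<Delta> "{of_int k / \<Delta> | k :: int. True}" \<Lambda> J
  proof
    show "\<Lambda> \<subseteq> {of_int k / \<Delta> | k :: int. True}"
    proof
      fix \<nu> assume "\<nu> \<in> \<Lambda>"
      then obtain r :: int where "\<nu> = of_int r / \<beta>" using rounded_multiples_subset[OF \<beta>] \<Lambda> by blast
      moreover have "of_int r / \<beta> = of_int (r * N) / \<Delta>"
        using \<Delta>_pos \<beta> unfolding assms(10) N_def[symmetric] by (auto simp: zero_less_mult_iff)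
      ultimately show "\<nu> \<in> {of_int k / \<Delta> | k :: int. True}" by blast
    qed
  qed (use \<Delta>_pos J_meas J_sub in auto)
  show ?thesis
    using C.bounded_below_on_complement[OF riesz_J] C.complete_on_complement[OF riesz_J(1)]
    by (intro exponential_basisI[OF \<Delta>_pos _ C.D_meas]) auto
qed

end
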